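(* Let $n\ge1$, let $m$ be a positive integer, and let $\eta$ be a vector of integers in $\mathcal A^{\tilde C_n}_m=\{(x_1,\dots,x_n): m>x_1>\dots>x_n>0\}$. Define $$P_k=\frac{2^{2n^2-n}}{m^n}\left(\frac{2\sin\frac{n\pi}{2m}\cos\frac{(n+1)\pi}{2m}}{\sin\frac{\pi}{2m}}\right)^k\prod_{1\le h<t\le n}\left(\sin\frac{\pi(\eta_h-\eta_t)}{2m}\sin\frac{\pi(t-h)}{2m}\right)\prod_{1\le h\le t\le n}\left(\sin\frac{\pi(\eta_t+\eta_h)}{2m}\sin\frac{\pi(t+h)}{2m}\right),$$ $$Q=\prod_{h=0}^n\prod_{t=1}^n\frac{\sin\frac{\pi(t-h+m-1)}{2m}}{\sin\frac{\pi(t-h+n)}{2m}},\qquad \Delta=\prod_{h=1}^{n+1}\prod_{t=1}^n\left|\sin\frac{(2t-2h+1)\pi}{2m}\right|.$$ Then, as $k\to\infty$, the number of walks which start at $\eta$, consist of exactly $k$ standard steps (arbitrary end point), and stay in $\mathcal A^{\tilde C_n}_m$ is asymptotically: $P_k\Big(Q+(-1)^{|\eta|+k+\frac n2}2^{-n^2}\Delta^{-1}\prod_{h=1}^{n/2}\tan^2\frac{(2h-1)\pi}{2m}\Big)$ if $m,n$ are both even; $P_k\Big(Q+(-1)^{|\eta|+k+\frac{n+1}2}2^{-n^2}\Delta^{-1}\prod_{h=1}^{(n+1)/2}\tan^2\frac{(2h-1)\pi}{2m}\Big)$ if $m$ is even and $n$ is odd; $P_k\Big(Q+(-1)^{|\eta|+k+\frac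 n2}2^{-n^2}\Delta^{-1}\prod_{h=1}^{n/2}\frac{\sin^2\frac{(2h-1)\pi}{2m}}{\cos^2\frac{h\pi}{m}}\Big)$ if $m$ is odd and $n$ is even; $P_kQ$ if $m,n$ are both odd.
   Context: For $\eta\in\mathbb R^n$, $|\eta|=\eta_1+\dots+\eta_n$. A walk with $k$ standard steps is a sequence $p_0,\dots,p_k$ with $p_i-p_{i-1}\in\{\pm e_1,\dots,\pm e_n\}$; it stays in $R$ if all $p_i\in R$. "Asymptotically $E$" means the ratio of the count to $E$ tends to $1$. *)

theory Defs
  imports Complex_Main "HOL-Library.Landau_Symbols"
begin

(* asymp_equiv reads 0 / 0 as 1. This matters only for m = n + 1: the alcove then has a single
   lattice point, and both the number of walks and P_factor vanish for k >= 1. *)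
unbundle asymp_equiv_syntax

(* Since the dimension n is a number, points of R^n are functions nat => real that use the
   coordinates 1, ..., n and vanish at every other index. *)
definition Rn :: "nat \<Rightarrow> (nat \<Rightarrow> real) set" where
  "Rn n = {x. \<forall>i. i \<notin> {1..n} \<longrightarrow> x i = 0}"

definition unit_vec :: "nat \<Rightarrow> nat \<Rightarrow> real" where
  "unit_vec j = (\<lambda>i. if i = j then 1 else 0)"

definition standard_steps :: "nat \<Rightarrow> (nat \<Rightarrow> real) set" where
  "standard_steps n = (\<Union>j\<in>{1..n}. {unit_vec j, - unit_vec j})"

definition alcove_C :: "nat \<Rightarrow> nat \<Rightarrow> (nat \<Rightarrow> real) set" where
  "alcove_C n m = {x \<in> Rn n. real m > x 1 \<and> (\<forall>i\<in>{1..<n}. x i > x (Suc i)) \<and> x n > 0}"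

(* The list entries p ! 0, ..., p ! k are the points p_0, ..., p_k of the walk. *)
definition walks ::
  "nat \<Rightarrow> (nat \<Rightarrow> real) set \<Rightarrow> (nat \<Rightarrow> real) \<Rightarrow> nat \<Rightarrow> (nat \<Rightarrow> real) list set" where
  "walks n R a k = {p. length p = k + 1 \<and> p ! 0 = a \<and>
     (\<forall>i<k. p ! Suc i - p ! i \<in> standard_steps n) \<and> (\<forall>i\<le>k. p ! i \<in> R)}"

definition P_factor :: "nat \<Rightarrow> nat \<Rightarrow> (nat \<Rightarrow> int) \<Rightarrow> nat \<Rightarrow> real" where
  "P_factor n m \<eta> k =
     2 powi (2 * int n ^ 2 - int n) / real m ^ n *
     (2 * sin (real n * pi / (2 * real m)) * cos ((real n + 1) * pi / (2 * real m)) /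
        sin (pi / (2 * real m))) ^ k *
     (\<Prod>(h, t) \<in> {(h, t). 1 \<le> h \<and> h < t \<and> t \<le> n}.
        sin (pi * real_of_int (\<eta> h - \<eta> t) / (2 * real m)) *
        sin (pi * (real t - real h) / (2 * real m))) *
     (\<Prod>(h, t) \<in> {(h, t). 1 \<le> h \<and> h \<le> t \<and> t \<le> n}.
        sin (pi * real_of_int (\<eta> t + \<eta> h) / (2 * real m)) *
        sin (pi * (real t + real h) / (2 * real m)))"

definition Q_factor :: "nat \<Rightarrow> nat \<Rightarrow> real" where
  "Q_factor n m =
     (\<Prod>h = 0..n. \<Prod>t = 1..n.
        sin (pi * (real t - real h + real m - 1) / (2 * real m)) /
        sin (pi * (real t - real h + real n) / (2 * real m)))"

definition Delta_factor :: "nat \<Rightarrow> nat \<Rightarrow> real" where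
  "Delta_factor n m =
     (\<Prod>h = 1..n + 1. \<Prod>t = 1..n.
        \<bar>sin ((2 * real t - 2 * real h + 1) * pi / (2 * real m))\<bar>)"

end

theory Submission
  imports Defs "HOL-Computational_Algebra.Polynomial" "HOL-Library.FuncSet"
begin

text \<open>
  Reflection turns the count into an antisymmetric function of the starting point, which is expanded in
  the sine basis of \<open>{1..m-1}\<^sup>n\<close>. Only the frequency sets \<open>{1..n}\<close> and
  \<open>{m-n..m-1}\<close>, with eigenvalues \<open>\<mu>\<close> and \<open>-\<mu>\<close>, contribute to the leading order. Their
  coefficients need the sum, over all end points, of an alternant of sines. The sign of an ordering is a
  Pfaffian, so this sum obeys Pfaffian-type row expansions; by the symmetry \<open>x \<mapsto> m - x\<close> an entry
  of the expansion vanishes unless its two frequencies have opposite parity, and the surviving entries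
  are of Cauchy type. Lagrange interpolation in the cosines then gives a product formula, valid for any
  frequency set with balanced parities. For the two dominant sets it is matched with the stated products
  by induction on \<open>n\<close>.
\<close>

section \<open>Order signs\<close>

text \<open>In each formula of the theorem the bracket is \<open>Q\<close> times 1 + (-1)^k s t with
  a sign s: \<open>Q\<close> and 2^(-n^2) / \<Delta> are the same number, and t is the ratio of the
  end-point sums of the two dominant frequency sets. Since the eigenvalues \<mu> and -\<mu> have
  equal modulus, the normalised count oscillates and need not converge, so exact coefficients alone
  do not suffice: for n + 1 < m one also needs t < 1, to keep the coefficient away from 0. The
  mirror r -> m - r exchanges the two sets. It preserves parities for even m and exchanges them for
  odd m, whence the two kinds of products. For m and n both odd the mirrored set has more even than
  odd frequencies, its end-point sum is 0, and the oscillating term disappears. No Pfaffian is ever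
  formed. The row expansions determine the end-point sum by induction, so it is enough that the
  product formula satisfies them, and this is what Lagrange's formula verifies.\<close>

definition pair_prod :: "'i::linorder set \<Rightarrow> ('i \<Rightarrow> 'i \<Rightarrow> real) \<Rightarrow> real" where
  "pair_prod I h = (\<Prod>i\<in>I. \<Prod>j\<in>{j\<in>I. i < j}. h i j)"

definition rank_sign :: "'i::linorder \<Rightarrow> 'i set \<Rightarrow> real" where
  "rank_sign k I = (-1) ^ card {i\<in>I. i < k}"

text \<open>The value is 1 on strictly decreasing \<open>y\<close>, the order of coordinates in the
  alcove, and 0 as soon as two entries agree. An increasing list of length n therefore has sign
  (-1)^(n(n-1)/2), which is why the sign of the identity map enters later formulas.\<close>

definition order_sign :: "'i::linorder set \<Rightarrow> ('i \<Rightarrow> int) \<Rightarrow> real" where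
  "order_sign I y = pair_prod I (\<lambda>i j. sgn (real_of_int (y i) - real_of_int (y j)))"

lemma rank_sign_sq [simp]: "rank_sign k I * rank_sign k I = 1"
  by (simp add: rank_sign_def flip: power_add)

lemma pair_prod_empty [simp]: "pair_prod {} h = 1"
  by (simp add: pair_prod_def)

lemma pair_prod_cong:
  assumes "I = J" "\<And>i j. i \<in> J \<Longrightarrow> j \<in> J \<Longrightarrow> i < j \<Longrightarrow> h i j = g i j"
  shows "pair_prod I h = pair_prod J g"
  unfolding pair_prod_def using assms by (auto intro!: prod.cong)

lemma pair_prod_mult: "pair_prod I (\<lambda>i j. h i j * g i j) = pair_prod I h * pair_prod I g"
  by (simp add: pair_prod_def prod.distrib)

lemma pair_prod_remove:
  assumes "finite I" "k \<in> I"
  shows "pair_prod I h = pair_prod (I - {k}) h * ((\<Prod>i\<in>{i\<in>I. i < k}. h i k) * (\<Prod>j\<in>{j\<in>I. k < j}. h k j))"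
proof -
  have *: "(\<Prod>j\<in>{j\<in>I. i < j}. h i j) =
      (\<Prod>j\<in>{j\<in>I - {k}. i < j}. h i j) * (if i < k then h i k else 1)" if "i \<in> I" for i
  proof (cases "i < k")
    case True
    have "{j\<in>I. i < j} = insert k {j\<in>I - {k}. i < j}" using True assms by auto
    then show ?thesis using True assms by simp
  next
    case False
    then have "{j\<in>I. i < j} = {j\<in>I - {k}. i < j}" by auto
    then show ?thesis using False by simp
  qed
  have "pair_prod I h = (\<Prod>j\<in>{j\<in>I. k < j}. h k j) *
      (\<Prod>i\<in>I-{k}. (\<Prod>j\<in>{j\<in>I - {k}. i < j}. h i j) * (if i < k then h i k else 1))"
    unfolding pair_prod_def using assms by (subst prod.remove[of _ k]) (auto simp: * intro!: prod.cong)
  also have "\<dots> = (\<Prod>j\<in>{j\<in>I. k < j}. h k j) * (pair_prod (I-{k}) h * (\<Prod>i\<in>I-{k}. (if i < k then h i k else 1)))"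
    by (simp add: pair_prod_def prod.distrib)
  also have "(\<Prod>i\<in>I-{k}. (if i < k then h i k else 1)) = (\<Prod>i\<in>{i\<in>I. i < k}. h i k)"
    using assms by (intro prod.mono_neutral_cong_right) auto
  finally show ?thesis by (simp add: mult_ac)
qed

lemma prod_split_at:
  assumes "finite I" "k \<in> (I :: 'i::linorder set)"
  shows "(\<Prod>j\<in>I-{k}. h j) = (\<Prod>i\<in>{i\<in>I. i < k}. h i) * (\<Prod>j\<in>{j\<in>I. k < j}. (h j :: real))"
proof -
  have *: "I - {k} = {i\<in>I. i < k} \<union> {j\<in>I. k < j}" by auto
  show ?thesis unfolding * by (rule prod.union_disjoint) (use assms in auto)
qed

text \<open>Factors with \<open>k\<close> in second place are turned around, at the cost of one sign
  for each element below \<open>k\<close>.\<close>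

lemma pair_prod_remove_anti:
  assumes "finite I" "k \<in> I" "\<And>i. i \<in> I \<Longrightarrow> i < k \<Longrightarrow> h i k = - h k i"
  shows "pair_prod I h = rank_sign k I * (\<Prod>j\<in>I-{k}. h k j) * pair_prod (I - {k}) h"
proof -
  have "(\<Prod>i\<in>{i\<in>I. i < k}. h i k) = (\<Prod>i\<in>{i\<in>I. i < k}. (-1) * h k i)"
    using assms by (intro prod.cong) auto
  also have "\<dots> = rank_sign k I * (\<Prod>i\<in>{i\<in>I. i < k}. h k i)"
    unfolding prod.distrib by (simp add: rank_sign_def)
  finally show ?thesis
    using assms by (simp add: pair_prod_remove[of I k] prod_split_at mult_ac)
qed

lemma pair_prod_remove_sym:
  assumes "finite I" "k \<in> I" "\<And>i. i \<in> I \<Longrightarrow> i < k \<Longrightarrow> h i k = h k i"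
  shows "pair_prod I h = (\<Prod>j\<in>I-{k}. h k j) * pair_prod (I - {k}) h"
proof -
  have "(\<Prod>i\<in>{i\<in>I. i < k}. h i k) = (\<Prod>i\<in>{i\<in>I. i < k}. h k i)"
    using assms by (intro prod.cong) auto
  then show ?thesis
    using assms by (simp add: pair_prod_remove[of I k] prod_split_at mult_ac)
qed

text \<open>For symmetric \<open>h\<close> the product runs over unordered pairs, so
  \<open>r\<close> may scramble the order.\<close>

lemma pair_prod_reindex:
  assumes "finite I" "inj_on r I" "\<And>a b. h a b = h b a"
  shows "pair_prod I (\<lambda>i j. h (r i) (r j)) = pair_prod (r ` I) h"
  using assms(1,2)
proof (induction I rule: finite_induct)
  case (insert k I)
  have im: "r ` insert k I - {r k} = r ` I" using insert by auto
  have "pair_prod (insert k I) (\<lambda>i j. h (r i) (r j)) =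
      (\<Prod>j\<in>I. h (r k) (r j)) * pair_prod I (\<lambda>i j. h (r i) (r j))"
    using insert(1,2) pair_prod_remove_sym[of "insert k I" k "\<lambda>i j. h (r i) (r j)"] by (simp add: assms(3))
  also have "\<dots> = (\<Prod>j\<in>r`I. h (r k) j) * pair_prod (r ` I) h"
    using insert by (simp add: prod.reindex)
  also have "\<dots> = pair_prod (r ` insert k I) h"
    using insert(1) pair_prod_remove_sym[of "r ` insert k I" "r k" h, unfolded im] by (simp add: assms(3))
  finally show ?case .
qed simp

lemma order_sign_cong: "(\<And>i. i \<in> I \<Longrightarrow> y i = z i) \<Longrightarrow> order_sign I y = order_sign I z"
  unfolding order_sign_def by (intro pair_prod_cong) auto

lemma order_sign_remove:
  assumes "finite I" "k \<in> I"
  shows "order_sign I y = rank_sign k I * (\<Prod>j\<in>I-{k}. sgn (real_of_int (y k) - real_of_int (y j))) * order_sign (I - {k}) y"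
  unfolding order_sign_def by (rule pair_prod_remove_anti) (use assms in \<open>auto simp: sgn_if\<close>)

lemma order_sign_eq_0:
  assumes "finite I" "a \<in> I" "b \<in> I" "a \<noteq> b" "y a = y b"
  shows "order_sign I y = 0"
proof -
  have "(\<Prod>j\<in>I-{a}. sgn (real_of_int (y a) - real_of_int (y j))) = 0"
    using assms by (intro prod_zero bexI[of _ b]) auto
  then show ?thesis using assms by (simp add: order_sign_remove[of I a])
qed

lemma order_sign_not_inj:
  assumes "finite I" "\<not> inj_on y I"
  shows "order_sign I y = 0"
proof -
  from assms(2) obtain a b where "a \<in> I" "b \<in> I" "a \<noteq> b" "y a = y b"
    unfolding inj_on_def by blast
  then show ?thesis by (intro order_sign_eq_0[of I a b] assms)
qed

lemma order_sign_sq: "finite I \<Longrightarrow> inj_on y I \<Longrightarrow> (order_sign I y)\<^sup>2 = 1"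
proof (induction I rule: finite_induct)
  case (insert k I)
  have "(\<Prod>j\<in>I. sgn (real_of_int (y k) - real_of_int (y j)))\<^sup>2 = (\<Prod>j\<in>I. 1)"
    unfolding prod_power_distrib using insert by (intro prod.cong) (auto simp: sgn_if)
  moreover have "order_sign (insert k I) y = rank_sign k (insert k I) * (\<Prod>j\<in>I. sgn (real_of_int (y k) - real_of_int (y j))) * order_sign I y"
    using insert(1,2) order_sign_remove[of "insert k I" k y] by simp
  moreover have "(rank_sign k (insert k I))\<^sup>2 = 1" by (simp add: power2_eq_square)
  moreover have "(order_sign I y)\<^sup>2 = 1" using insert by simp
  ultimately show ?case by (simp add: power_mult_distrib)
qed (simp add: order_sign_def)

text \<open>Multiplying the signs of a pair under \<open>r\<close> and under \<open>y\<close> gives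
  a symmetric factor, so the product depends only on the image set. This is multiplicativity of
  permutation signs; the sign of the identity on the image accounts for listing it in increasing
  order.\<close>

lemma order_sign_comp:
  assumes "finite I" "inj_on r I"
  shows "order_sign I (\<lambda>i. y (r i)) = order_sign I r * (order_sign (r ` I) (\<lambda>a. a) * order_sign (r ` I) y)"
proof -
  define h where "h = (\<lambda>a b. sgn (real_of_int a - real_of_int b) * sgn (real_of_int (y a) - real_of_int (y b)))"
  have anti: "sgn (u - v) = - sgn (v - u)" for u v :: real
    by (simp flip: sgn_minus)
  have "h a b = h b a" for a b
    unfolding h_def by (subst (1 2) anti) simp
  then have "pair_prod I (\<lambda>i j. h (r i) (r j)) = pair_prod (r ` I) h"
    using assms pair_prod_reindex[of I r h] by blast
  also have "\<dots> = order_sign (r ` I) (\<lambda>a. a) * order_sign (r ` I) y"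
    by (simp add: h_def pair_prod_mult order_sign_def)
  also have "pair_prod I (\<lambda>i j. h (r i) (r j)) = order_sign I r * order_sign I (\<lambda>i. y (r i))"
    by (simp add: h_def pair_prod_mult order_sign_def)
  finally have "order_sign I r * (order_sign (r ` I) (\<lambda>a. a) * order_sign (r ` I) y) = (order_sign I r)\<^sup>2 * order_sign I (\<lambda>i. y (r i))"
    by (simp add: power2_eq_square)
  then show ?thesis using order_sign_sq[OF assms] by simp
qed

text \<open>Removing the smaller element first lowers the rank of the larger by one, while removing
  the larger first leaves the rank of the smaller alone.\<close>

lemma rank_sign_remove:
  assumes "finite I" "a \<in> I" "b \<in> I" "a \<noteq> b"
  shows "rank_sign a I * rank_sign b (I - {a}) = - (rank_sign b I * rank_sign a (I - {b}))"
proof -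
  have *: "rank_sign a I * rank_sign b (I - {a}) = - (rank_sign b I * rank_sign a (I - {b}))" if "a < b" "a \<in> I" "b \<in> I" for a b
  proof -
    have 1: "{i \<in> I. i \<noteq> b \<and> i < a} = {i \<in> I. i < a}" using that by auto
    have 2: "{i \<in> I. i < b} = insert a {i \<in> I - {a}. i < b}" using that by auto
    show ?thesis unfolding rank_sign_def using assms(1) by (auto simp: 1 2 card_insert_if)
  qed
  show ?thesis
  proof (cases "a < b")
    case False
    then show ?thesis using *[of b a] assms by auto
  qed (use * assms in auto)
qed

text \<open>A new least element \<open>b\<close> does not alter how many elements lie above the old
  ones, so each induction step adds one term. If \<open>b < v\<close>, that term only switches the
  parity correction; otherwise all old elements exceed \<open>v\<close> and the product over them is
  (-1)^(card Y). The point of the identity is to linearise a product of signs.\<close>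

lemma sum_alternating_sgn:
  assumes "finite (Y :: int set)"
  shows "(\<Sum>u\<in>Y. sgn (real_of_int v - real_of_int u) * (-1) ^ card {w\<in>Y. u < w}) =
     (\<Prod>u\<in>Y. sgn (real_of_int v - real_of_int u)) - (if even (card Y) then 1 else 0)"
  using assms
proof (induction Y rule: finite_linorder_min_induct)
  case (insert b Y)
  have 1: "{w\<in>insert b Y. u < w} = {w\<in>Y. u < w}" if "u \<in> Y" for u using insert that by auto
  have 2: "{w\<in>insert b Y. b < w} = Y" using insert by auto
  have b: "b \<notin> Y" using insert by auto
  let ?g = "\<lambda>u. sgn (real_of_int v - real_of_int u)"
  have "(\<Sum>u\<in>insert b Y. ?g u * (-1) ^ card {w\<in>insert b Y. u < w}) =
    ?g b * (-1) ^ card {w\<in>insert b Y. b < w} + (\<Sum>u\<in>Y. ?g u * (-1) ^ card {w\<in>insert b Y. u < w})"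
    using insert(1) b by (rule sum.insert)
  also have "(\<Sum>u\<in>Y. ?g u * (-1) ^ card {w\<in>insert b Y. u < w}) = (\<Sum>u\<in>Y. ?g u * (-1) ^ card {w\<in>Y. u < w})"
    by (intro sum.cong refl) (simp only: 1)
  also note 2
  also have "sgn (real_of_int v - real_of_int b) * (-1) ^ card Y + (\<Sum>u\<in>Y. ?g u * (-1) ^ card {w\<in>Y. u < w}) = sgn (real_of_int v - real_of_int b) * (-1) ^ card Y +
     (\<Prod>u\<in>Y. sgn (real_of_int v - real_of_int u)) - (if even (card Y) then 1 else 0)"
    using insert.IH by simp
  also have "\<dots> = (\<Prod>u\<in>insert b Y. sgn (real_of_int v - real_of_int u)) - (if even (card (insert b Y)) then 1 else 0)"
  proof (cases "b < v")
    case True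
    then show ?thesis using insert b by (auto simp: sgn_if)
  next
    case False
    then have "(\<Prod>u\<in>Y. sgn (real_of_int v - real_of_int u)) = (\<Prod>u\<in>Y. -1)"
      using insert by (intro prod.cong) (auto simp: sgn_if dest!: bspec)
    then show ?thesis using False insert b by (auto simp: sgn_if)
  qed
  finally show ?case .
qed simp

text \<open>Adding a value \<open>v\<close> above all of \<open>Y\<close> turns the weights \<open>sgn (v - u)\<close> into 1.\<close>

lemma sum_alternating:
  assumes "finite (Y :: int set)"
  shows "(\<Sum>u\<in>Y. (-1) ^ card {w\<in>Y. u < w}) = (if odd (card Y) then 1 else 0 :: real)"
proof -
  obtain v where v: "\<And>u. u \<in> Y \<Longrightarrow> u < v"
    using assms by (metis Max_ge less_add_one order_le_less_trans)
  have "(\<Sum>u\<in>Y. sgn (real_of_int v - real_of_int u) * (-1) ^ card {w\<in>Y. u < w}) = (\<Sum>u\<in>Y. (-1) ^ card {w\<in>Y. u < w})"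
    by (intro sum.cong) (auto dest: v)
  moreover have "(\<Prod>u\<in>Y. sgn (real_of_int v - real_of_int u)) = 1" by (intro prod.neutral) (auto dest: v)
  ultimately show ?thesis using sum_alternating_sgn[OF assms, of v] by (auto split: if_splits)
qed

text \<open>For injective \<open>y\<close>, deleting index \<open>k\<close> changes the order sign,
  up to \<open>rank_sign\<close>, by the parity of the number of values above \<open>y k\<close>;
  the sum over indices thus becomes a sum over the set of values. If two values coincide, only the
  two deletions that break the tie can survive, and they cancel by
  \<open>rank_sign_remove\<close>.\<close>

lemma sum_rank_sign_order_sign:
  assumes "finite J"
  shows "(\<Sum>k\<in>J. rank_sign k J * h (y k) * order_sign (J - {k}) y) =
    order_sign J y * (\<Sum>u\<in>y ` J. h u * (-1) ^ card {w\<in>y ` J. u < w})"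
proof (cases "inj_on y J")
  case True
  have *: "rank_sign k J * order_sign (J - {k}) y = order_sign J y * (-1) ^ card {w\<in>y ` J. y k < w}" if "k \<in> J" for k
  proof -
    have "(\<Prod>j\<in>J-{k}. sgn (real_of_int (y k) - real_of_int (y j))) = (\<Prod>w\<in>y`J - {y k}. sgn (real_of_int (y k) - real_of_int w))"
    proof -
      have "y`J - {y k} = y ` (J - {k})" using True that by (auto simp: inj_on_def)
      then show ?thesis using inj_on_subset[OF True, of "J - {k}"] by (simp add: prod.reindex)
    qed
    also have "\<dots> = (\<Prod>w\<in>{w\<in>y ` J. y k < w}. -1)"
      using assms by (intro prod.mono_neutral_cong_right) (auto simp: sgn_if)
    finally have "order_sign J y = rank_sign k J * (-1) ^ card {w\<in>y ` J. y k < w} * order_sign (J - {k}) y"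
      using that assms by (subst order_sign_remove[of J k]) auto
    moreover have "((-1) ^ n * (-1) ^ n :: real) = 1" for n by (simp flip: power_add)
    ultimately show ?thesis by (simp add: mult_ac)
  qed
  have "(\<Sum>k\<in>J. rank_sign k J * h (y k) * order_sign (J - {k}) y) =
      (\<Sum>k\<in>J. order_sign J y * (h (y k) * (-1) ^ card {w\<in>y ` J. y k < w}))"
    by (intro sum.cong) (use * in \<open>auto simp: mult_ac\<close>)
  then show ?thesis using True by (simp add: sum.reindex sum_distrib_left)
next
  case False
  then obtain a b where ab: "a \<in> J" "b \<in> J" "a \<noteq> b" "y a = y b" by (auto simp: inj_on_def)
  have z: "order_sign (J - {k}) y = 0" if "k \<noteq> a" "k \<noteq> b" for k
    using that ab assms by (intro order_sign_eq_0[of _ a b]) auto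
  have "(\<Sum>k\<in>J. rank_sign k J * h (y k) * order_sign (J - {k}) y) = (\<Sum>k\<in>{a,b}. rank_sign k J * h (y k) * order_sign (J - {k}) y)"
    using ab assms z by (intro sum.mono_neutral_right) auto
  also have "\<dots> = h (y a) * (rank_sign a J * order_sign (J - {a}) y + rank_sign b J * order_sign (J - {b}) y)"
    using ab by (simp add: algebra_simps)
  also have "rank_sign a J * order_sign (J - {a}) y = (rank_sign a J * rank_sign b (J - {a})) * ((\<Prod>j\<in>J-{a}-{b}. sgn (real_of_int (y b) - real_of_int (y j))) * order_sign (J - {a} - {b}) y)"
    using ab assms by (subst order_sign_remove[of _ b]) auto
  also have "rank_sign b J * order_sign (J - {b}) y = (rank_sign b J * rank_sign a (J - {b})) * ((\<Prod>j\<in>J-{a}-{b}. sgn (real_of_int (y b) - real_of_int (y j))) * order_sign (J - {a} - {b}) y)"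
  proof -
    have "J-{b}-{a} = J-{a}-{b}" by auto
    then show ?thesis using ab assms by (subst order_sign_remove[of _ a]) auto
  qed
  also have "rank_sign a J * rank_sign b (J - {a}) = - (rank_sign b J * rank_sign a (J - {b}))"
    using rank_sign_remove ab assms by blast
  finally show ?thesis using order_sign_not_inj[OF assms False] by simp
qed

text \<open>Pfaffian expansion along a bordering row of ones, the usual way to complete an odd
  number of rows.\<close>

lemma order_sign_expand_odd:
  assumes "finite J" "odd (card J)"
  shows "order_sign J y = (\<Sum>k\<in>J. rank_sign k J * order_sign (J - {k}) y)"
proof -
  have "(\<Sum>k\<in>J. rank_sign k J * order_sign (J - {k}) y) = order_sign J y * (\<Sum>u\<in>y ` J. (-1) ^ card {w\<in>y ` J. u < w})"
    using sum_rank_sign_order_sign[OF assms(1), of "\<lambda>_. 1" y] by simp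
  also have "\<dots> = order_sign J y"
  proof (cases "inj_on y J")
    case True
    then show ?thesis using assms by (subst sum_alternating) (auto simp: card_image)
  qed (use order_sign_not_inj[of J y] assms in simp)
  finally show ?thesis ..
qed

text \<open>Expansion of the Pfaffian with entries sgn(y i - y j) along row \<open>e\<close>. It
  rests on \<open>sum_alternating_sgn\<close> at \<open>v = y e\<close>, whose parity correction is
  absent because an odd number of indices remains.\<close>

lemma order_sign_expand_even:
  assumes "finite I" "even (card I)" "e \<in> I"
  shows "order_sign I y = rank_sign e I * (\<Sum>k\<in>I-{e}. rank_sign k (I-{e}) * sgn (real_of_int (y e) - real_of_int (y k)) * order_sign (I - {e} - {k}) y)"
proof -
  let ?J = "I - {e}" and ?g = "\<lambda>u. sgn (real_of_int (y e) - real_of_int u)"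
  have "(\<Sum>k\<in>?J. rank_sign k ?J * ?g (y k) * order_sign (?J - {k}) y) =
      order_sign ?J y * (\<Sum>u\<in>y ` ?J. ?g u * (-1) ^ card {w\<in>y ` ?J. u < w})"
    using sum_rank_sign_order_sign[of ?J ?g y] assms(1) by simp
  also have "\<dots> = order_sign ?J y * (\<Prod>j\<in>?J. ?g (y j))"
  proof (cases "inj_on y ?J")
    case True
    have "odd (card (y ` ?J))"
      using assms True by (cases "card I") (auto simp: card_image)
    then have "(\<Sum>u\<in>y ` ?J. ?g u * (-1) ^ card {w\<in>y ` ?J. u < w}) = (\<Prod>u\<in>y ` ?J. ?g u)"
      using assms by (subst sum_alternating_sgn) auto
    then show ?thesis using True by (simp add: prod.reindex)
  qed (use order_sign_not_inj[of ?J y] assms in simp)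
  finally show ?thesis
    using assms by (subst order_sign_remove[of I e]) simp_all
qed

section \<open>Alternating sums\<close>

text \<open>The sum of all maximal minors of the matrix \<open>f\<close> with rows \<open>R\<close>
  and columns \<open>X\<close>, the columns taken in decreasing order. If \<open>X\<close> and
  \<open>R\<close> have equal size, it is a single determinant up to sign. The same notion thus
  serves for the sum over end points and for the alternant at the starting point.\<close>

definition alternating_sum :: "int set \<Rightarrow> ('i::linorder \<Rightarrow> int \<Rightarrow> real) \<Rightarrow> 'i set \<Rightarrow> real" where
  "alternating_sum X f R = (\<Sum>y\<in>R \<rightarrow>\<^sub>E X. order_sign R y * (\<Prod>i\<in>R. f i (y i)))"

lemma sum_PiE_remove:
  assumes "k \<in> J"
  shows "(\<Sum>y\<in>J \<rightarrow>\<^sub>E X. F y) = (\<Sum>x\<in>X. \<Sum>g\<in>(J - {k}) \<rightarrow>\<^sub>E X. F (g(k := x)))"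
proof -
  have "J \<rightarrow>\<^sub>E X = (\<lambda>(x, g). g(k := x)) ` (X \<times> ((J - {k}) \<rightarrow>\<^sub>E X))"
    using PiE_insert_eq[of k "J - {k}" "\<lambda>_. X"] assms by (simp add: insert_absorb)
  moreover have "inj_on (\<lambda>(x, g). g(k := x)) (X \<times> ((J - {k}) \<rightarrow>\<^sub>E X))"
    using inj_combinator[of k "J - {k}" "\<lambda>_. X"] by simp
  ultimately show ?thesis
    by (simp add: sum.reindex sum.cartesian_product case_prod_unfold)
qed

text \<open>In the expanded order sign nothing refers to coordinate \<open>k\<close> any more, so
  the summation over its value splits off as a row sum.\<close>

lemma alternating_sum_odd:
  assumes "finite J" "odd (card J)"
  shows "alternating_sum X f J = (\<Sum>k\<in>J. rank_sign k J * (\<Sum>x\<in>X. f k x) * alternating_sum X f (J - {k}))"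
proof -
  have "alternating_sum X f J = (\<Sum>y\<in>J \<rightarrow>\<^sub>E X. \<Sum>k\<in>J. rank_sign k J * order_sign (J - {k}) y * (\<Prod>i\<in>J. f i (y i)))"
    unfolding alternating_sum_def by (subst order_sign_expand_odd[OF assms]) (simp add: sum_distrib_right)
  also have "\<dots> = (\<Sum>k\<in>J. \<Sum>y\<in>J \<rightarrow>\<^sub>E X. rank_sign k J * order_sign (J - {k}) y * (\<Prod>i\<in>J. f i (y i)))"
    by (rule sum.swap)
  also have "\<dots> = (\<Sum>k\<in>J. rank_sign k J * (\<Sum>x\<in>X. f k x) * alternating_sum X f (J - {k}))"
  proof (rule sum.cong[OF refl])
    fix k assume k: "k \<in> J"
    have "order_sign (J - {k}) (g(k := x)) = order_sign (J - {k}) g" for g x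
      by (rule order_sign_cong) auto
    moreover have "(\<Prod>i\<in>J. f i ((g(k := x)) i)) = f k x * (\<Prod>i\<in>J-{k}. f i (g i))" for g x
      using k assms(1) by (subst prod.remove[of _ k]) auto
    ultimately have "(\<Sum>g\<in>(J - {k}) \<rightarrow>\<^sub>E X. rank_sign k J * order_sign (J - {k}) (g(k := x)) * (\<Prod>i\<in>J. f i ((g(k := x)) i))) =
        rank_sign k J * f k x * alternating_sum X f (J - {k})" for x
      unfolding alternating_sum_def by (simp only: sum_distrib_left mult_ac)
    then show "(\<Sum>y\<in>J \<rightarrow>\<^sub>E X. rank_sign k J * order_sign (J - {k}) y * (\<Prod>i\<in>J. f i (y i))) =
        rank_sign k J * (\<Sum>x\<in>X. f k x) * alternating_sum X f (J - {k})"
      unfolding sum_PiE_remove[OF k] by (simp only: sum_distrib_left sum_distrib_right)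
  qed
  finally show ?thesis .
qed

text \<open>Two coordinates are summed at once: after the expansion the only sign that involves
  either of them is their mutual one. Hence a pair of rows enters through an antisymmetric bilinear
  form.\<close>

lemma alternating_sum_even:
  assumes "finite I" "even (card I)" "e \<in> I"
  shows "alternating_sum X f I = rank_sign e I * (\<Sum>k\<in>I-{e}. rank_sign k (I-{e}) *
     (\<Sum>u\<in>X. \<Sum>v\<in>X. sgn (real_of_int u - real_of_int v) * f e u * f k v) * alternating_sum X f (I - {e} - {k}))"
proof -
  let ?J = "I - {e}"
  have "alternating_sum X f I = (\<Sum>y\<in>I \<rightarrow>\<^sub>E X. \<Sum>k\<in>?J. rank_sign e I * rank_sign k ?J * sgn (real_of_int (y e) - real_of_int (y k)) * order_sign (?J - {k}) y * (\<Prod>i\<in>I. f i (y i)))"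
    unfolding alternating_sum_def by (subst order_sign_expand_even[OF assms]) (simp add: sum_distrib_right sum_distrib_left mult_ac)
  also have "\<dots> = (\<Sum>k\<in>?J. \<Sum>y\<in>I \<rightarrow>\<^sub>E X. rank_sign e I * rank_sign k ?J * sgn (real_of_int (y e) - real_of_int (y k)) * order_sign (?J - {k}) y * (\<Prod>i\<in>I. f i (y i)))"
    by (rule sum.swap)
  also have "\<dots> = (\<Sum>k\<in>?J. rank_sign e I * (rank_sign k ?J *
     (\<Sum>u\<in>X. \<Sum>v\<in>X. sgn (real_of_int u - real_of_int v) * f e u * f k v) * alternating_sum X f (?J - {k})))"
  proof (rule sum.cong[OF refl])
    fix k assume k: "k \<in> ?J"
    have 1: "order_sign (?J - {k}) (g(k := v, e := u)) = order_sign (?J - {k}) g" for g u v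
      by (rule order_sign_cong) auto
    have 2: "(\<Prod>i\<in>I. f i ((g(k := v, e := u)) i)) = f e u * f k v * (\<Prod>i\<in>?J-{k}. f i (g i))" for g u v
      using k assms(1,3) by (simp add: prod.remove[of I e] prod.remove[of ?J k] del: fun_upd_apply)
       (auto intro!: prod.cong)
    have 3: "(g(k := v, e := u)) e = u" "(g(k := v, e := u)) k = v" for g :: "'a \<Rightarrow> int" and u v
      using k by auto
    have "(\<Sum>g\<in>(?J - {k}) \<rightarrow>\<^sub>E X. rank_sign e I * rank_sign k ?J * sgn (real_of_int u - real_of_int v) * order_sign (?J - {k}) g * (f e u * f k v * (\<Prod>i\<in>?J-{k}. f i (g i)))) =
       rank_sign e I * (rank_sign k ?J * (sgn (real_of_int u - real_of_int v) * f e u * f k v) * alternating_sum X f (?J - {k}))" for u v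
      unfolding alternating_sum_def by (simp only: sum_distrib_left mult_ac)
    then show "(\<Sum>y\<in>I \<rightarrow>\<^sub>E X. rank_sign e I * rank_sign k ?J * sgn (real_of_int (y e) - real_of_int (y k)) * order_sign (?J - {k}) y * (\<Prod>i\<in>I. f i (y i))) =
        rank_sign e I * (rank_sign k ?J *
     (\<Sum>u\<in>X. \<Sum>v\<in>X. sgn (real_of_int u - real_of_int v) * f e u * f k v) * alternating_sum X f (?J - {k}))"
      unfolding sum_PiE_remove[OF assms(3)] sum_PiE_remove[OF k] 1 2 3
      by (simp only: sum_distrib_left sum_distrib_right)
  qed
  finally show ?thesis by (simp add: sum_distrib_left)
qed

lemma alternating_sum_empty [simp]: "alternating_sum X f {} = 1"
  by (simp add: alternating_sum_def order_sign_def)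

section \<open>Lagrange interpolation: values and top coefficient\<close>

lemma lagrange_poly:
  fixes c :: "'a \<Rightarrow> real"
  assumes "finite A" "inj_on c A" "degree p < card A"
  shows "p = (\<Sum>k\<in>A. smult (poly p (c k) / (\<Prod>j\<in>A-{k}. c k - c j)) (\<Prod>j\<in>A-{k}. [:- c j, 1:]))" (is "p = ?L")
proof (rule poly_eqI_degree[where A = "c ` A"])
  have card: "card (c ` A) = card A" using assms by (simp add: card_image)
  then show "degree p < card (c ` A)" using assms by simp
  have pos: "card A > 0" using assms by linarith
  have "degree (smult a (\<Prod>j\<in>A-{k}. [:- c j, 1:])) < card A" if "k \<in> A" for k a
  proof -
    have "degree (smult a (\<Prod>j\<in>A-{k}. [:- c j, 1:])) \<le> card A - 1"
      using that assms(1) by (auto simp: degree_prod_sum_eq)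
    then show ?thesis using pos by linarith
  qed
  then show "degree ?L < card (c ` A)" unfolding card
    by (intro degree_sum_less pos)
  fix x assume "x \<in> c ` A"
  then obtain i where i: "i \<in> A" "x = c i" by auto
  have "poly ?L x = (\<Sum>k\<in>A. poly p (c k) / (\<Prod>j\<in>A-{k}. c k - c j) * (\<Prod>j\<in>A-{k}. c i - c j))"
    by (simp add: poly_sum poly_prod i)
  also have "\<dots> = (\<Sum>k\<in>{i}. poly p (c k) / (\<Prod>j\<in>A-{k}. c k - c j) * (\<Prod>j\<in>A-{k}. c i - c j))"
    using i assms(1) by (intro sum.mono_neutral_right) (auto intro!: prod_zero)
  also have "(\<Prod>j\<in>A-{i}. c i - c j) \<noteq> 0"
    using i assms by (auto simp: inj_on_def)
  then have "(\<Sum>k\<in>{i}. poly p (c k) / (\<Prod>j\<in>A-{k}. c k - c j) * (\<Prod>j\<in>A-{k}. c i - c j)) = poly p x"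
    using i by simp
  finally show "poly p x = poly ?L x" ..
qed

lemma lagrange_eval:
  fixes c :: "'a \<Rightarrow> real"
  assumes "finite A" "inj_on c A" "degree p < card A"
  shows "poly p z = (\<Sum>k\<in>A. poly p (c k) * (\<Prod>j\<in>A-{k}. z - c j) / (\<Prod>j\<in>A-{k}. c k - c j))"
  by (subst lagrange_poly[OF assms]) (simp add: poly_sum poly_prod)

text \<open>Each basis product is monic of degree \<open>card A - 1\<close>. The coefficient on the
  left is 0 if \<open>p\<close> has smaller degree.\<close>

lemma lagrange_coeff:
  fixes c :: "'a \<Rightarrow> real"
  assumes "finite A" "inj_on c A" "degree p < card A"
  shows "coeff p (card A - 1) = (\<Sum>k\<in>A. poly p (c k) / (\<Prod>j\<in>A-{k}. c k - c j))"
proof -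
  have "coeff (\<Prod>j\<in>A-{k}. [:- c j, 1:]) (card A - 1) = 1" if "k \<in> A" for k
  proof -
    have "degree (\<Prod>j\<in>A-{k}. [:- c j, 1:]) = card A - 1"
      using that assms(1) by (simp add: degree_prod_sum_eq)
    then show ?thesis using lead_coeff_prod[of "\<lambda>j. [:- c j, 1:]" "A - {k}"] by simp
  qed
  then show ?thesis
    by (subst lagrange_poly[OF assms]) (simp add: coeff_sum)
qed

section \<open>Finite sine sums\<close>

definition sine :: "nat \<Rightarrow> int \<Rightarrow> int \<Rightarrow> real" where
  "sine m r x = sin (pi / real m * (real_of_int r * real_of_int x))"

definition cosine :: "nat \<Rightarrow> int \<Rightarrow> real" where
  "cosine m r = cos (pi / real m * real_of_int r)"

lemma sum_sin_telescope:
  assumes "a \<le> b + 1"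
  shows "2 * sin h * (\<Sum>x\<in>{a..b::int}. sin (2 * h * real_of_int x)) =
     cos (h * (2 * real_of_int a - 1)) - cos (h * (2 * real_of_int b + 1))"
proof -
  have "a - 1 \<le> b" using assms by simp
  then show ?thesis
  proof (induction b rule: int_ge_induct)
    case base
    then show ?case by (simp add: algebra_simps)
  next
    case (step b)
    have "{a..b + 1} = insert (b + 1) {a..b}" using step by auto
    moreover have "2 * sin h * sin (2 * h * real_of_int (b + 1)) =
        cos (h * (2 * real_of_int b + 1)) - cos (h * (2 * real_of_int (b + 1) + 1))"
    proof -
      have "h * (2 * real_of_int b + 1) = 2 * h * real_of_int (b + 1) - h"
        "h * (2 * real_of_int (b + 1) + 1) = 2 * h * real_of_int (b + 1) + h"
        by (simp_all add: algebra_simps)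
      then show ?thesis by (simp only: cos_add cos_diff) simp
    qed
    ultimately show ?case using step.IH by (simp add: distrib_left)
  qed
qed

lemma sin_half_angle_nonzero:
  assumes "l \<noteq> 0" "\<bar>l\<bar> < 2 * int m"
  shows "sin (pi / real m * real_of_int l / 2) \<noteq> 0"
proof -
  have *: "0 < sin (pi / real m * real_of_int l / 2)" if "0 < l" "l < 2 * int m" for l
  proof (rule sin_gt_zero)
    have "real_of_int l < real_of_int (2 * int m)" using that by (subst of_int_less_iff) auto
    then show "pi / real m * real_of_int l / 2 < pi" using that by (simp add: field_simps)
  qed (use that in auto)
  show ?thesis
  proof (cases "l > 0")
    case True
    then show ?thesis using *[of l] assms by auto
  next
    case False
    then show ?thesis using *[of "-l"] assms by auto
  qed
qed

lemma cos_int_pi: "cos (real_of_int l * pi) = (if even l then 1 else -1)"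
proof (cases "even l")
  case True
  then obtain i where "l = 2 * i" by blast
  then show ?thesis using cos_one_2pi_int[of "real_of_int l * pi"] by auto
next
  case False
  then obtain i where "l = 2 * i + 1" by (auto elim: oddE)
  then have "real_of_int l * pi = real_of_int i * 2 * pi + pi" by (simp add: algebra_simps)
  moreover have "cos (real_of_int i * 2 * pi) = 1" by (subst cos_one_2pi_int) auto
  ultimately show ?thesis using False by simp
qed

text \<open>The telescoped boundary terms are cos h and cos(l \<pi> - h), with h half the angle:
  they cancel for even \<open>l\<close> and add up for odd \<open>l\<close>. All vanishing of
  Pfaffian entries comes from this parity rule.\<close>

lemma sin_sum:
  assumes "m > 0"
  shows "sin (pi / real m * real_of_int l / 2) * (\<Sum>x\<in>{1..int m - 1}. sine m l x) =
     (if odd l then cos (pi / real m * real_of_int l / 2) else 0)"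
proof -
  define h where "h = pi / real m * real_of_int l / 2"
  have hm: "2 * h * real m = real_of_int l * pi" using assms by (simp add: h_def)
  have s: "sin (real_of_int l * pi) = 0" by (simp add: sin_zero_iff_int2)
  have "(\<Sum>x\<in>{1..int m - 1}. sine m l x) = (\<Sum>x\<in>{1..int m - 1}. sin (2 * h * real_of_int x))"
    by (simp add: sine_def h_def mult_ac)
  then have "2 * sin h * (\<Sum>x\<in>{1..int m - 1}. sine m l x) = cos h - cos (real_of_int l * pi - h)"
    using sum_sin_telescope[of 1 "int m - 1" h] assms hm by (simp add: algebra_simps)
  also have "\<dots> = (if odd l then 2 * cos h else 0)"
    by (simp add: cos_diff s cos_int_pi)
  finally show ?thesis unfolding h_def[symmetric] by (auto split: if_splits)
qed

lemma sin_sum_odd: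
  assumes "m > 0" "odd l" "\<bar>l\<bar> < 2 * int m"
  shows "(\<Sum>x\<in>{1..int m - 1}. sine m l x) = cot (pi / real m * real_of_int l / 2)"
proof -
  have "l \<noteq> 0" using assms by auto
  then show ?thesis
    using sin_sum[OF assms(1), of l] sin_half_angle_nonzero[of l m] assms
    by (simp add: cot_def field_simps)
qed

lemma sin_sum_even:
  assumes "m > 0" "even l" "\<bar>l\<bar> < 2 * int m"
  shows "(\<Sum>x\<in>{1..int m - 1}. sine m l x) = 0"
proof (cases "l = 0")
  case False
  then show ?thesis using sin_sum[OF assms(1), of l] sin_half_angle_nonzero[of l m] assms by simp
qed (simp add: sine_def)

text \<open>The sum is split at \<open>v\<close> and both parts are telescoped. For even
  \<open>e\<close> both outer boundary terms equal cos h, and the inner ones combine to 2 cos h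
  times the cosine at \<open>v\<close>.\<close>

lemma sgn_sum_even:
  assumes "m > 0" "even e" "e \<noteq> 0" "\<bar>e\<bar> < 2 * int m" "v \<in> {1..int m - 1}"
  shows "(\<Sum>u\<in>{1..int m - 1}. sgn (real_of_int u - real_of_int v) * sine m e u) =
    - cot (pi / real m * real_of_int e / 2) * (1 - cosine m (e * v))"
proof -
  define h where "h = pi / real m * real_of_int e / 2"
  have h0: "sin h \<noteq> 0" using sin_half_angle_nonzero assms unfolding h_def by auto
  have hm: "2 * h * real m = real_of_int e * pi" using assms by (simp add: h_def)
  have s: "sin (real_of_int e * pi) = 0" by (simp add: sin_zero_iff_int2)
  have sine: "sine m e x = sin (2 * h * real_of_int x)" for x by (simp add: sine_def h_def mult_ac)
  have X: "{1..int m - 1} = insert v ({1..v-1} \<union> {v+1..int m - 1})" using assms by auto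
  have "(\<Sum>u\<in>{1..int m - 1}. sgn (real_of_int u - real_of_int v) * sine m e u) =
     (\<Sum>u\<in>{1..v-1}. sgn (real_of_int u - real_of_int v) * sine m e u) +
     (\<Sum>u\<in>{v+1..int m-1}. sgn (real_of_int u - real_of_int v) * sine m e u)"
  proof -
    have "(\<Sum>u\<in>{1..int m - 1}. F u) = F v + ((\<Sum>u\<in>{1..v-1}. F u) + (\<Sum>u\<in>{v+1..int m-1}. F u))" for F :: "int \<Rightarrow> real"
      unfolding X by (subst sum.insert, simp, simp, subst sum.union_disjoint) auto
    then show ?thesis by simp
  qed
  also have "\<dots> = (\<Sum>u\<in>{1..v-1}. - sine m e u) + (\<Sum>u\<in>{v+1..int m-1}. sine m e u)"
    by (intro arg_cong2[of _ _ _ _ "(+)"] sum.cong) (auto simp: sgn_if)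
  finally have "2 * sin h * (\<Sum>u\<in>{1..int m - 1}. sgn (real_of_int u - real_of_int v) * sine m e u) =
     2 * sin h * (\<Sum>u\<in>{v+1..int m-1}. sin (2 * h * real_of_int u)) -
     2 * sin h * (\<Sum>u\<in>{1..v-1}. sin (2 * h * real_of_int u))"
    by (simp add: sine sum_negf right_diff_distrib)
  also have "\<dots> = (cos (2 * h * v + h) - cos (real_of_int e * pi - h)) - (cos h - cos (2 * h * v - h))"
    using sum_sin_telescope[of "v+1" "int m - 1" h] sum_sin_telescope[of 1 "v - 1" h] assms hm
    by (simp add: algebra_simps)
  also have "\<dots> = 2 * (cos h * cos (2 * h * v) - cos h)"
    using assms by (simp add: cos_diff cos_add s cos_int_pi)
  finally have "sin h * (\<Sum>u\<in>{1..int m - 1}. sgn (real_of_int u - real_of_int v) * sine m e u) = - cos h * (1 - cos (2 * h * v))"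
    by (simp add: algebra_simps)
  moreover have "cosine m (e * v) = cos (2 * h * v)" by (simp add: cosine_def h_def mult_ac)
  ultimately show ?thesis unfolding h_def[symmetric] using h0 by (simp add: cot_def field_simps)
qed

text \<open>Everything is expressed through P = sin(a + h) sin(a - h) = sin^2 a - sin^2 h, which is
  half of cos 2h - cos 2a. With 2h and 2a the angles of an even and an odd frequency, the result is
  a factor for each row times a Cauchy kernel.\<close>

lemma cot_identity:
  fixes a h :: real
  assumes "sin a \<noteq> 0" "sin h \<noteq> 0" "sin (a + h) \<noteq> 0" "sin (a - h) \<noteq> 0"
  shows "- cot h * (cot a - (cot (a + h) + cot (a - h)) / 2) =
    sin (2 * h) * sin (2 * a) / ((1 - cos (2 * a)) * (cos (2 * h) - cos (2 * a)))"
proof -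
  define P where "P = sin (a + h) * sin (a - h)"
  have P0: "P \<noteq> 0" using assms by (simp add: P_def)
  have P: "P = (sin a)\<^sup>2 - (sin h)\<^sup>2"
  proof -
    have "P = (sin a)\<^sup>2 * (cos h)\<^sup>2 - (cos a)\<^sup>2 * (sin h)\<^sup>2"
      unfolding P_def sin_add sin_diff by (simp add: algebra_simps power2_eq_square)
    then show ?thesis unfolding cos_squared_eq by (simp add: algebra_simps)
  qed
  have "cot (a + h) + cot (a - h) = (sin (a - h) * cos (a + h) + sin (a + h) * cos (a - h)) / P"
    using assms by (simp add: cot_def P_def field_simps)
  also have "sin (a - h) * cos (a + h) + sin (a + h) * cos (a - h) = 2 * sin a * cos a"
    using sin_add[of "a - h" "a + h"] sin_double[of a] by (simp add: mult_ac)
  finally have sum: "cot (a + h) + cot (a - h) = 2 * sin a * cos a / P" .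
  have c: "cos (2 * h) - cos (2 * a) = 2 * P"
    unfolding P by (simp add: cos_double_sin)
  have "cot a - (cot (a + h) + cot (a - h)) / 2 = cos a * (P - (sin a)\<^sup>2) / (sin a * P)"
    unfolding sum using assms P0 by (simp add: cot_def field_simps power2_eq_square)
  also have "P - (sin a)\<^sup>2 = - (sin h)\<^sup>2" using P by simp
  finally have D: "cot a - (cot (a + h) + cot (a - h)) / 2 = cos a * - (sin h)\<^sup>2 / (sin a * P)" .
  have "- cot h * (cot a - (cot (a + h) + cot (a - h)) / 2) = cos h * sin h * cos a / (sin a * P)"
    unfolding D using assms P0 by (simp add: cot_def field_simps power2_eq_square)
  moreover have "sin (2 * h) * sin (2 * a) / ((1 - cos (2 * a)) * (2 * P)) = cos h * sin h * cos a / (sin a * P)"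
  proof -
    have *: "1 - cos (2 * a) = 2 * (sin a * sin a)" by (simp add: cos_double_sin power2_eq_square)
    show ?thesis unfolding sin_double * using assms P0 by (simp add: field_simps)
  qed
  ultimately show ?thesis unfolding c by simp
qed

text \<open>Summing over the even row first leaves 1 minus a cosine, and a sine times a cosine is
  the mean of the sines at frequencies \<open>k + e\<close> and \<open>k - e\<close>. So plain sine
  sums suffice.\<close>

lemma sgn_sum_even_left:
  assumes "m > 0" "even e" "e \<in> {1..int m - 1}"
  shows "(\<Sum>u\<in>{1..int m - 1}. \<Sum>v\<in>{1..int m - 1}. sgn (real_of_int u - real_of_int v) * sine m e u * sine m k v) =
    - cot (pi / real m * real_of_int e / 2) * ((\<Sum>v\<in>{1..int m - 1}. sine m k v) -
       ((\<Sum>v\<in>{1..int m - 1}. sine m (k + e) v) + (\<Sum>v\<in>{1..int m - 1}. sine m (k - e) v)) / 2)"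
proof -
  define C where "C = - cot (pi / real m * real_of_int e / 2)"
  let ?X = "{1..int m - 1}"
  have "(\<Sum>u\<in>?X. \<Sum>v\<in>?X. sgn (real_of_int u - real_of_int v) * sine m e u * sine m k v) =
     (\<Sum>v\<in>?X. (\<Sum>u\<in>?X. sgn (real_of_int u - real_of_int v) * sine m e u) * sine m k v)"
    by (subst sum.swap) (simp add: sum_distrib_right)
  also have "\<dots> = (\<Sum>v\<in>?X. C * (1 - cosine m (e * v)) * sine m k v)"
    using assms by (intro sum.cong refl) (subst sgn_sum_even, auto simp: C_def)
  also have "\<dots> = (\<Sum>v\<in>?X. C * (sine m k v - (sine m (k + e) v + sine m (k - e) v) / 2))"
  proof (intro sum.cong refl)
    fix v
    have "sine m (k + e) v + sine m (k - e) v = 2 * (sine m k v * cosine m (e * v))"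
      by (simp add: sine_def cosine_def algebra_simps sin_add sin_diff)
    then show "C * (1 - cosine m (e * v)) * sine m k v = C * (sine m k v - (sine m (k + e) v + sine m (k - e) v) / 2)"
      by (simp add: algebra_simps)
  qed
  also have "\<dots> = C * ((\<Sum>v\<in>?X. sine m k v) - ((\<Sum>v\<in>?X. sine m (k + e) v) + (\<Sum>v\<in>?X. sine m (k - e) v)) / 2)"
    by (simp only: sum_subtractf sum.distrib flip: sum_distrib_left sum_divide_distrib)
  finally show ?thesis unfolding C_def .
qed

text \<open>The frequencies \<open>k\<close>, \<open>k + e\<close> and \<open>k - e\<close> are all
  odd, so each sine sum is a cotangent and \<open>cot_identity\<close> applies.\<close>

lemma sgn_sum_even_odd:
  assumes "m > 0" "even e" "odd k" "e \<in> {1..int m - 1}" "k \<in> {1..int m - 1}"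
  shows "(\<Sum>u\<in>{1..int m - 1}. \<Sum>v\<in>{1..int m - 1}. sgn (real_of_int u - real_of_int v) * sine m e u * sine m k v) =
    sine m e 1 * sine m k 1 / ((1 - cosine m k) * (cosine m e - cosine m k))"
proof -
  define h where "h = pi / real m * real_of_int e / 2"
  define a where "a = pi / real m * real_of_int k / 2"
  have ah: "a + h = pi / real m * real_of_int (k + e) / 2" "a - h = pi / real m * real_of_int (k - e) / 2"
    by (simp_all add: a_def h_def add_divide_distrib diff_divide_distrib distrib_left right_diff_distrib)
  have *: "k - e \<noteq> 0" "k + e \<noteq> 0" "\<bar>k - e\<bar> < 2 * int m" "\<bar>k + e\<bar> < 2 * int m" "\<bar>k\<bar> < 2 * int m"
    "odd (k - e)" "odd (k + e)"
    using assms by auto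
  have "(\<Sum>u\<in>{1..int m - 1}. \<Sum>v\<in>{1..int m - 1}. sgn (real_of_int u - real_of_int v) * sine m e u * sine m k v) =
      - cot h * (cot a - (cot (a + h) + cot (a - h)) / 2)"
  proof -
    have 1: "(\<Sum>v\<in>{1..int m - 1}. sine m (k + e) v) = cot (a + h)"
      unfolding ah using * assms by (intro sin_sum_odd)
    have 2: "(\<Sum>v\<in>{1..int m - 1}. sine m (k - e) v) = cot (a - h)"
      unfolding ah using * assms by (intro sin_sum_odd)
    have 3: "(\<Sum>v\<in>{1..int m - 1}. sine m k v) = cot a"
      unfolding a_def using * assms by (intro sin_sum_odd)
    show ?thesis unfolding sgn_sum_even_left[OF assms(1,2,4)] 1 2 3 h_def ..
  qed
  also have "\<dots> = sin (2 * h) * sin (2 * a) / ((1 - cos (2 * a)) * (cos (2 * h) - cos (2 * a)))"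
  proof (rule cot_identity)
    show "sin (a + h) \<noteq> 0" "sin (a - h) \<noteq> 0" unfolding ah using sin_half_angle_nonzero * by blast+
    show "sin a \<noteq> 0" "sin h \<noteq> 0" unfolding a_def h_def using sin_half_angle_nonzero[of _ m] assms by auto
  qed
  finally show ?thesis by (simp add: sine_def cosine_def a_def h_def mult_ac)
qed

text \<open>Here \<open>k\<close>, \<open>k + e\<close> and \<open>k - e\<close> are all even,
  possibly 0, and each of the three sine sums vanishes.\<close>

lemma sgn_sum_even_even:
  assumes "m > 0" "even e" "even k" "e \<in> {1..int m - 1}" "k \<in> {1..int m - 1}"
  shows "(\<Sum>u\<in>{1..int m - 1}. \<Sum>v\<in>{1..int m - 1}. sgn (real_of_int u - real_of_int v) * sine m e u * sine m k v) = 0"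
proof -
  have *: "\<bar>k - e\<bar> < 2 * int m" "\<bar>k + e\<bar> < 2 * int m" "\<bar>k\<bar> < 2 * int m" "even (k - e)" "even (k + e)"
    using assms by auto
  show ?thesis unfolding sgn_sum_even_left[OF assms(1,2,4)]
    using * assms by (simp only: sin_sum_even) simp
qed

section \<open>Closed form of the alternating sine sum\<close>

text \<open>Chosen so that the sum of an odd row is its weight, and the entry for an even row
  \<open>e\<close> and an odd row \<open>k\<close> is the product of their weights divided by the
  difference of their cosines.\<close>

definition row_weight :: "nat \<Rightarrow> int \<Rightarrow> real" where
  "row_weight m r = sine m r 1 * (if odd r then 1 / (1 - cosine m r) else 1)"

text \<open>Differences within a parity class and reciprocals across the classes: the factors of a
  Cauchy determinant whose two families of nodes are the cosines of the even and of the odd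
  frequencies.\<close>

definition cosine_pair :: "nat \<Rightarrow> int \<Rightarrow> int \<Rightarrow> real" where
  "cosine_pair m i j = (if even i = even j then cosine m i - cosine m j else 1 / (cosine m i - cosine m j))"

definition sine_prod :: "nat \<Rightarrow> int set \<Rightarrow> real" where
  "sine_prod m R = (\<Prod>r\<in>R. row_weight m r) * pair_prod R (cosine_pair m)"

lemma cosine_strict_antimono:
  assumes "0 \<le> i" "i < j" "j \<le> int m"
  shows "cosine m j < cosine m i"
  unfolding cosine_def
proof (rule cos_monotone_0_pi)
  have "m > 0" using assms by simp
  moreover have "real_of_int i < real_of_int j" "real_of_int j \<le> real m"
    using assms by linarith+
  ultimately show "pi / real m * real_of_int i < pi / real m * real_of_int j"
    "pi / real m * real_of_int j \<le> pi"
    by (simp_all add: field_simps)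
qed (use assms in auto)

lemma cosine_inj_on: "inj_on (cosine m) {0..int m}"
proof (rule linorder_inj_onI)
  fix x y assume "x < y" "x \<in> {0..int m}" "y \<in> {0..int m}"
  then show "cosine m x \<noteq> cosine m y" using cosine_strict_antimono[of x y m] by simp
qed auto

lemma cosine_inj_on_subset:
  assumes "R \<subseteq> {1..int m - 1}"
  shows "inj_on (cosine m) R"
  using assms by (intro inj_on_subset[OF cosine_inj_on[of m]]) (auto simp: subset_iff)

lemma sum_sine_row_weight:
  assumes "r \<in> {1..int m - 1}"
  shows "(\<Sum>x\<in>{1..int m - 1}. sine m r x) = (if odd r then row_weight m r else 0)"
proof -
  define a where "a = pi / real m * real_of_int r / 2"
  have a0: "sin a \<noteq> 0" unfolding a_def using assms by (intro sin_half_angle_nonzero) auto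
  have "cot a = sin (2 * a) / (1 - cos (2 * a))"
    using a0 by (simp add: cot_def sin_double cos_double_sin power2_eq_square)
  then have "cot a = sine m r 1 / (1 - cosine m r)" by (simp add: sine_def cosine_def a_def)
  then show ?thesis
    using assms sin_sum_odd[of m r] sin_sum_even[of m r] by (auto simp: row_weight_def a_def)
qed

lemma cosine_pair_nonzero:
  assumes "i \<in> {1..int m - 1}" "j \<in> {1..int m - 1}" "i \<noteq> j"
  shows "cosine_pair m i j \<noteq> 0"
  using assms inj_onD[OF cosine_inj_on[of m], of i j] by (auto simp: cosine_pair_def)

lemma cosine_pair_anti: "cosine_pair m i j = - cosine_pair m j i"
proof -
  have "1 / (cosine m i - cosine m j) = - (1 / (cosine m j - cosine m i))"
    by (metis minus_diff_eq minus_divide_right)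
  then show ?thesis unfolding cosine_pair_def by simp
qed

lemma sine_prod_remove:
  assumes "finite R" "k \<in> R"
  shows "sine_prod m R = row_weight m k * rank_sign k R * (\<Prod>j\<in>R-{k}. cosine_pair m k j) * sine_prod m (R - {k})"
proof -
  have "pair_prod R (cosine_pair m) = rank_sign k R * (\<Prod>j\<in>R-{k}. cosine_pair m k j) * pair_prod (R - {k}) (cosine_pair m)"
    by (rule pair_prod_remove_anti[OF assms]) (rule cosine_pair_anti)
  then show ?thesis unfolding sine_prod_def by (simp add: prod.remove[OF assms])
qed

lemma prod_cosine_pair:
  assumes "finite R"
  shows "(\<Prod>j\<in>R. cosine_pair m k j) =
    (\<Prod>j\<in>{j\<in>R. even j = even k}. cosine m k - cosine m j) / (\<Prod>j\<in>{j\<in>R. even j \<noteq> even k}. cosine m k - cosine m j)"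
proof -
  have "R = {j\<in>R. even j = even k} \<union> {j\<in>R. even j \<noteq> even k}" by auto
  then have "(\<Prod>j\<in>R. cosine_pair m k j) = (\<Prod>j\<in>{j\<in>R. even j = even k}. cosine_pair m k j) * (\<Prod>j\<in>{j\<in>R. even j \<noteq> even k}. cosine_pair m k j)"
    using assms by (subst prod.union_disjoint[symmetric]) auto
  also have "(\<Prod>j\<in>{j\<in>R. even j = even k}. cosine_pair m k j) = (\<Prod>j\<in>{j\<in>R. even j = even k}. cosine m k - cosine m j)"
    by (intro prod.cong) (auto simp: cosine_pair_def)
  also have "(\<Prod>j\<in>{j\<in>R. even j \<noteq> even k}. cosine_pair m k j) = (\<Prod>j\<in>{j\<in>R. even j \<noteq> even k}. 1 / (cosine m k - cosine m j))"
    by (intro prod.cong) (auto simp: cosine_pair_def)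
  finally show ?thesis by (simp add: prod_dividef)
qed

lemma monic_product:
  assumes "finite A"
  shows "degree (\<Prod>j\<in>A. [:- c j, 1:] :: real poly) = card A" "coeff (\<Prod>j\<in>A. [:- c j, 1:]) (card A) = (1::real)"
proof -
  show d: "degree (\<Prod>j\<in>A. [:- c j, 1:] :: real poly) = card A" by (simp add: degree_prod_sum_eq)
  show "coeff (\<Prod>j\<in>A. [:- c j, 1:]) (card A) = (1::real)"
    using lead_coeff_prod[of "\<lambda>j. [:- c j, 1:]" A] d by simp
qed

abbreviation odds :: "int set \<Rightarrow> int set" where "odds R \<equiv> {r\<in>R. odd r}"
abbreviation evens :: "int set \<Rightarrow> int set" where "evens R \<equiv> {r\<in>R. even r}"

lemma card_parity: "finite R \<Longrightarrow> card R = card (odds R) + card (evens R)"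
  by (subst card_Un_disjoint[symmetric]) (auto intro!: arg_cong[of _ _ card])

text \<open>Only odd rows have a nonzero sum. Divided by \<open>sine_prod m R\<close>, the expansion
  becomes Lagrange's formula for a top coefficient, with the odd cosines as nodes and the even
  cosines as roots. The polynomial is monic of degree one less than the number of nodes, so the
  value is 1.\<close>

lemma alternating_sum_sine_step_odd:
  assumes "finite R" "R \<subseteq> {1..int m - 1}" "card (odds R) = card (evens R) + 1"
    and IH: "\<And>k. k \<in> odds R \<Longrightarrow> alternating_sum {1..int m - 1} (sine m) (R - {k}) = sine_prod m (R - {k})"
  shows "alternating_sum {1..int m - 1} (sine m) R = sine_prod m R"
proof -
  have fin: "finite (odds R)" "finite (evens R)" using assms by auto
  have "odd (card R)" using card_parity[OF assms(1)] assms(3) by simp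
  then have "alternating_sum {1..int m - 1} (sine m) R =
      (\<Sum>k\<in>R. rank_sign k R * (\<Sum>x\<in>{1..int m - 1}. sine m k x) * alternating_sum {1..int m - 1} (sine m) (R - {k}))"
    using assms by (intro alternating_sum_odd)
  also have "\<dots> = (\<Sum>k\<in>R. if odd k then rank_sign k R * row_weight m k * alternating_sum {1..int m - 1} (sine m) (R - {k}) else 0)"
    using assms(2) by (intro sum.cong refl) (auto simp: sum_sine_row_weight subset_iff)
  also have "\<dots> = (\<Sum>k\<in>odds R. rank_sign k R * row_weight m k * alternating_sum {1..int m - 1} (sine m) (R - {k}))"
    using assms(1) by (intro sum.mono_neutral_cong_right) auto
  also have "\<dots> = (\<Sum>k\<in>odds R. sine_prod m R * ((\<Prod>j\<in>evens R. cosine m k - cosine m j) / (\<Prod>j\<in>odds R-{k}. cosine m k - cosine m j)))"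
  proof (rule sum.cong[OF refl])
    fix k assume k: "k \<in> odds R"
    define C where "C = (\<Prod>j\<in>R-{k}. cosine_pair m k j)"
    have "C \<noteq> 0" unfolding C_def using assms(1,2) k cosine_pair_nonzero by (auto simp: subset_iff)
    moreover have "sine_prod m R = row_weight m k * rank_sign k R * C * sine_prod m (R - {k})"
      unfolding C_def using sine_prod_remove k assms(1) by blast
    ultimately have "rank_sign k R * row_weight m k * sine_prod m (R - {k}) = sine_prod m R * (1 / C)" by simp
    moreover have "C = (\<Prod>j\<in>odds R-{k}. cosine m k - cosine m j) / (\<Prod>j\<in>evens R. cosine m k - cosine m j)"
    proof -
      have "{j \<in> R - {k}. even j = even k} = odds R - {k}" "{j \<in> R - {k}. even j \<noteq> even k} = evens R"
        using k by auto
      then show ?thesis unfolding C_def using assms(1) by (subst prod_cosine_pair) simp_all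
    qed
    ultimately show "rank_sign k R * row_weight m k * alternating_sum {1..int m - 1} (sine m) (R - {k}) =
        sine_prod m R * ((\<Prod>j\<in>evens R. cosine m k - cosine m j) / (\<Prod>j\<in>odds R-{k}. cosine m k - cosine m j))"
      using IH[OF k] by simp
  qed
  also have "\<dots> = sine_prod m R * (\<Sum>k\<in>odds R. poly (\<Prod>j\<in>evens R. [:- cosine m j, 1:]) (cosine m k) / (\<Prod>j\<in>odds R-{k}. cosine m k - cosine m j))"
    by (simp add: sum_distrib_left poly_prod)
  also have "\<dots> = sine_prod m R * coeff (\<Prod>j\<in>evens R. [:- cosine m j, 1:]) (card (odds R) - 1)"
    using fin assms monic_product(1)[OF fin(2), of "cosine m"] cosine_inj_on_subset[of "odds R" m]
    by (subst lagrange_coeff) auto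
  also have "\<dots> = sine_prod m R"
    using monic_product(2)[OF fin(2), of "cosine m"] assms(3) by simp
  finally show ?thesis .
qed

text \<open>In the expansion along an even row \<open>e\<close> only odd partners survive. After
  division by \<open>sine_prod m R\<close> the sum is Lagrange's formula at the odd cosines for the
  polynomial whose roots are the other even cosines, evaluated at the cosine of \<open>e\<close>.
  Leaving out the root at \<open>e\<close> brings its degree below the number of nodes.\<close>

lemma alternating_sum_sine_step_even:
  assumes "finite R" "R \<subseteq> {1..int m - 1}" "card (odds R) = card (evens R)" "e \<in> evens R"
    and IH: "\<And>k. k \<in> odds R \<Longrightarrow> alternating_sum {1..int m - 1} (sine m) (R - {e} - {k}) = sine_prod m (R - {e} - {k})"
  shows "alternating_sum {1..int m - 1} (sine m) R = sine_prod m R"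
proof -
  let ?X = "{1..int m - 1}" and ?J = "R - {e}"
  let ?B = "\<lambda>k. \<Sum>u\<in>?X. \<Sum>v\<in>?X. sgn (real_of_int u - real_of_int v) * sine m e u * sine m k v"
  have fin: "finite (odds R)" "finite (evens R)" using assms by auto
  have m: "m > 0" and e: "even e" "e \<in> ?X" "e \<in> R" using assms by auto
  have "even (card R)" using card_parity[OF assms(1)] assms(3) by simp
  then have "alternating_sum ?X (sine m) R =
      rank_sign e R * (\<Sum>k\<in>?J. rank_sign k ?J * ?B k * alternating_sum ?X (sine m) (?J - {k}))"
    using assms by (intro alternating_sum_even) auto
  also have "(\<Sum>k\<in>?J. rank_sign k ?J * ?B k * alternating_sum ?X (sine m) (?J - {k})) =
     (\<Sum>k\<in>odds R. rank_sign k ?J * ?B k * alternating_sum ?X (sine m) (?J - {k}))"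
    using assms(1,2) m e sgn_sum_even_even[of m e] by (intro sum.mono_neutral_right) auto
  also have "rank_sign e R * \<dots> = (\<Sum>k\<in>odds R. sine_prod m R * ((\<Prod>j\<in>evens R - {e}. cosine m k - cosine m j) *
      (\<Prod>j\<in>odds R-{k}. cosine m e - cosine m j) / (\<Prod>j\<in>odds R-{k}. cosine m k - cosine m j)) / (\<Prod>j\<in>evens R - {e}. cosine m e - cosine m j))"
  proof (subst sum_distrib_left, rule sum.cong[OF refl])
    fix k assume k: "k \<in> odds R"
    have kR: "k \<in> ?J" "k \<in> ?X" using k e assms(2) by auto
    define C where "C = (\<Prod>j\<in>?J-{k}. cosine_pair m k j)"
    define E where "E = (\<Prod>j\<in>?J. cosine_pair m e j)"
    have "C \<noteq> 0" "E \<noteq> 0" unfolding C_def E_def using assms(1,2) k e cosine_pair_nonzero by (auto simp: subset_iff)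
    define d where "d = cosine m e - cosine m k"
    have d0: "d \<noteq> 0" using inj_onD[OF cosine_inj_on[of m], of e k] e kR by (auto simp: d_def)
    have B: "?B k = row_weight m e * row_weight m k / d"
      using sgn_sum_even_odd[OF m e(1) _ e(2) kR(2)] k e by (simp add: row_weight_def d_def)
    have "sine_prod m R = row_weight m e * rank_sign e R * E * (row_weight m k * rank_sign k ?J * C * sine_prod m (?J - {k}))"
      unfolding C_def E_def using sine_prod_remove[of R e m] sine_prod_remove[of ?J k m] kR(1) e assms(1) by simp
    then have main: "rank_sign e R * (rank_sign k ?J * (row_weight m e * row_weight m k / d) * sine_prod m (?J - {k})) = sine_prod m R * (1 / (C * E * d))"
      using \<open>C \<noteq> 0\<close> \<open>E \<noteq> 0\<close> d0 by (simp add: field_simps)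
    have C: "C = (\<Prod>j\<in>odds R-{k}. cosine m k - cosine m j) / (\<Prod>j\<in>evens R - {e}. cosine m k - cosine m j)"
    proof -
      have "{j \<in> ?J - {k}. even j = even k} = odds R - {k}" "{j \<in> ?J - {k}. even j \<noteq> even k} = evens R - {e}"
        using k e by auto
      then show ?thesis unfolding C_def using assms(1) by (subst prod_cosine_pair) simp_all
    qed
    have E: "E = (\<Prod>j\<in>evens R-{e}. cosine m e - cosine m j) / (\<Prod>j\<in>odds R. cosine m e - cosine m j)"
    proof -
      have "{j \<in> ?J. even j = even e} = evens R - {e}" "{j \<in> ?J. even j \<noteq> even e} = odds R"
        using k e by auto
      then show ?thesis unfolding E_def using assms(1) by (subst prod_cosine_pair) simp_all
    qed
    \<comment> \<open>The factor of \<open>k\<close> is split off the denominator of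
      \<open>E\<close>, where it cancels the Cauchy denominator \<open>d\<close> of the
      entry.\<close>
    have o: "(\<Prod>j\<in>odds R. cosine m e - cosine m j) = d * (\<Prod>j\<in>odds R - {k}. cosine m e - cosine m j)"
      unfolding d_def using fin k by (subst prod.remove[of _ k]) auto
    show "rank_sign e R * (rank_sign k ?J * ?B k * alternating_sum ?X (sine m) (?J - {k})) = sine_prod m R * ((\<Prod>j\<in>evens R - {e}. cosine m k - cosine m j) *
      (\<Prod>j\<in>odds R-{k}. cosine m e - cosine m j) / (\<Prod>j\<in>odds R-{k}. cosine m k - cosine m j)) / (\<Prod>j\<in>evens R - {e}. cosine m e - cosine m j)"
      unfolding IH[OF k] B main using \<open>C \<noteq> 0\<close> \<open>E \<noteq> 0\<close> d0 unfolding C E o by (simp add: field_simps)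
  qed
  also have "\<dots> = sine_prod m R * (\<Sum>k\<in>odds R. poly (\<Prod>j\<in>evens R - {e}. [:- cosine m j, 1:]) (cosine m k) * (\<Prod>j\<in>odds R-{k}. cosine m e - cosine m j) / (\<Prod>j\<in>odds R-{k}. cosine m k - cosine m j))
      / (\<Prod>j\<in>evens R - {e}. cosine m e - cosine m j)"
    by (simp add: sum_distrib_left sum_divide_distrib poly_prod)
  also have "(\<Sum>k\<in>odds R. poly (\<Prod>j\<in>evens R - {e}. [:- cosine m j, 1:]) (cosine m k) * (\<Prod>j\<in>odds R-{k}. cosine m e - cosine m j) / (\<Prod>j\<in>odds R-{k}. cosine m k - cosine m j))
     = poly (\<Prod>j\<in>evens R - {e}. [:- cosine m j, 1:]) (cosine m e)"
  proof (rule lagrange_eval[symmetric])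
    show "finite (odds R)" by fact
    show "inj_on (cosine m) (odds R)" using assms(2) by (intro cosine_inj_on_subset) auto
    have "card (evens R) > 0" using assms(4) fin(2) by (auto simp: card_gt_0_iff)
    moreover have "card (evens R - {e}) = card (evens R) - 1" using assms(4) fin(2) by simp
    ultimately show "degree (\<Prod>j\<in>evens R - {e}. [:- cosine m j, 1:]) < card (odds R)"
      using monic_product(1)[of "evens R - {e}" "cosine m"] fin(2) assms(3) by simp
  qed
  also have "\<dots> = (\<Prod>j\<in>evens R - {e}. cosine m e - cosine m j)" by (simp add: poly_prod)
  also have "sine_prod m R * \<dots> / \<dots> = sine_prod m R"
  proof -
    have "cosine m e - cosine m j \<noteq> 0" if "j \<in> evens R - {e}" for j
      using inj_onD[OF cosine_inj_on[of m], of e j] e that assms(2) by (auto simp: subset_iff)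
    then have "(\<Prod>j\<in>evens R - {e}. cosine m e - cosine m j) \<noteq> 0" using fin by simp
    then show ?thesis by simp
  qed
  finally show ?thesis .
qed

text \<open>A surplus odd row is removed by the odd expansion, and a balanced set loses one even and
  one odd row. Both reductions lead to a balanced set.\<close>

lemma alternating_sum_sine_balanced:
  assumes "R \<subseteq> {1..int m - 1}" "card (odds R) = card (evens R) \<or> card (odds R) = card (evens R) + 1"
  shows "alternating_sum {1..int m - 1} (sine m) R = sine_prod m R"
  using assms
proof (induction "card R" arbitrary: R rule: less_induct)
  case less
  have fin: "finite R" using less.prems(1) finite_subset by blast
  then have fin2: "finite (odds R)" "finite (evens R)" by auto
  show ?case
  proof (cases "card (odds R) = card (evens R) + 1")
    case True
    show ?thesis
    proof (rule alternating_sum_sine_step_odd[OF fin less.prems(1) True])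
      fix k assume k: "k \<in> odds R"
      have "odds (R - {k}) = odds R - {k}" "evens (R - {k}) = evens R" using k by auto
      moreover have "card (odds R - {k}) = card (odds R) - 1" using k fin2 by simp
      moreover have "card (R - {k}) < card R" using k fin by (intro psubset_card_mono) auto
      ultimately show "alternating_sum {1..int m - 1} (sine m) (R - {k}) = sine_prod m (R - {k})"
        using True less.prems(1) by (intro less.hyps) auto
    qed
  next
    case False
    then have eq: "card (odds R) = card (evens R)" using less.prems(2) by simp
    show ?thesis
    proof (cases "evens R = {}")
      case True
      then have "card R = 0" using eq card_parity[OF fin] by (simp only: card.empty)
      then have "R = {}" using fin by simp
      then show ?thesis by (simp add: sine_prod_def)
    next
      case False
      then obtain e where e: "e \<in> evens R" by blast
      show ?thesis
      proof (rule alternating_sum_sine_step_even[OF fin less.prems(1) eq e])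
        fix k assume k: "k \<in> odds R"
        have "odds (R - {e} - {k}) = odds R - {k}" "evens (R - {e} - {k}) = evens R - {e}" using k e by auto
        moreover have "card (odds R - {k}) = card (odds R) - 1" "card (evens R - {e}) = card (evens R) - 1"
          using k e fin2 by simp_all
        moreover have "card (R - {e} - {k}) < card R" using k fin by (intro psubset_card_mono) auto
        ultimately show "alternating_sum {1..int m - 1} (sine m) (R - {e} - {k}) = sine_prod m (R - {e} - {k})"
          using eq less.prems(1) by (intro less.hyps) auto
      qed
    qed
  qed
qed

text \<open>A term with nonzero entry removes one odd row, or one odd and one even row, so the
  surplus of even rows persists. Once no odd row is left, every entry of the expansion is 0.\<close>

lemma alternating_sum_sine_unbalanced:
  assumes "R \<subseteq> {1..int m - 1}" "card (evens R) > card (odds R)"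
  shows "alternating_sum {1..int m - 1} (sine m) R = 0"
  using assms
proof (induction "card R" arbitrary: R rule: less_induct)
  case less
  let ?X = "{1..int m - 1}"
  have fin: "finite R" using less.prems(1) finite_subset by blast
  then have fin2: "finite (odds R)" "finite (evens R)" by auto
  have "evens R \<noteq> {}" using less.prems(2) by (intro notI) simp
  then obtain e where e: "e \<in> evens R" by blast
  then have m: "m > 0" using less.prems by auto
  show ?case
  proof (cases "odd (card R)")
    case True
    have "(\<Sum>x\<in>?X. sine m k x) * alternating_sum ?X (sine m) (R - {k}) = 0" if "k \<in> R" for k
    proof (cases "odd k")
      case True
      then have k: "k \<in> odds R" using that by simp
      have "odds (R - {k}) = odds R - {k}" "evens (R - {k}) = evens R" using k by auto
      moreover have "card (odds R - {k}) = card (odds R) - 1" using k fin2 by simp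
      moreover have "card (R - {k}) < card R" using k fin by (intro psubset_card_mono) auto
      ultimately have "alternating_sum ?X (sine m) (R - {k}) = 0"
        using less.prems by (intro less.hyps) auto
      then show ?thesis by simp
    next
      case False
      then show ?thesis using that less.prems by (subst sum_sine_row_weight) auto
    qed
    then show ?thesis unfolding alternating_sum_odd[OF fin True] by (intro sum.neutral) (auto simp: mult.assoc)
  next
    case False
    have "(\<Sum>u\<in>?X. \<Sum>v\<in>?X. sgn (real_of_int u - real_of_int v) * sine m e u * sine m k v) * alternating_sum ?X (sine m) (R - {e} - {k}) = 0" if "k \<in> R" for k
    proof (cases "odd k")
      case True
      then have k: "k \<in> odds R" using that by simp
      have "odds (R - {e} - {k}) = odds R - {k}" "evens (R - {e} - {k}) = evens R - {e}" using k e by auto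
      moreover have "card (odds R) > 0" using k fin2 by (auto simp: card_gt_0_iff)
      moreover have "card (odds R - {k}) = card (odds R) - 1" "card (evens R - {e}) = card (evens R) - 1" using k e fin2 by simp_all
      moreover have "card (R - {e} - {k}) < card R" using k fin by (intro psubset_card_mono) auto
      ultimately have "alternating_sum ?X (sine m) (R - {e} - {k}) = 0"
        using less.prems by (intro less.hyps) auto
      then show ?thesis by simp
    next
      case False
      moreover have "e \<in> ?X" "k \<in> ?X" using that e less.prems(1) by blast+
      ultimately show ?thesis using sgn_sum_even_even[OF m, of e k] e by simp
    qed
    moreover have "e \<in> R" "even (card R)" using e False by auto
    ultimately show ?thesis by (subst alternating_sum_even[of R e]) (auto simp: fin mult.assoc intro!: sum.neutral)
  qed
qed

section \<open>The Weyl numerator\<close>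

text \<open>Laplace expansion along the last column: with as many columns as rows an injective
  choice uses the top column exactly once, and since that value is the largest its comparisons
  contribute just a rank sign.\<close>

lemma alternating_sum_top:
  assumes "finite I" "card I = Suc N"
  shows "alternating_sum {1..int (Suc N)} f I = (\<Sum>k\<in>I. rank_sign k I * f k (int (Suc N)) * alternating_sum {1..int N} f (I - {k}))"
proof -
  let ?T = "int (Suc N)"
  let ?X = "{1..?T}" and ?Y = "{1..int N}"
  define F where "F = (\<lambda>y. order_sign I y * (\<Prod>i\<in>I. f i (y i)))"
  \<comment> \<open>For injective \<open>y\<close> exactly one \<open>k\<close> meets the condition;
    for the others \<open>F y\<close> is 0. This inserts the sum over \<open>k\<close> without
    partitioning the index set.\<close>
  have single: "F y = (\<Sum>k\<in>I. if y k = ?T \<and> (\<forall>j\<in>I-{k}. y j \<in> ?Y) then F y else 0)" if y: "y \<in> I \<rightarrow>\<^sub>E ?X" for y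
  proof (cases "inj_on y I")
    case True
    have "y ` I = ?X"
    proof (rule card_subset_eq)
      show "y ` I \<subseteq> ?X" using y by auto
      show "card (y ` I) = card ?X" using True assms by (simp add: card_image)
    qed simp
    moreover have "?T \<in> ?X" by simp
    ultimately have "?T \<in> y ` I" by (simp only:)
    then obtain k where k: "k \<in> I" "y k = ?T" by (elim imageE) simp
    have other: "y j \<in> ?Y" if "j \<in> I - {k}" for j
    proof -
      have "y j \<in> ?X" using that PiE_mem[OF y] by blast
      moreover have "y j \<noteq> ?T" using that k inj_onD[OF True, of j k] by auto
      ultimately show ?thesis by auto
    qed
    have "(\<Sum>k\<in>I. if y k = ?T \<and> (\<forall>j\<in>I-{k}. y j \<in> ?Y) then F y else 0) =
      (\<Sum>l\<in>{k}. if y l = ?T \<and> (\<forall>j\<in>I-{l}. y j \<in> ?Y) then F y else 0)"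
    proof (rule sum.mono_neutral_right)
      show "\<forall>l\<in>I - {k}. (if y l = ?T \<and> (\<forall>j\<in>I-{l}. y j \<in> ?Y) then F y else 0) = 0"
        using k other by force
    qed (use assms k in auto)
    then show ?thesis using k other by simp
  next
    case False
    then have Fy: "F y = 0" using order_sign_not_inj[OF assms(1), of y] by (simp add: F_def)
    show ?thesis unfolding Fy by simp
  qed
  have "alternating_sum ?X f I = (\<Sum>y\<in>I \<rightarrow>\<^sub>E ?X. F y)" by (simp add: alternating_sum_def F_def)
  also have "\<dots> = (\<Sum>y\<in>I \<rightarrow>\<^sub>E ?X. \<Sum>k\<in>I. if y k = ?T \<and> (\<forall>j\<in>I-{k}. y j \<in> ?Y) then F y else 0)"
    by (rule sum.cong[OF refl]) (rule single)
  also have "\<dots> = (\<Sum>k\<in>I. \<Sum>y\<in>I \<rightarrow>\<^sub>E ?X. if y k = ?T \<and> (\<forall>j\<in>I-{k}. y j \<in> ?Y) then F y else 0)"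
    by (rule sum.swap)
  also have "\<dots> = (\<Sum>k\<in>I. rank_sign k I * f k ?T * alternating_sum ?Y f (I - {k}))"
  proof (rule sum.cong[OF refl])
    fix k assume k: "k \<in> I"
    have "(\<Sum>y\<in>I \<rightarrow>\<^sub>E ?X. if y k = ?T \<and> (\<forall>j\<in>I-{k}. y j \<in> ?Y) then F y else 0) =
      (\<Sum>x\<in>?X. \<Sum>g\<in>(I-{k}) \<rightarrow>\<^sub>E ?X. if x = ?T \<and> (\<forall>j\<in>I-{k}. g j \<in> ?Y) then F (g(k := x)) else 0)"
      by (subst sum_PiE_remove[OF k]) (intro sum.cong refl, auto)
    also have "\<dots> = (\<Sum>x\<in>{?T}. \<Sum>g\<in>(I-{k}) \<rightarrow>\<^sub>E ?X. if x = ?T \<and> (\<forall>j\<in>I-{k}. g j \<in> ?Y) then F (g(k := x)) else 0)"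
      by (rule sum.mono_neutral_right) auto
    also have "\<dots> = (\<Sum>g\<in>(I-{k}) \<rightarrow>\<^sub>E ?X. if \<forall>j\<in>I-{k}. g j \<in> ?Y then F (g(k := ?T)) else 0)"
      by simp
    also have "\<dots> = (\<Sum>g\<in>(I-{k}) \<rightarrow>\<^sub>E ?Y. F (g(k := ?T)))"
    proof (rule sum.mono_neutral_cong_right)
      show "finite ((I-{k}) \<rightarrow>\<^sub>E ?X)" using assms by (intro finite_PiE) auto
      show "(I-{k}) \<rightarrow>\<^sub>E ?Y \<subseteq> (I-{k}) \<rightarrow>\<^sub>E ?X" by (intro PiE_mono) auto
    qed (auto simp: PiE_iff Pi_iff)
    also have "\<dots> = (\<Sum>g\<in>(I-{k}) \<rightarrow>\<^sub>E ?Y. rank_sign k I * f k ?T * (order_sign (I - {k}) g * (\<Prod>i\<in>I-{k}. f i (g i))))"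
    proof (rule sum.cong[OF refl])
      fix g assume g: "g \<in> (I-{k}) \<rightarrow>\<^sub>E ?Y"
      have "(\<Prod>j\<in>I-{k}. sgn (real_of_int ((g(k := ?T)) k) - real_of_int ((g(k := ?T)) j))) = 1"
      proof (rule prod.neutral, rule ballI)
        fix j assume j: "j \<in> I - {k}"
        then have "g j < ?T" using PiE_mem[OF g j] by simp
        then show "sgn (real_of_int ((g(k := ?T)) k) - real_of_int ((g(k := ?T)) j)) = 1" using j by simp
      qed
      moreover have "order_sign (I - {k}) (g(k := ?T)) = order_sign (I - {k}) g" by (rule order_sign_cong) auto
      ultimately have "order_sign I (g(k := ?T)) = rank_sign k I * order_sign (I - {k}) g"
        by (subst order_sign_remove[OF assms(1) k]) simp
      moreover have "(\<Prod>i\<in>I. f i ((g(k := ?T)) i)) = f k ?T * (\<Prod>i\<in>I-{k}. f i (g i))"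
        using k assms(1) by (subst prod.remove[of _ k]) auto
      ultimately show "F (g(k := ?T)) = rank_sign k I * f k ?T * (order_sign (I - {k}) g * (\<Prod>i\<in>I-{k}. f i (g i)))"
        unfolding F_def by simp
    qed
    also have "\<dots> = rank_sign k I * f k ?T * alternating_sum ?Y f (I - {k})"
      unfolding alternating_sum_def by (simp only: sum_distrib_left)
    finally show "(\<Sum>y\<in>I \<rightarrow>\<^sub>E ?X. if y k = ?T \<and> (\<forall>j\<in>I-{k}. y j \<in> ?Y) then F y else 0) =
      rank_sign k I * f k ?T * alternating_sum ?Y f (I - {k})" .
  qed
  finally show ?thesis .
qed

fun chebyshev_U :: "nat \<Rightarrow> real poly" where
  "chebyshev_U 0 = 1"
| "chebyshev_U (Suc 0) = [:0, 2:]"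
| "chebyshev_U (Suc (Suc n)) = [:0, 2:] * chebyshev_U (Suc n) - chebyshev_U n"

text \<open>The leading coefficient is the source of the power of two in
  \<open>weyl_numerator\<close>.\<close>

lemma chebyshev_U_degree: "degree (chebyshev_U n) \<le> n \<and> coeff (chebyshev_U n) n = 2 ^ n"
proof (induction n rule: chebyshev_U.induct)
  case (3 n)
  have "degree ([:0, 2:] * chebyshev_U (Suc n)) \<le> Suc (Suc n)"
    using degree_mult_le[of "[:0, 2:]" "chebyshev_U (Suc n)"] 3(1) by simp
  then have "degree (chebyshev_U (Suc (Suc n))) \<le> Suc (Suc n)"
    using 3(2) by (auto intro!: degree_diff_le)
  moreover have "coeff (chebyshev_U n) (Suc (Suc n)) = 0"
    using 3(2) by (intro coeff_eq_0) simp
  ultimately show ?case using 3(1) by simp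
qed auto

lemma chebyshev_U_sin: "sin (real (Suc n) * t) = sin t * poly (chebyshev_U n) (cos t)"
proof (induction n rule: chebyshev_U.induct)
  case (3 n)
  have "sin (real (Suc (Suc (Suc n))) * t) = sin (real (Suc (Suc n)) * t + t)"
    by (simp add: algebra_simps)
  moreover have "sin (real (Suc n) * t) = sin (real (Suc (Suc n)) * t - t)"
    by (simp add: algebra_simps)
  ultimately have "sin (real (Suc (Suc (Suc n))) * t) = 2 * cos t * sin (real (Suc (Suc n)) * t) - sin (real (Suc n) * t)"
    unfolding sin_add sin_diff by simp
  then show ?case unfolding 3 by (simp add: algebra_simps)
qed (use sin_double[of t] in auto)

text \<open>The Weyl denominator formula of type C. In the expansion along the highest frequency,
  sin((N + 1) t) = sin t U_N(cos t), and what remains is Lagrange's formula for the top coefficient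
  of U_N, a factor 2^N in each step.\<close>

lemma weyl_numerator:
  assumes "finite I" "inj_on (\<lambda>i. cosine m (x i)) I"
  shows "alternating_sum {1..int (card I)} (\<lambda>i \<rho>. sine m \<rho> (x i)) I =
     2 ^ (card I * (card I - 1) div 2) * (\<Prod>i\<in>I. sine m 1 (x i)) * pair_prod I (\<lambda>i j. cosine m (x i) - cosine m (x j))"
  using assms
proof (induction "card I" arbitrary: I)
  case (Suc N)
  let ?f = "\<lambda>i \<rho>. sine m \<rho> (x i)" and ?d = "\<lambda>i j. cosine m (x i) - cosine m (x j)"
  define C where "C = 2 ^ (N * (N - 1) div 2) * (\<Prod>i\<in>I. sine m 1 (x i)) * pair_prod I ?d"
  have N: "card I = Suc N" using Suc by simp
  have "alternating_sum {1..int (card I)} ?f I = (\<Sum>k\<in>I. rank_sign k I * ?f k (int (Suc N)) * alternating_sum {1..int N} ?f (I - {k}))"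
    unfolding N by (rule alternating_sum_top[OF Suc.prems(1) N])
  also have "\<dots> = (\<Sum>k\<in>I. C * (poly (chebyshev_U N) (cosine m (x k)) / (\<Prod>j\<in>I-{k}. ?d k j)))"
  proof (rule sum.cong[OF refl])
    fix k assume k: "k \<in> I"
    have card: "card (I - {k}) = N" using N k Suc.prems by simp
    have IH: "alternating_sum {1..int N} ?f (I - {k}) = 2 ^ (N * (N - 1) div 2) * (\<Prod>i\<in>I-{k}. sine m 1 (x i)) * pair_prod (I-{k}) ?d"
      using Suc.hyps(1)[of "I - {k}"] Suc.prems card inj_on_subset[OF Suc.prems(2), of "I - {k}"] by auto
    have s: "?f k (int (Suc N)) = sine m 1 (x k) * poly (chebyshev_U N) (cosine m (x k))"
      using chebyshev_U_sin[of N "pi / real m * real_of_int (x k)"] by (simp add: sine_def cosine_def mult_ac)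
    have p: "pair_prod I ?d = rank_sign k I * (\<Prod>j\<in>I-{k}. ?d k j) * pair_prod (I - {k}) ?d"
      using Suc.prems(1) k by (intro pair_prod_remove_anti) auto
    have "?d k j \<noteq> 0" if "j \<in> I - {k}" for j
      using inj_onD[OF Suc.prems(2), of k j] that k by auto
    then have nz: "(\<Prod>j\<in>I-{k}. ?d k j) \<noteq> 0" using Suc.prems(1) by simp
    show "rank_sign k I * ?f k (int (Suc N)) * alternating_sum {1..int N} ?f (I - {k}) = C * (poly (chebyshev_U N) (cosine m (x k)) / (\<Prod>j\<in>I-{k}. ?d k j))"
      unfolding C_def IH s p prod.remove[OF Suc.prems(1) k, of "\<lambda>i. sine m 1 (x i)"]
      using nz by (simp add: field_simps)
  qed
  also have "\<dots> = C * coeff (chebyshev_U N) (card I - 1)"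
    unfolding sum_distrib_left[symmetric]
    using chebyshev_U_degree[of N] N Suc.prems by (subst lagrange_coeff) auto
  also have "\<dots> = C * 2 ^ N" using chebyshev_U_degree[of N] N by simp
  also have "\<dots> = 2 ^ (N * (N - 1) div 2 + N) * (\<Prod>i\<in>I. sine m 1 (x i)) * pair_prod I ?d"
    unfolding C_def by (simp add: power_add)
  also have "N * (N - 1) div 2 + N = Suc N * N div 2"
  proof -
    have "Suc N * N = N * (N - 1) + N * 2" by (cases N) (auto simp: algebra_simps)
    then show ?thesis by simp
  qed
  finally show ?case unfolding N by simp
qed auto

section \<open>Walks and the method of images\<close>

lemma order_sign_swap:
  assumes "finite I" "a \<in> I" "b \<in> I" "a \<noteq> b"
  shows "order_sign I (y(a := y b, b := y a)) = - order_sign I y"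
proof -
  let ?K = "I - {a} - {b}"
  let ?z = "y(a := y b, b := y a)"
  have exp: "order_sign I w = rank_sign a I * rank_sign b (I - {a}) * sgn (real_of_int (w a) - real_of_int (w b)) *
      ((\<Prod>j\<in>?K. sgn (real_of_int (w a) - real_of_int (w j))) *
       (\<Prod>j\<in>?K. sgn (real_of_int (w b) - real_of_int (w j)))) * order_sign ?K w" for w
    using assms by (simp add: order_sign_remove[of I a] order_sign_remove[of "I - {a}" b]
        prod.remove[of "I - {a}" b])
  have "order_sign ?K ?z = order_sign ?K y" by (rule order_sign_cong) auto
  moreover have "(\<Prod>j\<in>?K. sgn (real_of_int (?z a) - real_of_int (?z j))) = (\<Prod>j\<in>?K. sgn (real_of_int (y b) - real_of_int (y j)))"
    using assms by (intro prod.cong) auto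
  moreover have "(\<Prod>j\<in>?K. sgn (real_of_int (?z b) - real_of_int (?z j))) = (\<Prod>j\<in>?K. sgn (real_of_int (y a) - real_of_int (y j)))"
    using assms by (intro prod.cong) auto
  moreover have "sgn (real_of_int (?z a) - real_of_int (?z b)) = - sgn (real_of_int (y a) - real_of_int (y b))"
    using assms by (simp flip: sgn_minus)
  ultimately show ?thesis unfolding exp[of ?z] exp[of y] by simp
qed

text \<open>Exchanging two coordinates permutes the index set of the sum. Besides order signs,
  \<open>H\<close> will be the weights in \<open>walk_sum\<close>, which yields the vanishing on the
  diagonals.\<close>

lemma antisymmetric_sum_swap:
  fixes H :: "('i \<Rightarrow> int) \<Rightarrow> real"
  assumes "finite I" "a \<in> I" "b \<in> I" "a \<noteq> b"
    and H: "\<And>y. H (y(a := y b, b := y a)) = - H y"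
  shows "(\<Sum>y\<in>I \<rightarrow>\<^sub>E X. H y * (\<Prod>i\<in>I. (f(a := f b, b := f a)) i (y i))) =
    - (\<Sum>y\<in>I \<rightarrow>\<^sub>E X. H y * (\<Prod>i\<in>I. f i (y i)))"
proof -
  let ?s = "\<lambda>y::'i \<Rightarrow> int. y(a := y b, b := y a)"
  have split: "(\<Prod>i\<in>I. G i) = G a * (G b * (\<Prod>i\<in>I - {a} - {b}. G i))" for G :: "'i \<Rightarrow> real"
    using assms by (simp add: prod.remove[of I a] prod.remove[of "I - {a}" b])
  have "(\<Sum>y\<in>I \<rightarrow>\<^sub>E X. H y * (\<Prod>i\<in>I. (f(a := f b, b := f a)) i (y i))) =
      (\<Sum>y\<in>I \<rightarrow>\<^sub>E X. - (H y * (\<Prod>i\<in>I. f i (y i))))"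
  proof (rule sum.reindex_bij_witness[of _ ?s ?s])
    fix y assume y: "y \<in> I \<rightarrow>\<^sub>E X"
    show "?s (?s y) = y" "?s (?s y) = y" by auto
    show "?s y \<in> I \<rightarrow>\<^sub>E X" "?s y \<in> I \<rightarrow>\<^sub>E X" using y assms by (auto simp: PiE_iff extensional_def)
    have "(\<Prod>i\<in>I. f i (?s y i)) = (\<Prod>i\<in>I. (f(a := f b, b := f a)) i (y i))"
      unfolding split using assms(2-4) by (auto intro!: prod.cong)
    then show "- (H (?s y) * (\<Prod>i\<in>I. f i (?s y i))) = H y * (\<Prod>i\<in>I. (f(a := f b, b := f a)) i (y i))"
      by (simp add: H)
  qed
  then show ?thesis by (simp add: sum_negf)
qed

lemma alternating_sum_swap:
  assumes "finite I" "a \<in> I" "b \<in> I" "a \<noteq> b"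
  shows "alternating_sum X (f(a := f b, b := f a)) I = - alternating_sum X f I"
  unfolding alternating_sum_def using assms by (intro antisymmetric_sum_swap order_sign_swap)

lemma alternating_sum_equal_rows:
  assumes "finite I" "a \<in> I" "b \<in> I" "a \<noteq> b" "f a = f b"
  shows "alternating_sum X f I = 0"
proof -
  have "f(a := f b, b := f a) = f" using assms by auto
  then show ?thesis using alternating_sum_swap[OF assms(1-4), of X f] by simp
qed

text \<open>A permutation of the rows costs its sign. This separates the dependence on the order of
  the frequencies from the dependence on their set.\<close>

lemma alternating_sum_comp:
  assumes "finite I" "inj_on r I"
  shows "alternating_sum X (\<lambda>i. f (r i)) I = order_sign I r * order_sign (r ` I) (\<lambda>a. a) * alternating_sum X f (r ` I)"
proof -
  let ?p = "\<lambda>y. restrict (\<lambda>i. y (r i)) I" and ?q = "\<lambda>y. restrict (\<lambda>j. y (inv_into I r j)) (r ` I)"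
  have "alternating_sum X (\<lambda>i. f (r i)) I = (\<Sum>y\<in>r ` I \<rightarrow>\<^sub>E X. order_sign I r * order_sign (r ` I) (\<lambda>a. a) * (order_sign (r ` I) y * (\<Prod>i\<in>r ` I. f i (y i))))"
    unfolding alternating_sum_def
  proof (rule sum.reindex_bij_witness[of _ ?p ?q])
    fix y assume y: "y \<in> I \<rightarrow>\<^sub>E X"
    show "?p (?q y) = y"
    proof
      fix i show "?p (?q y) i = y i" using y assms by (cases "i \<in> I") (auto simp: PiE_iff extensional_def)
    qed
    show "?q y \<in> r ` I \<rightarrow>\<^sub>E X" using y assms by auto
    have "order_sign I y = order_sign I (\<lambda>i. ?q y (r i))" using assms by (intro order_sign_cong) auto
    also have "\<dots> = order_sign I r * (order_sign (r ` I) (\<lambda>a. a) * order_sign (r ` I) (?q y))" by (rule order_sign_comp[OF assms])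
    finally have "order_sign I y = order_sign I r * (order_sign (r ` I) (\<lambda>a. a) * order_sign (r ` I) (?q y))" .
    moreover have "(\<Prod>i\<in>r ` I. f i (?q y i)) = (\<Prod>i\<in>I. f (r i) (y i))"
      using assms by (simp add: prod.reindex)
    ultimately show "order_sign I r * order_sign (r ` I) (\<lambda>a. a) * (order_sign (r ` I) (?q y) * (\<Prod>i\<in>r ` I. f i (?q y i))) = order_sign I y * (\<Prod>i\<in>I. f (r i) (y i))"
      by simp
  next
    fix y assume y: "y \<in> r ` I \<rightarrow>\<^sub>E X"
    show "?q (?p y) = y"
    proof
      fix i show "?q (?p y) i = y i" using y assms by (cases "i \<in> r ` I") (auto simp: PiE_iff extensional_def inv_into_into f_inv_into_f)
    qed
    show "?p y \<in> I \<rightarrow>\<^sub>E X" using y by auto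
  qed
  then show ?thesis unfolding alternating_sum_def by (simp only: sum_distrib_left)
qed

text \<open>\<open>walk_sum\<close> is the number of walks extended to all of \<open>\<int>\<^sup>n\<close> as an antisymmetric function:
  the method of images, carried out in the sine basis.\<close>

definition walk_sum :: "nat \<Rightarrow> nat \<Rightarrow> nat \<Rightarrow> (nat \<Rightarrow> int) \<Rightarrow> real" where
  "walk_sum n m k x = (\<Sum>r\<in>{1..n} \<rightarrow>\<^sub>E {1..int m - 1}.
     (2 / real m) ^ n * alternating_sum {1..int m - 1} (\<lambda>i. sine m (r i)) {1..n} *
     (\<Sum>i\<in>{1..n}. 2 * cosine m (r i)) ^ k * (\<Prod>i\<in>{1..n}. sine m (r i) (x i)))"

section \<open>Sine transform: initial value, recursion and zeros of the image sum\<close>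

lemma sum_cos_telescope:
  assumes "a \<le> b + 1"
  shows "2 * sin h * (\<Sum>x\<in>{a..b::int}. cos (2 * h * real_of_int x)) =
     sin (h * (2 * real_of_int b + 1)) - sin (h * (2 * real_of_int a - 1))"
proof -
  have "a - 1 \<le> b" using assms by simp
  then show ?thesis
  proof (induction b rule: int_ge_induct)
    case base
    then show ?case by (simp add: algebra_simps)
  next
    case (step b)
    have "{a..b + 1} = insert (b + 1) {a..b}" using step by auto
    moreover have "2 * sin h * cos (2 * h * real_of_int (b + 1)) =
        sin (h * (2 * real_of_int (b + 1) + 1)) - sin (h * (2 * real_of_int b + 1))"
    proof -
      have "h * (2 * real_of_int b + 1) = 2 * h * real_of_int (b + 1) - h"
        "h * (2 * real_of_int (b + 1) + 1) = 2 * h * real_of_int (b + 1) + h"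
        by (simp_all add: algebra_simps)
      then show ?thesis by (simp only: sin_add sin_diff) simp
    qed
    ultimately show ?case using step.IH by (simp add: distrib_left)
  qed
qed

lemma cos_sum:
  assumes "m > 0" "l \<noteq> 0" "\<bar>l\<bar> < 2 * int m"
  shows "(\<Sum>r\<in>{1..int m - 1}. cosine m (r * l)) = (if even l then -1 else 0)"
proof -
  define h where "h = pi / real m * real_of_int l / 2"
  have h0: "sin h \<noteq> 0" using sin_half_angle_nonzero assms unfolding h_def by auto
  have hm: "2 * h * real m = real_of_int l * pi" using assms by (simp add: h_def)
  have s: "sin (real_of_int l * pi) = 0" by (simp add: sin_zero_iff_int2)
  have "(\<Sum>r\<in>{1..int m - 1}. cosine m (r * l)) = (\<Sum>x\<in>{1..int m - 1}. cos (2 * h * real_of_int x))"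
    by (simp add: cosine_def h_def mult_ac)
  then have "2 * sin h * (\<Sum>r\<in>{1..int m - 1}. cosine m (r * l)) = sin (real_of_int l * pi - h) - sin h"
    using sum_cos_telescope[of 1 "int m - 1" h] assms hm by (simp add: algebra_simps)
  also have "\<dots> = 2 * sin h * (if even l then -1 else 0)"
    by (simp add: sin_diff s cos_int_pi)
  finally show ?thesis using h0 by (auto split: if_splits)
qed

text \<open>Since \<open>x - y\<close> and \<open>x + y\<close> have equal parity, the two cosine
  sums cancel unless \<open>x = y\<close>, where they are m - 1 and -1.\<close>

lemma sine_orthogonality:
  assumes "m > 0" "x \<in> {1..int m - 1}" "y \<in> {1..int m - 1}"
  shows "(\<Sum>r\<in>{1..int m - 1}. sine m r x * sine m r y) = (if x = y then real m / 2 else 0)"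
proof -
  let ?X = "{1..int m - 1}"
  have "sine m r x * sine m r y = (cosine m (r * (x - y)) - cosine m (r * (x + y))) / 2" for r
    by (simp add: sine_def cosine_def algebra_simps cos_add cos_diff)
  then have sum: "(\<Sum>r\<in>?X. sine m r x * sine m r y) = ((\<Sum>r\<in>?X. cosine m (r * (x - y))) - (\<Sum>r\<in>?X. cosine m (r * (x + y)))) / 2"
    by (simp only: sum_subtractf flip: sum_divide_distrib)
  have plus: "(\<Sum>r\<in>?X. cosine m (r * (x + y))) = (if even (x + y) then -1 else 0)"
    using assms by (intro cos_sum) auto
  show ?thesis
  proof (cases "x = y")
    case True
    have "(\<Sum>r\<in>?X. cosine m (r * (x - y))) = real m - 1"
      using True assms(1) by (simp add: cosine_def of_nat_diff nat_diff_distrib)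
    then show ?thesis unfolding sum plus by (simp only:) (use True in simp)
  next
    case False
    then have "(\<Sum>r\<in>?X. cosine m (r * (x - y))) = (if even (x - y) then -1 else 0)"
      using assms by (intro cos_sum) auto
    then show ?thesis unfolding sum plus using False by simp
  qed
qed

text \<open>The weights at time 0 are the sine transform of the order sign, which is the
  antisymmetric extension of the constant 1 on the alcove. Orthogonality inverts the transform on
  the whole box.\<close>

lemma walk_sum_0:
  assumes "m > 0" "\<And>i. i \<in> {1..n} \<Longrightarrow> x i \<in> {1..int m - 1}"
  shows "walk_sum n m 0 x = order_sign {1..n} x"
proof -
  let ?I = "{1..n}" and ?X = "{1..int m - 1}"
  let ?P = "?I \<rightarrow>\<^sub>E ?X"
  have "walk_sum n m 0 x = (\<Sum>r\<in>?P. \<Sum>y\<in>?P. (2 / real m) ^ n * order_sign ?I y * (\<Prod>i\<in>?I. sine m (r i) (x i) * sine m (r i) (y i)))"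
    unfolding walk_sum_def alternating_sum_def
    by (intro sum.cong refl) (simp add: sum_distrib_left sum_distrib_right prod.distrib mult_ac)
  also have "\<dots> = (\<Sum>y\<in>?P. (2 / real m) ^ n * order_sign ?I y * (\<Sum>r\<in>?P. \<Prod>i\<in>?I. sine m (r i) (x i) * sine m (r i) (y i)))"
    by (subst sum.swap) (simp add: sum_distrib_left)
  also have "\<dots> = (\<Sum>y\<in>?P. (2 / real m) ^ n * order_sign ?I y * (\<Prod>i\<in>?I. \<Sum>r\<in>?X. sine m r (x i) * sine m r (y i)))"
    by (subst prod_sum_PiE) auto
  also have "\<dots> = (\<Sum>y\<in>?P. if y = restrict x ?I then order_sign ?I x else 0)"
  proof (rule sum.cong[OF refl])
    fix y assume y: "y \<in> ?P"
    have orth: "(\<Prod>i\<in>?I. \<Sum>r\<in>?X. sine m r (x i) * sine m r (y i)) = (\<Prod>i\<in>?I. if x i = y i then real m / 2 else 0)"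
      using y assms by (intro prod.cong refl sine_orthogonality) auto
    show "(2 / real m) ^ n * order_sign ?I y * (\<Prod>i\<in>?I. \<Sum>r\<in>?X. sine m r (x i) * sine m r (y i)) = (if y = restrict x ?I then order_sign ?I x else 0)"
    proof (cases "y = restrict x ?I")
      case True
      have "order_sign ?I y = order_sign ?I x" unfolding True by (rule order_sign_cong) auto
      moreover have "(\<Prod>i\<in>?I. if x i = y i then real m / 2 else 0) = (real m / 2) ^ n"
        unfolding True by simp
      ultimately show ?thesis unfolding orth using True assms(1) by (simp flip: power_mult_distrib)
    next
      case False
      then obtain i where "i \<in> ?I" "x i \<noteq> y i"
        using y PiE_ext[of y ?I "\<lambda>_. ?X" "restrict x ?I"] assms(2) by fastforce
      then have "(\<Prod>i\<in>?I. if x i = y i then real m / 2 else 0) = 0" by (intro prod_zero) auto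
      then show ?thesis unfolding orth using False by simp
    qed
  qed
  also have "\<dots> = order_sign ?I x"
  proof -
    have "restrict x ?I \<in> ?P" using assms(2) by auto
    moreover have "finite ?P" by (intro finite_PiE) auto
    ultimately show ?thesis by (simp add: sum.delta')
  qed
  finally show ?thesis .
qed

text \<open>All 2n neighbours are summed, with no regard to walls. Each product of sines is an
  eigenfunction, by sin(a + b) + sin(a - b) = 2 sin a cos b in every coordinate.\<close>

lemma walk_sum_Suc:
  "walk_sum n m (Suc k) x = (\<Sum>i\<in>{1..n}. walk_sum n m k (x(i := x i + 1)) + walk_sum n m k (x(i := x i - 1)))"
proof -
  let ?I = "{1..n}" and ?P = "{1..n} \<rightarrow>\<^sub>E {1..int m - 1}"
  define A where "A = (\<lambda>r. (2 / real m) ^ n * alternating_sum {1..int m - 1} (\<lambda>i. sine m (r i)) ?I * (\<Sum>i\<in>?I. 2 * cosine m (r i)) ^ k)"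
  define S where "S = (\<lambda>r z. \<Prod>i\<in>?I. sine m (r i) (z i))"
  have V: "walk_sum n m k z = (\<Sum>r\<in>?P. A r * S r z)" for z unfolding walk_sum_def A_def S_def ..
  have step: "S r (x(j := x j + 1)) + S r (x(j := x j - 1)) = 2 * cosine m (r j) * S r x" if j: "j \<in> ?I" for r j
  proof -
    have upd: "S r (x(j := v)) = sine m (r j) v * (\<Prod>i\<in>?I - {j}. sine m (r i) (x i))" for v
      unfolding S_def using j by (subst prod.remove[of _ j]) (auto intro!: prod.cong)
    have "sine m (r j) (x j + 1) + sine m (r j) (x j - 1) = 2 * cosine m (r j) * sine m (r j) (x j)"
      by (simp add: sine_def cosine_def algebra_simps sin_add sin_diff)
    then have "S r (x(j := x j + 1)) + S r (x(j := x j - 1)) = 2 * cosine m (r j) * (sine m (r j) (x j) * (\<Prod>i\<in>?I - {j}. sine m (r i) (x i)))"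
      unfolding upd by (simp add: algebra_simps flip: distrib_right)
    then show ?thesis unfolding S_def using j by (subst prod.remove[of _ j]) auto
  qed
  have "(\<Sum>i\<in>?I. walk_sum n m k (x(i := x i + 1)) + walk_sum n m k (x(i := x i - 1))) =
     (\<Sum>i\<in>?I. \<Sum>r\<in>?P. A r * (2 * cosine m (r i) * S r x))"
  proof (rule sum.cong[OF refl])
    fix i assume "i \<in> ?I"
    then show "walk_sum n m k (x(i := x i + 1)) + walk_sum n m k (x(i := x i - 1)) = (\<Sum>r\<in>?P. A r * (2 * cosine m (r i) * S r x))"
      by (simp only: V flip: sum.distrib distrib_left) (simp only: step)
  qed
  also have "\<dots> = (\<Sum>r\<in>?P. \<Sum>i\<in>?I. A r * (2 * cosine m (r i) * S r x))" by (rule sum.swap)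
  also have "\<dots> = (\<Sum>r\<in>?P. A r * (\<Sum>i\<in>?I. 2 * cosine m (r i)) * S r x)"
    by (simp only: sum_distrib_left sum_distrib_right mult.assoc)
  also have "\<dots> = walk_sum n m (Suc k) x"
    unfolding walk_sum_def A_def S_def by (simp only: power_Suc2 mult.assoc)
  finally show ?thesis ..
qed

lemma walk_sum_wall:
  assumes "m > 0" "j \<in> {1..n}" "x j = 0 \<or> x j = int m"
  shows "walk_sum n m k x = 0"
proof -
  have "sine m r (x j) = 0" for r
    using assms(1,3) by (auto simp: sine_def sin_zero_iff_int2)
  then have "(\<Prod>i\<in>{1..n}. sine m (r i) (x i)) = 0" for r
    using assms(2) by (intro prod_zero bexI[of _ j]) auto
  then show ?thesis unfolding walk_sum_def by (simp only: mult_zero_right sum.neutral_const)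
qed

text \<open>Exchanging the frequencies at \<open>a\<close> and \<open>b\<close> negates the weight
  and preserves the eigenvalue, while equal coordinates make the product of sines invariant. So the
  sum equals its negative.\<close>

lemma walk_sum_diagonal:
  assumes "a \<in> {1..n}" "b \<in> {1..n}" "a \<noteq> b" "x a = x b"
  shows "walk_sum n m k x = 0"
proof -
  let ?I = "{1..n}"
  define H where "H = (\<lambda>r. (2 / real m) ^ n * alternating_sum {1..int m - 1} (\<lambda>i. sine m (r i)) ?I * (\<Sum>i\<in>?I. 2 * cosine m (r i)) ^ k)"
  define f where "f = (\<lambda>i \<rho>. sine m \<rho> (x i))"
  have V: "walk_sum n m k x = (\<Sum>r\<in>?I \<rightarrow>\<^sub>E {1..int m - 1}. H r * (\<Prod>i\<in>?I. f i (r i)))"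
    unfolding walk_sum_def H_def f_def ..
  have "H (r(a := r b, b := r a)) = - H r" for r
  proof -
    have "(\<lambda>i. sine m ((r(a := r b, b := r a)) i)) = (\<lambda>i. sine m (r i))(a := sine m (r b), b := sine m (r a))"
      by auto
    moreover have "alternating_sum {1..int m - 1} ((\<lambda>i. sine m (r i))(a := sine m (r b), b := sine m (r a))) ?I = - alternating_sum {1..int m - 1} (\<lambda>i. sine m (r i)) ?I"
      using assms by (intro alternating_sum_swap) auto
    moreover have "(\<Sum>i\<in>?I. 2 * cosine m ((r(a := r b, b := r a)) i)) = (\<Sum>i\<in>?I. 2 * cosine m (r i))"
    proof -
      have split: "(\<Sum>i\<in>?I. G i) = G a + (G b + (\<Sum>i\<in>?I - {a} - {b}. G i))" for G :: "nat \<Rightarrow> real"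
        using assms(1-3) sum.remove[of ?I a G] sum.remove[of "?I - {a}" b G] by simp
      show ?thesis unfolding split using assms(3) by (auto intro!: sum.cong)
    qed
    ultimately show ?thesis unfolding H_def by simp
  qed
  then have "(\<Sum>r\<in>?I \<rightarrow>\<^sub>E {1..int m - 1}. H r * (\<Prod>i\<in>?I. (f(a := f b, b := f a)) i (r i))) = - walk_sum n m k x"
    unfolding V using assms by (intro antisymmetric_sum_swap) auto
  moreover have "f(a := f b, b := f a) = f" using assms by (auto simp: f_def)
  ultimately show ?thesis unfolding V by simp
qed


section \<open>First-step recursion for the number of walks\<close>

lemma walks_outside: "a \<notin> R \<Longrightarrow> walks n R a k = {}"
  unfolding walks_def by auto

lemma walks_0: "a \<in> R \<Longrightarrow> walks n R a 0 = {[a]}"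
  unfolding walks_def by (auto simp: length_Suc_conv)

lemma walks_Suc:
  assumes "a \<in> R"
  shows "walks n R a (Suc k) = (\<Union>s\<in>standard_steps n. Cons a ` walks n R (\<lambda>i. a i + s i) k)"
proof (rule set_eqI)
  fix p
  show "p \<in> walks n R a (Suc k) \<longleftrightarrow> p \<in> (\<Union>s\<in>standard_steps n. Cons a ` walks n R (\<lambda>i. a i + s i) k)"
  proof (cases p)
    case Nil
    then show ?thesis by (auto simp: walks_def)
  next
    case (Cons b q)
    have "p \<in> walks n R a (Suc k) \<longleftrightarrow> b = a \<and> length q = k + 1 \<and> q ! 0 - a \<in> standard_steps n \<and>
        (\<forall>i<k. q ! Suc i - q ! i \<in> standard_steps n) \<and> (\<forall>i\<le>k. q ! i \<in> R)"
      using assms unfolding walks_def Cons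
      by (auto simp: All_less_Suc2 simp flip: less_Suc_eq_le)
    also have "\<dots> \<longleftrightarrow> b = a \<and> (\<exists>s\<in>standard_steps n. q \<in> walks n R (\<lambda>i. a i + s i) k)"
    proof -
      have "q ! 0 = (\<lambda>i. a i + s i) \<longleftrightarrow> q ! 0 - a = s" for s
        by (auto simp: fun_eq_iff algebra_simps)
      then show ?thesis unfolding walks_def by auto
    qed
    also have "\<dots> \<longleftrightarrow> p \<in> (\<Union>s\<in>standard_steps n. Cons a ` walks n R (\<lambda>i. a i + s i) k)"
      unfolding Cons by auto
    finally show ?thesis .
  qed
qed

lemma finite_standard_steps: "finite (standard_steps n)"
  unfolding standard_steps_def by auto

lemma finite_walks: "finite (walks n R a k)"
proof (induction k arbitrary: a)
  case 0
  then show ?case by (cases "a \<in> R") (auto simp: walks_0 walks_outside)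
next
  case (Suc k)
  then show ?case by (cases "a \<in> R") (auto simp: walks_Suc walks_outside finite_standard_steps)
qed

lemma card_walks_Suc:
  assumes "a \<in> R"
  shows "card (walks n R a (Suc k)) = (\<Sum>s\<in>standard_steps n. card (walks n R (\<lambda>i. a i + s i) k))"
proof -
  have "card (walks n R a (Suc k)) = (\<Sum>s\<in>standard_steps n. card (Cons a ` walks n R (\<lambda>i. a i + s i) k))"
    unfolding walks_Suc[OF assms]
  proof (rule card_UN_disjoint)
    show "\<forall>s\<in>standard_steps n. \<forall>t\<in>standard_steps n. s \<noteq> t \<longrightarrow>
      Cons a ` walks n R (\<lambda>i. a i + s i) k \<inter> Cons a ` walks n R (\<lambda>i. a i + t i) k = {}"
    proof (intro ballI impI)
      fix s t :: "nat \<Rightarrow> real" assume "s \<noteq> t"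
      then have "(\<lambda>i. a i + s i) \<noteq> (\<lambda>i. a i + t i)" by (auto simp: fun_eq_iff)
      then show "Cons a ` walks n R (\<lambda>i. a i + s i) k \<inter> Cons a ` walks n R (\<lambda>i. a i + t i) k = {}"
        unfolding walks_def by auto
    qed
  qed (auto simp: finite_standard_steps finite_walks)
  then show ?thesis by (simp add: card_image)
qed

lemma sum_standard_steps:
  "(\<Sum>s\<in>standard_steps n. f s) = (\<Sum>j\<in>{1..n}. f (unit_vec j) + (f (- unit_vec j) :: nat))"
  unfolding standard_steps_def
proof (subst sum.UNION_disjoint)
  have neq: "unit_vec i \<noteq> - unit_vec j" for i j
  proof
    assume "unit_vec i = - unit_vec j"
    then have "unit_vec i i = - unit_vec j i" by simp
    then show False by (auto simp: unit_vec_def split: if_splits)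
  qed
  have inj: "unit_vec i = unit_vec j \<Longrightarrow> i = j" for i j
  proof -
    assume "unit_vec i = unit_vec j"
    then have "unit_vec i i = unit_vec j i" by simp
    then show "i = j" by (auto simp: unit_vec_def split: if_splits)
  qed
  have inj': "i = j" if "- unit_vec i = - unit_vec j" for i j
  proof (rule inj)
    show "unit_vec i = unit_vec j"
    proof
      fix l show "unit_vec i l = unit_vec j l" using fun_cong[OF that, of l] by simp
    qed
  qed
  show "\<forall>i\<in>{1..n}. \<forall>j\<in>{1..n}. i \<noteq> j \<longrightarrow> {unit_vec i, - unit_vec i} \<inter> {unit_vec j, - unit_vec j} = {}"
    using neq inj inj' neq[symmetric] by blast
  show "(\<Sum>j = 1..n. sum f {unit_vec j, - unit_vec j}) = (\<Sum>j = 1..n. f (unit_vec j) + f (- unit_vec j))"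
    using neq by simp
qed auto

lemma alcove_mono:
  assumes "x \<in> alcove_C n m" "1 \<le> i" "i < j" "j \<le> n"
  shows "x j < x i"
  using assms(3,4)
proof (induction j)
  case (Suc j)
  have "x (Suc j) < x j" if "i \<le> j" using assms(1,2) Suc.prems that by (auto simp: alcove_C_def)
  then show ?case using Suc by (cases "i = j") auto
qed simp

lemma alcove_range:
  assumes "x \<in> alcove_C n m" "i \<in> {1..n}"
  shows "0 < x i" "x i < real m"
proof -
  have "x n \<le> x i" using alcove_mono[OF assms(1), of i n] assms(2) by (cases "i = n") auto
  moreover have "x i \<le> x 1" using alcove_mono[OF assms(1), of 1 i] assms(2) by (cases "i = 1") auto
  ultimately show "0 < x i" "x i < real m" using assms(1) by (auto simp: alcove_C_def)
qed

lemma order_sign_alcove: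
  assumes "(\<lambda>i. real_of_int (x i)) \<in> alcove_C n m"
  shows "order_sign {1..n} x = 1"
proof -
  have "order_sign {1..n} x = pair_prod {1..n} (\<lambda>_ _. 1)"
    unfolding order_sign_def
  proof (rule pair_prod_cong[OF refl])
    fix i j assume "i \<in> {1..n}" "j \<in> {1..n}" "i < j"
    then show "sgn (real_of_int (x i) - real_of_int (x j)) = 1"
      using alcove_mono[OF assms, of i j] by simp
  qed
  then show ?thesis by (simp add: pair_prod_def)
qed

text \<open>A unit step that violates a strict inequality between integers turns it into an
  equality. The walk therefore lands on a wall, where the image sum vanishes, and cannot jump
  across.\<close>

lemma walk_sum_off_alcove:
  assumes x: "(\<lambda>i. real_of_int (x i)) \<in> alcove_C n m" and "n \<ge> 1" "m > 0" "j \<in> {1..n}" "\<bar>d\<bar> = 1"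
    and out: "(\<lambda>i. real_of_int ((x(j := x j + d)) i)) \<notin> alcove_C n m"
  shows "walk_sum n m k (x(j := x j + d)) = 0"
proof -
  let ?y = "x(j := x j + d)"
  have dec: "x (Suc i) < x i" if "i \<in> {1..<n}" for i using x that by (auto simp: alcove_C_def)
  have x1: "x 1 < int m"
  proof -
    have "real_of_int (x 1) < real_of_int (int m)" using x by (simp add: alcove_C_def)
    then show ?thesis by (simp only: of_int_less_iff)
  qed
  have xn: "0 < x n" using x by (auto simp: alcove_C_def)
  have "(\<lambda>i. real_of_int (?y i)) \<in> Rn n" using x assms(4) by (auto simp: alcove_C_def Rn_def)
  then consider "real m \<le> real_of_int (?y 1)" | i where "i \<in> {1..<n}" "?y i \<le> ?y (Suc i)" | "?y n \<le> 0"
    using out unfolding alcove_C_def by force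
  then show ?thesis
  proof cases
    case 1
    then have "int m \<le> ?y 1" by linarith
    then have "?y 1 = int m" using x1 assms(5) by (auto split: if_splits)
    then show ?thesis using assms by (intro walk_sum_wall[of m 1]) auto
  next
    case (2 i)
    then have "?y i = ?y (Suc i)" using dec[of i] assms(5) by (auto split: if_splits)
    then show ?thesis using 2(1) by (intro walk_sum_diagonal[of i n "Suc i"]) auto
  next
    case 3
    then have "?y n = 0" using xn assms(5) by (auto split: if_splits)
    then show ?thesis using assms by (intro walk_sum_wall[of m n]) auto
  qed
qed

text \<open>Both sides are 1 at time 0 and satisfy the same recursion. A neighbour outside the
  alcove contributes 0 to each: no walk starts there, and it lies on a wall.\<close>

lemma card_walks_eq_walk_sum:
  assumes "n \<ge> 1" "m > 0" "(\<lambda>i. real_of_int (x i)) \<in> alcove_C n m"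
  shows "real (card (walks n (alcove_C n m) (\<lambda>i. real_of_int (x i)) k)) = walk_sum n m k x"
  using assms(3)
proof (induction k arbitrary: x)
  case 0
  have "x i \<in> {1..int m - 1}" if "i \<in> {1..n}" for i
    using alcove_range[OF 0 that] by auto
  then have "walk_sum n m 0 x = 1" using walk_sum_0[OF assms(2), of n x] order_sign_alcove[OF 0] by simp
  then show ?case using 0 by (simp add: walks_0)
next
  case (Suc k)
  let ?R = "alcove_C n m"
  have nb: "real (card (walks n ?R (\<lambda>i. real_of_int ((x(j := x j + d)) i)) k)) = walk_sum n m k (x(j := x j + d))"
    if "j \<in> {1..n}" "\<bar>d\<bar> = 1" for j d
  proof (cases "(\<lambda>i. real_of_int ((x(j := x j + d)) i)) \<in> ?R")
    case True
    then show ?thesis by (rule Suc.IH)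
  next
    case False
    show ?thesis unfolding walks_outside[OF False] walk_sum_off_alcove[OF Suc.prems assms(1,2) that False] by simp
  qed
  \<comment> \<open>The downward step is written with \<open>+ -1\<close> so that \<open>nb\<close>
    covers both directions.\<close>
  have up: "(\<lambda>i. real_of_int (x i) + unit_vec j i) = (\<lambda>i. real_of_int ((x(j := x j + 1)) i))"
    and dn: "(\<lambda>i. real_of_int (x i) + (- unit_vec j) i) = (\<lambda>i. real_of_int ((x(j := x j + -1)) i))" for j
    by (auto simp: unit_vec_def fun_eq_iff)
  have "real (card (walks n ?R (\<lambda>i. real_of_int (x i)) (Suc k))) =
      (\<Sum>j\<in>{1..n}. real (card (walks n ?R (\<lambda>i. real_of_int ((x(j := x j + 1)) i)) k)) +
         real (card (walks n ?R (\<lambda>i. real_of_int ((x(j := x j + -1)) i)) k)))"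
    unfolding card_walks_Suc[OF Suc.prems] sum_standard_steps up dn by simp
  also have "\<dots> = (\<Sum>j\<in>{1..n}. walk_sum n m k (x(j := x j + 1)) + walk_sum n m k (x(j := x j + -1)))"
    by (intro sum.cong arg_cong2[of _ _ _ _ "(+)"] nb) auto
  also have "\<dots> = walk_sum n m (Suc k) x" unfolding walk_sum_Suc by simp
  finally show ?case .
qed

section \<open>Dominant eigenvalues\<close>

text \<open>The joint weight of all eigenfunctions whose frequencies are the elements of
  \<open>R\<close> in some order: the end-point sum times the alternant at the starting
  point.\<close>

definition spectral_coeff :: "nat \<Rightarrow> nat \<Rightarrow> (nat \<Rightarrow> int) \<Rightarrow> int set \<Rightarrow> real" where
  "spectral_coeff n m x R = (2 / real m) ^ n * order_sign R (\<lambda>a. a) * alternating_sum {1..int m - 1} (sine m) R *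
     alternating_sum R (\<lambda>i \<rho>. sine m \<rho> (x i)) {1..n}"

text \<open>Reordering the frequencies multiplies the end-point sum by an order sign, so the
  products of sines add up to an alternant. Maps into \<open>R\<close> that miss an element have
  order sign 0 and can be added for free.\<close>

lemma spectral_coeff:
  assumes "R \<subseteq> {1..int m - 1}" "card R = n"
  shows "(\<Sum>r\<in>{r \<in> {1..n} \<rightarrow>\<^sub>E {1..int m - 1}. r ` {1..n} = R}.
      (2 / real m) ^ n * alternating_sum {1..int m - 1} (\<lambda>i. sine m (r i)) {1..n} * (\<Prod>i\<in>{1..n}. sine m (r i) (x i))) =
    spectral_coeff n m x R"
proof -
  let ?I = "{1..n}" and ?X = "{1..int m - 1}"
  let ?P = "{r \<in> ?I \<rightarrow>\<^sub>E ?X. r ` ?I = R}"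
  define C where "C = (2 / real m) ^ n * order_sign R (\<lambda>a. a) * alternating_sum ?X (sine m) R"
  have fin: "finite R" using assms(1) finite_subset by blast
  have "(\<Sum>r\<in>?P. (2 / real m) ^ n * alternating_sum ?X (\<lambda>i. sine m (r i)) ?I * (\<Prod>i\<in>?I. sine m (r i) (x i))) =
    (\<Sum>r\<in>?P. C * (order_sign ?I r * (\<Prod>i\<in>?I. sine m (r i) (x i))))"
  proof (rule sum.cong[OF refl])
    fix r assume r: "r \<in> ?P"
    then have "inj_on r ?I" using assms(2) by (intro eq_card_imp_inj_on) auto
    then have "alternating_sum ?X (\<lambda>i. sine m (r i)) ?I = order_sign ?I r * order_sign R (\<lambda>a. a) * alternating_sum ?X (sine m) R"
      using r by (subst alternating_sum_comp) auto
    then show "(2 / real m) ^ n * alternating_sum ?X (\<lambda>i. sine m (r i)) ?I * (\<Prod>i\<in>?I. sine m (r i) (x i)) =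
        C * (order_sign ?I r * (\<Prod>i\<in>?I. sine m (r i) (x i)))"
      unfolding C_def by simp
  qed
  also have "\<dots> = (\<Sum>r\<in>?I \<rightarrow>\<^sub>E R. C * (order_sign ?I r * (\<Prod>i\<in>?I. sine m (r i) (x i))))"
  proof (rule sum.mono_neutral_left)
    show "finite (?I \<rightarrow>\<^sub>E R)" using fin by (intro finite_PiE) auto
    show "?P \<subseteq> ?I \<rightarrow>\<^sub>E R"
    proof
      fix r assume r: "r \<in> ?P"
      show "r \<in> ?I \<rightarrow>\<^sub>E R" by (rule PiE_I) (use r in \<open>auto dest: PiE_arb\<close>)
    qed
    show "\<forall>r\<in>(?I \<rightarrow>\<^sub>E R) - ?P. C * (order_sign ?I r * (\<Prod>i\<in>?I. sine m (r i) (x i))) = 0"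
    proof
      fix r assume r: "r \<in> (?I \<rightarrow>\<^sub>E R) - ?P"
      have sub: "r ` ?I \<subseteq> R" using r by auto
      have "r \<in> ?I \<rightarrow>\<^sub>E ?X" using r assms(1) by (auto simp: PiE_iff)
      then have "r ` ?I \<noteq> R" using r by blast
      then have "card (r ` ?I) < n" using sub fin assms(2) psubset_card_mono[of R "r ` ?I"] by blast
      then have "\<not> inj_on r ?I" using card_image[of r ?I] by auto
      then show "C * (order_sign ?I r * (\<Prod>i\<in>?I. sine m (r i) (x i))) = 0" by (simp add: order_sign_not_inj)
    qed
  qed
  also have "\<dots> = C * alternating_sum R (\<lambda>i \<rho>. sine m \<rho> (x i)) ?I"
    unfolding alternating_sum_def by (simp only: sum_distrib_left)
  finally show ?thesis unfolding C_def spectral_coeff_def .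
qed

lemma cosine_reflect: "m > 0 \<Longrightarrow> cosine m (int m - r) = - cosine m r"
  by (simp add: cosine_def right_diff_distrib)

text \<open>Exchange argument: frequencies in \<open>R\<close> beyond n have cosines strictly below
  that of n, and they displace equally many frequencies whose cosines are at least that of
  n.\<close>

lemma cosine_sum_less:
  assumes "R \<subseteq> {1..int m - 1}" "card R = n" "R \<noteq> {1..int n}"
  shows "(\<Sum>r\<in>R. cosine m r) < (\<Sum>r\<in>{1..int n}. cosine m r)"
proof -
  let ?S = "{1..int n}"
  have fin: "finite R" using assms(1) finite_subset by blast
  have "card (R - ?S) = card (?S - R)"
    using card_Diff_subset_Int[of R ?S] card_Diff_subset_Int[of ?S R] fin assms(2) by (simp add: Int_commute)
  moreover have "R - ?S \<noteq> {}"
  proof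
    assume "R - ?S = {}"
    then have "R = ?S" using assms(2) by (intro card_subset_eq) auto
    then show False using assms(3) by simp
  qed
  ultimately have card: "card (R - ?S) = card (?S - R)" "finite (R - ?S)" "R - ?S \<noteq> {}" using fin by auto
  have nm: "n < m"
  proof -
    have "card R \<le> card {1..int m - 1}" using assms(1) by (intro card_mono) auto
    moreover have "R \<noteq> {}" using card by auto
    then have "m > 0" using assms(1) by (cases m) auto
    ultimately show ?thesis using assms(2) by auto
  qed
  have "(\<Sum>r\<in>R - ?S. cosine m r) < (\<Sum>r\<in>R - ?S. cosine m (int n))"
  proof (rule sum_strict_mono)
    fix r assume "r \<in> R - ?S"
    then show "cosine m r < cosine m (int n)" using assms(1) by (intro cosine_strict_antimono) (auto simp: subset_iff)
  qed (use card in auto)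
  also have "\<dots> = (\<Sum>r\<in>?S - R. cosine m (int n))" using card by simp
  also have "\<dots> \<le> (\<Sum>r\<in>?S - R. cosine m r)"
  proof (rule sum_mono)
    fix r assume "r \<in> ?S - R"
    then show "cosine m (int n) \<le> cosine m r"
      using cosine_strict_antimono[of r "int n" m] nm by (cases "r = int n") auto
  qed
  finally have "(\<Sum>r\<in>R - ?S. cosine m r) < (\<Sum>r\<in>?S - R. cosine m r)" .
  moreover have "(\<Sum>r\<in>R. cosine m r) = (\<Sum>r\<in>R \<inter> ?S. cosine m r) + (\<Sum>r\<in>R - ?S. cosine m r)"
    using fin by (metis sum.Int_Diff)
  moreover have "(\<Sum>r\<in>?S. cosine m r) = (\<Sum>r\<in>?S \<inter> R. cosine m r) + (\<Sum>r\<in>?S - R. cosine m r)"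
    by (metis sum.Int_Diff finite_atLeastAtMost_int)
  ultimately show ?thesis by (simp add: Int_commute)
qed

lemma top_image: "(\<lambda>r. int m - r) ` {1..int n} = {int m - int n..int m - 1}"
proof -
  have "r \<in> (\<lambda>r. int m - r) ` {1..int n}" if "r \<in> {int m - int n..int m - 1}" for r
    using that by (intro image_eqI[of _ _ "int m - r"]) auto
  then show ?thesis by auto
qed

text \<open>The mirror r -> m - r negates cosines, so this is \<open>cosine_sum_less\<close> for the
  mirrored set.\<close>

lemma cosine_sum_greater:
  assumes "R \<subseteq> {1..int m - 1}" "card R = n" "R \<noteq> {int m - int n..int m - 1}" "m > 0"
  shows "- (\<Sum>r\<in>{1..int n}. cosine m r) < (\<Sum>r\<in>R. cosine m r)"
proof -
  let ?f = "\<lambda>r. int m - r"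
  have inj: "inj_on ?f R" by (auto simp: inj_on_def)
  have "?f ` R \<noteq> {1..int n}"
  proof
    assume "?f ` R = {1..int n}"
    then have "?f ` ?f ` R = {int m - int n..int m - 1}" by (simp only: top_image)
    then show False using assms(3) by (simp add: image_image)
  qed
  then have "(\<Sum>r\<in>?f ` R. cosine m r) < (\<Sum>r\<in>{1..int n}. cosine m r)"
    using assms inj by (intro cosine_sum_less) (auto simp: card_image subset_iff)
  then show ?thesis using inj assms(4) by (simp add: sum.reindex cosine_reflect sum_negf)
qed

text \<open>By \<open>n + 1 < m\<close> the two extremal sets are distinct. Every other frequency
  set has an eigenvalue of modulus below \<mu>, and its contribution decays after division by the
  power of \<mu>.\<close>

lemma walk_sum_asymptotics:
  assumes "n \<ge> 1" "n + 1 < m"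
  defines "\<mu> \<equiv> 2 * (\<Sum>r\<in>{1..int n}. cosine m r)"
  shows "\<mu> > 0" "(\<lambda>k. walk_sum n m k x / \<mu> ^ k - (spectral_coeff n m x {1..int n} +
      (-1) ^ k * spectral_coeff n m x {int m - int n..int m - 1})) \<longlonglongrightarrow> 0"
proof -
  let ?I = "{1..n}" and ?X = "{1..int m - 1}" and ?R1 = "{1..int n}" and ?R2 = "{int m - int n..int m - 1}"
  have m: "m > 0" using assms by simp
  have "1 \<in> ?R1" "1 \<notin> ?R2" using assms(1,2) by auto
  then have neq: "?R1 \<noteq> ?R2" by blast
  have sub: "?R1 \<subseteq> ?X" "?R2 \<subseteq> ?X" and card: "card ?R1 = n" "card ?R2 = n" using assms(1,2) by auto
  \<comment> \<open>The set {1..n} is not the minimiser, so its cosine sum exceeds its own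
    negative.\<close>
  show pos: "\<mu> > 0"
    using cosine_sum_greater[OF sub(1) card(1) neq m] unfolding \<mu>_def by simp
  define P where "P = ?I \<rightarrow>\<^sub>E ?X"
  define C where "C = (\<lambda>r. (2 / real m) ^ n * alternating_sum ?X (\<lambda>i. sine m (r i)) ?I * (\<Prod>i\<in>?I. sine m (r i) (x i)))"
  define e where "e = (\<lambda>r. \<Sum>i\<in>?I. 2 * cosine m (r i))"
  have fin: "finite P" unfolding P_def by (intro finite_PiE) auto
  have C0: "C r = 0" if "\<not> inj_on r ?I" for r
  proof -
    obtain a b where ab: "a \<in> ?I" "b \<in> ?I" "a \<noteq> b" "r a = r b" using \<open>\<not> inj_on r ?I\<close> by (auto simp: inj_on_def)
    then have "alternating_sum ?X (\<lambda>i. sine m (r i)) ?I = 0" by (intro alternating_sum_equal_rows[of _ a b]) auto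
    then show ?thesis unfolding C_def by simp
  qed
  have e_inj: "e r = 2 * (\<Sum>\<rho>\<in>r ` ?I. cosine m \<rho>)" if "inj_on r ?I" for r
    unfolding e_def using that by (simp add: sum.reindex sum_distrib_left)
  define P1 where "P1 = {r \<in> P. r ` ?I = ?R1}"
  define P2 where "P2 = {r \<in> P. r ` ?I = ?R2}"
  define P3 where "P3 = P - P1 - P2"
  have e1: "e r = \<mu>" if "r \<in> P1" for r
  proof -
    have "inj_on r ?I" using that card by (intro eq_card_imp_inj_on) (auto simp: P1_def)
    then show ?thesis using that e_inj unfolding P1_def \<mu>_def by simp
  qed
  have e2: "e r = - \<mu>" if "r \<in> P2" for r
  proof -
    have "inj_on r ?I" using that card by (intro eq_card_imp_inj_on) (auto simp: P2_def)
    then have "e r = 2 * (\<Sum>\<rho>\<in>(\<lambda>r. int m - r) ` ?R1. cosine m \<rho>)" using that e_inj unfolding P2_def top_image by simp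
    also have "(\<Sum>\<rho>\<in>(\<lambda>r. int m - r) ` ?R1. cosine m \<rho>) = (\<Sum>\<rho>\<in>?R1. cosine m (int m - \<rho>))"
      by (rule sum.reindex_cong[of "\<lambda>r. int m - r"]) (auto simp: inj_on_def)
    finally show ?thesis using m by (simp add: cosine_reflect sum_negf \<mu>_def)
  qed
  \<comment> \<open>For repeated frequencies the bounds on sets say nothing: with n > 1, taking all
    frequencies equal to 1 gives an eigenvalue above \<mu>. Such terms have coefficient 0.\<close>
  have e3: "C r = 0 \<or> \<bar>e r\<bar> < \<mu>" if "r \<in> P3" for r
  proof (cases "inj_on r ?I")
    case True
    have "r ` ?I \<subseteq> ?X" "card (r ` ?I) = n" "r ` ?I \<noteq> ?R1" "r ` ?I \<noteq> ?R2"
      using that True by (auto simp: P3_def P1_def P2_def P_def card_image)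
    then have "\<bar>e r\<bar> < \<mu>"
      using cosine_sum_less[of "r ` ?I" m n] cosine_sum_greater[of "r ` ?I" m n] m
      unfolding e_inj[OF True] \<mu>_def by linarith
    then show ?thesis ..
  qed (use C0 in auto)
  have V: "walk_sum n m k x / \<mu> ^ k - (spectral_coeff n m x ?R1 + (-1) ^ k * spectral_coeff n m x ?R2) =
     (\<Sum>r\<in>P3. C r * (e r / \<mu>) ^ k)" for k
  proof -
    have "walk_sum n m k x = (\<Sum>r\<in>P. C r * e r ^ k)"
      unfolding walk_sum_def P_def C_def e_def by (intro sum.cong refl) (simp add: mult_ac)
    then have "walk_sum n m k x / \<mu> ^ k = (\<Sum>r\<in>P. C r * (e r / \<mu>) ^ k)"
      by (simp add: sum_divide_distrib power_divide)
    also have "P = (P1 \<union> P2) \<union> P3" by (auto simp: P1_def P2_def P3_def)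
    also have "(\<Sum>r\<in>(P1 \<union> P2) \<union> P3. C r * (e r / \<mu>) ^ k) =
       (\<Sum>r\<in>P1. C r * (e r / \<mu>) ^ k) + (\<Sum>r\<in>P2. C r * (e r / \<mu>) ^ k) + (\<Sum>r\<in>P3. C r * (e r / \<mu>) ^ k)"
    proof -
      have f: "finite P1" "finite P2" "finite P3" using fin by (auto simp: P1_def P2_def P3_def)
      have d: "P1 \<inter> P2 = {}" "(P1 \<union> P2) \<inter> P3 = {}" using neq by (auto simp: P1_def P2_def P3_def)
      show ?thesis using f d by (simp add: sum.union_disjoint)
    qed
    also have "(\<Sum>r\<in>P1. C r * (e r / \<mu>) ^ k) = (\<Sum>r\<in>P1. C r)"
      using e1 pos by (intro sum.cong) auto
    also have "(\<Sum>r\<in>P2. C r * (e r / \<mu>) ^ k) = (\<Sum>r\<in>P2. (-1) ^ k * C r)"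
      using e2 pos by (intro sum.cong) auto
    also have "\<dots> = (-1) ^ k * (\<Sum>r\<in>P2. C r)" by (simp only: sum_distrib_left)
    also have "(\<Sum>r\<in>P1. C r) = spectral_coeff n m x ?R1"
      using spectral_coeff[OF sub(1) card(1)] unfolding P1_def P_def C_def .
    also have "(\<Sum>r\<in>P2. C r) = spectral_coeff n m x ?R2"
      using spectral_coeff[OF sub(2) card(2)] unfolding P2_def P_def C_def .
    finally show ?thesis by simp
  qed
  have "(\<lambda>k. \<Sum>r\<in>P3. C r * (e r / \<mu>) ^ k) \<longlonglongrightarrow> (\<Sum>r\<in>P3. 0)"
  proof (rule tendsto_sum)
    fix r assume r: "r \<in> P3"
    show "(\<lambda>k. C r * (e r / \<mu>) ^ k) \<longlonglongrightarrow> 0"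
    proof (cases "C r = 0")
      case False
      then have "norm (e r / \<mu>) < 1" using e3[OF r] pos by simp
      then show ?thesis by (intro tendsto_mult_right_zero LIMSEQ_power_zero)
    qed simp
  qed
  then show "(\<lambda>k. walk_sum n m k x / \<mu> ^ k - (spectral_coeff n m x ?R1 + (-1) ^ k * spectral_coeff n m x ?R2)) \<longlonglongrightarrow> 0"
    unfolding V by simp
qed

text \<open>The only frequency set is {1..m-1}, whose cosines cancel in mirror pairs. This is the
  alcove with one lattice point, which no walk of positive length can stay in.\<close>

lemma walk_sum_single_point:
  assumes "m > 0" "n + 1 = m" "k \<ge> 1"
  shows "walk_sum n m k x = 0"
proof -
  let ?I = "{1..n}" and ?X = "{1..int m - 1}"
  have bal: "(\<Sum>\<rho>\<in>?X. cosine m \<rho>) = 0"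
  proof -
    have "(\<Sum>\<rho>\<in>?X. cosine m \<rho>) = (\<Sum>\<rho>\<in>?X. cosine m (int m - \<rho>))"
      by (rule sum.reindex_bij_witness[of _ "\<lambda>r. int m - r" "\<lambda>r. int m - r"]) auto
    then show ?thesis using assms(1) by (simp add: cosine_reflect sum_negf)
  qed
  have "alternating_sum ?X (\<lambda>i. sine m (r i)) ?I * (\<Sum>i\<in>?I. 2 * cosine m (r i)) ^ k = 0" if r: "r \<in> ?I \<rightarrow>\<^sub>E ?X" for r
  proof (cases "inj_on r ?I")
    case True
    have "r ` ?I = ?X" using r True assms by (intro card_subset_eq) (auto simp: card_image)
    then have "(\<Sum>i\<in>?I. cosine m (r i)) = 0" using bal sum.reindex[OF True, of "cosine m"] by simp
    then have "(\<Sum>i\<in>?I. 2 * cosine m (r i)) = 0" by (simp only: mult_zero_right flip: sum_distrib_left)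
    then show ?thesis using assms(3) by simp
  next
    case False
    then obtain a b where "a \<in> ?I" "b \<in> ?I" "a \<noteq> b" "r a = r b" by (auto simp: inj_on_def)
    then have "alternating_sum ?X (\<lambda>i. sine m (r i)) ?I = 0" by (intro alternating_sum_equal_rows[of _ a b]) auto
    then show ?thesis by simp
  qed
  then have "A * alternating_sum ?X (\<lambda>i. sine m (r i)) ?I * (\<Sum>i\<in>?I. 2 * cosine m (r i)) ^ k * B = 0"
    if "r \<in> ?I \<rightarrow>\<^sub>E ?X" for r A B
    using that by (simp only: mult.assoc[of A] mult_zero_right mult_zero_left)
  then show ?thesis unfolding walk_sum_def by (intro sum.neutral ballI)
qed

section \<open>The mirror symmetry at the starting point\<close>

lemma pair_prod_const: "finite I \<Longrightarrow> pair_prod I (\<lambda>_ _. c) = c ^ (card I * (card I - 1) div 2)"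
proof (induction I rule: finite_linorder_max_induct)
  case (insert b A)
  have b: "b \<notin> A" using insert by auto
  have "pair_prod (insert b A) (\<lambda>_ _. c) = c ^ card A * c ^ (card A * (card A - 1) div 2)"
    using insert b by (subst pair_prod_remove_sym[of _ b]) auto
  also have "\<dots> = c ^ (card A * (card A - 1) div 2 + card A)" by (simp add: power_add)
  also have "card A * (card A - 1) div 2 + card A = Suc (card A) * card A div 2"
  proof -
    have "Suc (card A) * card A = card A * (card A - 1) + card A * 2" by (cases "card A") (auto simp: algebra_simps)
    then show ?thesis by simp
  qed
  finally show ?case using insert(1) b by simp
qed simp

lemma sine_reflect:
  assumes "m > 0"
  shows "sine m (int m - r) x = (if even x then -1 else 1) * sine m r x"
proof -
  have "sine m (int m - r) x = sin (real_of_int x * pi - pi / real m * (real_of_int r * real_of_int x))"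
    using assms by (simp add: sine_def field_simps)
  moreover have "sin (real_of_int x * pi) = 0" by (simp add: sin_zero_iff_int2)
  ultimately show ?thesis by (simp add: sin_diff cos_int_pi sine_def)
qed

text \<open>The mirror reverses all comparisons between frequencies, which gives (-1)^(n(n-1)/2),
  and multiplies each sine by a sign depending only on the parity of the coordinate. Here lies the
  origin of |\<eta>| in the exponent of the theorem.\<close>

lemma alternating_sum_top_reflect:
  assumes "m > 0"
  shows "alternating_sum {int m - int n..int m - 1} (\<lambda>i \<rho>. sine m \<rho> (x i)) {1..n} =
    (-1) ^ (n * (n - 1) div 2) * (\<Prod>i\<in>{1..n}. if even (x i) then -1 else 1) *
     alternating_sum {1..int n} (\<lambda>i \<rho>. sine m \<rho> (x i)) {1..n}"
proof -
  let ?I = "{1..n}" and ?R1 = "{1..int n}" and ?R2 = "{int m - int n..int m - 1}"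
  let ?f = "\<lambda>r. restrict (\<lambda>i. int m - r i) ?I"
  define s where "s = (-1) ^ (n * (n - 1) div 2) * (\<Prod>i\<in>?I. if even (x i) then -1 else 1 :: real)"
  have sgf: "order_sign ?I (?f r) = (-1) ^ (n * (n - 1) div 2) * order_sign ?I r" for r
  proof -
    have "order_sign ?I (?f r) = order_sign ?I (\<lambda>i. int m - r i)" by (rule order_sign_cong) auto
    also have "\<dots> = pair_prod ?I (\<lambda>i j. (-1) * sgn (real_of_int (r i) - real_of_int (r j)))"
      unfolding order_sign_def by (intro pair_prod_cong) (auto simp: sgn_if)
    also have "\<dots> = pair_prod ?I (\<lambda>_ _. -1) * order_sign ?I r" unfolding order_sign_def by (rule pair_prod_mult)
    finally show ?thesis by (simp add: pair_prod_const)
  qed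
  have "alternating_sum ?R2 (\<lambda>i \<rho>. sine m \<rho> (x i)) ?I = (\<Sum>r\<in>?I \<rightarrow>\<^sub>E ?R1. s * (order_sign ?I r * (\<Prod>i\<in>?I. sine m (r i) (x i))))"
    unfolding alternating_sum_def
  proof (rule sum.reindex_bij_witness[of _ ?f ?f])
    fix r assume r: "r \<in> ?I \<rightarrow>\<^sub>E ?R2"
    show "?f (?f r) = r" using r by (auto simp: PiE_iff extensional_def fun_eq_iff)
    show "?f r \<in> ?I \<rightarrow>\<^sub>E ?R1" unfolding restrict_PiE_iff using PiE_mem[OF r] by fastforce
    have "(\<Prod>i\<in>?I. sine m (r i) (x i)) = (\<Prod>i\<in>?I. (if even (x i) then -1 else 1) * sine m (?f r i) (x i))"
      using sine_reflect[OF assms, of "int m - r _"] by (intro prod.cong) auto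
    moreover have "order_sign ?I r = (-1) ^ (n * (n - 1) div 2) * order_sign ?I (?f r)"
      unfolding sgf by (simp flip: power_add mult.assoc)
    ultimately show "s * (order_sign ?I (?f r) * (\<Prod>i\<in>?I. sine m (?f r i) (x i))) = order_sign ?I r * (\<Prod>i\<in>?I. sine m (r i) (x i))"
      unfolding s_def by (simp only: prod.distrib mult_ac)
  next
    fix r assume r: "r \<in> ?I \<rightarrow>\<^sub>E ?R1"
    show "?f (?f r) = r" using r by (auto simp: PiE_iff extensional_def fun_eq_iff)
    show "?f r \<in> ?I \<rightarrow>\<^sub>E ?R2" unfolding restrict_PiE_iff using PiE_mem[OF r] by fastforce
  qed
  then show ?thesis unfolding alternating_sum_def s_def by (simp only: sum_distrib_left)
qed

section \<open>Products of sines\<close>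

definition half_sine :: "nat \<Rightarrow> int \<Rightarrow> real" where
  "half_sine m d = sin (pi * real_of_int d / (2 * real m))"

definition half_cosine :: "nat \<Rightarrow> int \<Rightarrow> real" where
  "half_cosine m d = cos (pi * real_of_int d / (2 * real m))"

text \<open>The common currency: \<Delta>, \<open>Q\<close> and the closed form for {1..n} all
  reduce to squares of these products with \<open>N\<close> from 1 to n.\<close>

definition odd_half_sine_prod :: "nat \<Rightarrow> nat \<Rightarrow> real" where
  "odd_half_sine_prod m N = (\<Prod>j=1..N. half_sine m (2 * int j - 1))"

lemma half_sine_pos:
  assumes "0 < d" "d < 2 * int m"
  shows "half_sine m d > 0"
proof -
  have "m > 0" using assms by simp
  moreover have "real_of_int d < 2 * real m" using assms(2) by linarith
  ultimately show ?thesis unfolding half_sine_def using assms by (intro sin_gt_zero) (auto simp: field_simps)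
qed

lemma half_sine_less:
  assumes "0 \<le> d" "d < e" "e \<le> int m"
  shows "half_sine m d < half_sine m e"
proof -
  have "m > 0" using assms by simp
  moreover have "real_of_int d < real_of_int e" "real_of_int e \<le> real m" using assms(2,3) by linarith+
  ultimately have *: "m > 0" "real_of_int d < real_of_int e" "real_of_int e \<le> real m" by auto
  have "0 \<le> pi * real_of_int d / (2 * real m)" using assms(1) by simp
  then have "- (pi / 2) \<le> pi * real_of_int d / (2 * real m)"
    using pi_gt_zero by linarith
  moreover have "pi * real_of_int d / (2 * real m) < pi * real_of_int e / (2 * real m)"
    using * by (simp add: field_simps)
  moreover have "pi * real_of_int e / (2 * real m) \<le> pi / 2"
    using * by (simp add: field_simps)
  ultimately show ?thesis unfolding half_sine_def by (rule sin_monotone_2pi)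
qed

lemma half_sine_minus: "half_sine m (- d) = - half_sine m d"
  by (simp add: half_sine_def)

lemma half_cosine_minus: "half_cosine m (- d) = half_cosine m d"
  by (simp add: half_cosine_def)

lemma half_cosine_0 [simp]: "half_cosine m 0 = 1"
  by (simp add: half_cosine_def)

lemma half_sine_double: "half_sine m (2 * d) = 2 * half_sine m d * half_cosine m d"
  by (simp add: half_sine_def half_cosine_def flip: sin_double)

lemma half_sine_plus_m: "m > 0 \<Longrightarrow> half_sine m (d + int m) = half_cosine m d"
  by (simp add: half_sine_def half_cosine_def add_divide_distrib distrib_left sin_add)

lemma half_sine_m_minus: "m > 0 \<Longrightarrow> half_sine m (int m - d) = half_cosine m d"
  using half_sine_plus_m[of m "-d"] by (simp add: half_cosine_minus)

lemma sine_1: "sine m r 1 = half_sine m (2 * r)"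
  by (simp add: sine_def half_sine_def)

lemma cosine_diff: "cosine m i - cosine m j = 2 * half_sine m (j + i) * half_sine m (j - i)"
  unfolding cosine_def cos_diff_cos
  by (simp add: half_sine_def add_divide_distrib diff_divide_distrib distrib_left right_diff_distrib mult_ac add_ac)

lemma one_minus_cosine: "1 - cosine m r = 2 * (half_sine m r)\<^sup>2"
  using cosine_diff[of m 0 r] by (simp add: cosine_def power2_eq_square)

lemma one_plus_cosine: "1 + cosine m r = 2 * (half_cosine m r)\<^sup>2"
proof -
  have "cosine m r = cos (2 * (pi * real_of_int r / (2 * real m)))" by (simp add: cosine_def)
  then show ?thesis unfolding cos_double_cos half_cosine_def by simp
qed

lemma odd_half_sine_prod_Suc: "odd_half_sine_prod m (Suc n) = odd_half_sine_prod m n * half_sine m (2 * int n + 1)"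
  by (simp add: odd_half_sine_prod_def add.commute)

lemma odd_half_sine_prod_rev: "odd_half_sine_prod m n = (\<Prod>j=1..n. half_sine m (2 * (int n - int j) + 1))"
proof -
  have "odd_half_sine_prod m n = (\<Prod>j=1..n. half_sine m (2 * int (n + 1 - j) - 1))"
    unfolding odd_half_sine_prod_def by (subst prod.atLeastAtMost_rev) simp
  also have "\<dots> = (\<Prod>j=1..n. half_sine m (2 * (int n - int j) + 1))"
    by (intro prod.cong refl arg_cong[of _ _ "half_sine m"]) auto
  finally show ?thesis .
qed

lemma prod_square_Suc:
  "(\<Prod>h=a..Suc n. \<Prod>t=1..Suc n. f t h) =
    (\<Prod>h=a..n. \<Prod>t=1..n. f t h) * ((\<Prod>h=a..Suc n. f (Suc n) h) * (\<Prod>t=1..n. (f t (Suc n) :: real)))"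
  if "a \<le> Suc n"
  using that by (simp add: prod.distrib)

text \<open>From n to n + 1 the row t = n + 1 adds the absolute arguments 1, 3, ..., 2n + 1 and a
  further 1; the column h = n + 2 adds 3, 5, ..., 2n + 1. Moving the further 1 to the column makes
  both into the same odd product.\<close>

lemma Delta_factor_eq:
  assumes "n \<le> m"
  shows "Delta_factor n m = (\<Prod>i=1..n. (odd_half_sine_prod m i)\<^sup>2)"
  using assms
proof (induction n)
  case 0
  then show ?case by (simp add: Delta_factor_def)
next
  case (Suc n)
  define g where "g = (\<lambda>t h. \<bar>half_sine m (2 * int t - 2 * int h + 1)\<bar>)"
  have D: "Delta_factor n m = (\<Prod>h=1..n+1. \<Prod>t=1..n. g t h)" for n
    unfolding Delta_factor_def g_def half_sine_def by (intro prod.cong refl arg_cong[of _ _ abs] arg_cong[of _ _ sin]) simp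
  have abs: "\<bar>half_sine m d\<bar> = half_sine m d" if "0 < d" "d < 2 * int m" for d using half_sine_pos[OF that] by simp
  have "Delta_factor (Suc n) m = Delta_factor n m * ((\<Prod>h=1..Suc (Suc n). g (Suc n) h) * (\<Prod>t=1..n. g t (Suc (Suc n))))"
    unfolding D by (simp add: prod.distrib mult_ac)
  also have "(\<Prod>h=1..Suc (Suc n). g (Suc n) h) = odd_half_sine_prod m (Suc n) * half_sine m 1"
  proof -
    have "(\<Prod>h=1..Suc n. g (Suc n) h) = odd_half_sine_prod m (Suc n)"
      unfolding odd_half_sine_prod_rev g_def using Suc.prems by (intro prod.cong refl, subst abs) (auto simp: algebra_simps)
    moreover have "g (Suc n) (Suc (Suc n)) = half_sine m 1"
      using Suc.prems half_sine_minus[of m 1] abs[of 1] by (simp add: g_def)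
    ultimately show ?thesis by simp
  qed
  also have "(\<Prod>t=1..n. g t (Suc (Suc n))) = (\<Prod>t=1..n. half_sine m (2 * (int (Suc n) - int t) + 1))"
  proof (rule prod.cong[OF refl])
    fix t assume t: "t \<in> {1..n}"
    have "g t (Suc (Suc n)) = \<bar>half_sine m (- (2 * (int (Suc n) - int t) + 1))\<bar>"
      unfolding g_def by (simp add: algebra_simps)
    then show "g t (Suc (Suc n)) = half_sine m (2 * (int (Suc n) - int t) + 1)"
      unfolding half_sine_minus abs_minus_cancel using t Suc.prems by (subst (asm) abs) auto
  qed
  also have "odd_half_sine_prod m (Suc n) * half_sine m 1 * (\<Prod>t=1..n. half_sine m (2 * (int (Suc n) - int t) + 1)) = (odd_half_sine_prod m (Suc n))\<^sup>2"
    unfolding power2_eq_square by (subst (3) odd_half_sine_prod_rev) (simp add: mult_ac)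
  finally show ?case using Suc by simp
qed

text \<open>In the product of the half sines at 1, ..., 2n + 1, the even arguments double by sin 2a
  = 2 sin a cos a, and the half sines at 1, ..., n cancel. The induction carries this out one index
  at a time.\<close>

lemma prod_half_cosine_odd:
  assumes "n < m"
  shows "(\<Prod>j=1..n. 2 * half_cosine m (int j)) * odd_half_sine_prod m (Suc n) = (\<Prod>d=Suc n..2*n+1. half_sine m (int d))"
  using assms
proof (induction n)
  case 0
  then show ?case by (simp add: odd_half_sine_prod_def)
next
  case (Suc n)
  define E where "E = (\<Prod>d=Suc (Suc n)..2*n+1. half_sine m (int d))"
  have "(\<Prod>j=1..Suc n. 2 * half_cosine m (int j)) * odd_half_sine_prod m (Suc (Suc n)) =
     ((\<Prod>j=1..n. 2 * half_cosine m (int j)) * odd_half_sine_prod m (Suc n)) * (2 * half_cosine m (int (Suc n)) * half_sine m (2 * int (Suc n) + 1))"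
    unfolding odd_half_sine_prod_Suc[of m "Suc n"] by (simp add: mult_ac)
  also have "\<dots> = (\<Prod>d=Suc n..2*n+1. half_sine m (int d)) * (2 * half_cosine m (int (Suc n)) * half_sine m (2 * int (Suc n) + 1))"
    using Suc by simp
  also have "(\<Prod>d=Suc n..2*n+1. half_sine m (int d)) = half_sine m (int (Suc n)) * E"
    unfolding E_def by (subst prod.atLeast_Suc_atMost) auto
  also have "half_sine m (int (Suc n)) * E * (2 * half_cosine m (int (Suc n)) * half_sine m (2 * int (Suc n) + 1)) =
      E * half_sine m (2 * int (Suc n)) * half_sine m (2 * int (Suc n) + 1)"
    unfolding half_sine_double[of m "int (Suc n)"] by (simp add: mult_ac)
  also have "\<dots> = (\<Prod>d=Suc (Suc n)..2*Suc n+1. half_sine m (int d))"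
    unfolding E_def by (simp add: mult_ac add_ac)
  finally show ?case .
qed

text \<open>A shift by m makes the numerators of \<open>Q\<close> cosines, and reversing h makes the
  denominators half sines at t + h. From n to n + 1, \<open>prod_half_cosine_odd\<close> is used
  twice, which produces the square of the odd product. Together with \<open>Delta_factor_eq\<close>
  this gives \<open>Q\<close> = 2^(-n^2) / \<Delta>.\<close>

lemma Q_factor_eq:
  assumes "n < m"
  shows "Q_factor n m * (2 ^ n\<^sup>2 * (\<Prod>i=1..n. (odd_half_sine_prod m i)\<^sup>2)) = 1"
proof -
  define num where "num = (\<lambda>n. \<Prod>h=0..n. \<Prod>t=1..n. half_cosine m (int t - int h - 1))"
  define den where "den = (\<lambda>n. \<Prod>h=0..n. \<Prod>t=1..n. half_sine m (int t + int h))"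
  have m: "m > 0" using assms by simp
  have "Q_factor n m = (\<Prod>h=0..n. \<Prod>t=1..n. half_cosine m (int t - int h - 1)) / (\<Prod>h=0..n. \<Prod>t=1..n. half_sine m (int t - int h + int n))"
    unfolding Q_factor_def prod_dividef[symmetric] half_sine_plus_m[OF m, symmetric]
    by (intro prod.cong refl arg_cong2[of _ _ _ _ "(/)"]) (auto simp: half_sine_def algebra_simps)
  also have "(\<Prod>h=0..n. \<Prod>t=1..n. half_sine m (int t - int h + int n)) = den n"
  proof -
    have "(\<Prod>h=0..n. \<Prod>t=1..n. half_sine m (int t - int h + int n)) = (\<Prod>h=0..n. \<Prod>t=1..n. half_sine m (int t - int (n - h) + int n))"
      by (subst prod.atLeastAtMost_rev) simp
    also have "\<dots> = den n"
      unfolding den_def by (intro prod.cong refl arg_cong[of _ _ "half_sine m"]) auto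
    finally show ?thesis .
  qed
  finally have Q: "Q_factor n m = num n / den n" unfolding num_def .
  have den0: "den n \<noteq> 0"
  proof -
    have "half_sine m (int t + int h) > 0" if "h \<in> {0..n}" "t \<in> {1..n}" for h t
      using that assms by (intro half_sine_pos) auto
    then have "den n > 0" unfolding den_def by (intro prod_pos) blast
    then show ?thesis by simp
  qed
  have "num n * (2 ^ n\<^sup>2 * (\<Prod>i=1..n. (odd_half_sine_prod m i)\<^sup>2)) = den n"
    using assms
  proof (induction n)
    case 0
    then show ?case by (simp add: num_def den_def)
  next
    case (Suc n)
    define Cn where "Cn = (\<Prod>j=1..n. half_cosine m (int j))"
    define E where "E = (\<Prod>d=Suc (Suc n)..2*n+1. half_sine m (int d))"
    have num: "num (Suc n) = num n * (Cn * (Cn * half_cosine m (int (Suc n))))"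
    proof -
      have "(\<Prod>h=0..Suc n. half_cosine m (int (Suc n) - int h - 1)) = Cn * half_cosine m 1"
      proof -
        have "(\<Prod>h=0..n. half_cosine m (int (Suc n) - int h - 1)) = (\<Prod>h=0..n. half_cosine m (int (Suc n) - int (n - h) - 1))"
          by (subst prod.atLeastAtMost_rev) simp
        also have "\<dots> = (\<Prod>h=0..n. half_cosine m (int h))"
          by (intro prod.cong refl arg_cong[of _ _ "half_cosine m"]) auto
        also have "\<dots> = Cn" unfolding Cn_def by (subst prod.atLeast_Suc_atMost) auto
        finally show ?thesis using half_cosine_minus[of m 1] by simp
      qed
      \<comment> \<open>The new column has arguments 2, ..., n + 1; the leftover factor at 1 from
        the new row completes it.\<close>
      moreover have "(\<Prod>t=1..n. half_cosine m (int t - int (Suc n) - 1)) * half_cosine m 1 = Cn * half_cosine m (int (Suc n))"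
      proof -
        have "(\<Prod>t=1..n. half_cosine m (int t - int (Suc n) - 1)) = (\<Prod>t=1..n. half_cosine m (int (n + 1 - t) - int (Suc n) - 1))"
          by (subst prod.atLeastAtMost_rev) simp
        also have "\<dots> = (\<Prod>t=1..n. half_cosine m (- int (Suc t)))"
          by (intro prod.cong refl arg_cong[of _ _ "half_cosine m"]) auto
        also have "\<dots> = (\<Prod>t=Suc 1..Suc n. half_cosine m (int t))"
          unfolding half_cosine_minus by (subst prod.shift_bounds_cl_Suc_ivl) simp
        also have "\<dots> * half_cosine m 1 = (\<Prod>t=1..Suc n. half_cosine m (int t))"
          by (subst prod.atLeast_Suc_atMost[of 1 "Suc n"]) (auto simp: mult_ac)
        finally show ?thesis unfolding Cn_def by simp
      qed
      ultimately show ?thesis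
        unfolding num_def prod_square_Suc[of 0 n, OF le0] by (simp only: mult_ac)
    qed
    have den: "den (Suc n) = den n * ((half_sine m (int (Suc n)) * E * half_sine m (2 * int (Suc n))) * E)"
    proof -
      have "(\<Prod>h=0..Suc n. half_sine m (int (Suc n) + int h)) = (\<Prod>d=Suc n..2*n+2. half_sine m (int d))"
        by (rule prod.reindex_bij_witness[of _ "\<lambda>d. d - Suc n" "\<lambda>h. Suc n + h"]) (auto simp: add_ac)
      also have "\<dots> = half_sine m (int (Suc n)) * E * half_sine m (2 * int (Suc n))"
        unfolding E_def by (subst prod.atLeast_Suc_atMost) (auto simp: algebra_simps)
      finally have 1: "(\<Prod>h=0..Suc n. half_sine m (int (Suc n) + int h)) = half_sine m (int (Suc n)) * E * half_sine m (2 * int (Suc n))" .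
      have 2: "(\<Prod>t=1..n. half_sine m (int t + int (Suc n))) = E"
        unfolding E_def by (rule prod.reindex_bij_witness[of _ "\<lambda>d. d - Suc n" "\<lambda>h. Suc n + h"]) (auto simp: add_ac)
      show ?thesis unfolding den_def prod_square_Suc[of 0 n, OF le0] 1 2 ..
    qed
    have K: "2 ^ n * Cn * odd_half_sine_prod m (Suc n) = half_sine m (int (Suc n)) * E"
    proof -
      have "(\<Prod>j=1..n. 2 * half_cosine m (int j)) = 2 ^ n * Cn" unfolding Cn_def by (simp add: prod.distrib)
      moreover have "(\<Prod>d=Suc n..2*n+1. half_sine m (int d)) = half_sine m (int (Suc n)) * E"
        unfolding E_def by (subst prod.atLeast_Suc_atMost) auto
      ultimately show ?thesis using prod_half_cosine_odd[of n m] Suc.prems by simp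
    qed
    \<comment> \<open>Each of the two uses of \<open>K\<close> absorbs n factors 2, and the
      remaining one belongs to the double angle formula at n + 1.\<close>
    have "(Suc n)\<^sup>2 = n\<^sup>2 + (n + n + 1)" by (simp add: power2_eq_square)
    then have "num (Suc n) * (2 ^ (Suc n)\<^sup>2 * (\<Prod>i=1..Suc n. (odd_half_sine_prod m i)\<^sup>2)) =
       (num n * (2 ^ n\<^sup>2 * (\<Prod>i=1..n. (odd_half_sine_prod m i)\<^sup>2))) *
        ((2 ^ n * Cn * odd_half_sine_prod m (Suc n)) * (2 ^ n * Cn * odd_half_sine_prod m (Suc n)) * (2 * half_cosine m (int (Suc n))))"
      unfolding num by (simp add: power_add power2_eq_square mult_ac)
    also have "\<dots> = den (Suc n)"
      unfolding K den half_sine_double[of m "int (Suc n)"] using Suc by (simp add: mult_ac)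
    finally show ?case .
  qed
  then show ?thesis unfolding Q using den0 by simp
qed

text \<open>Since \<open>r\<close> preserves the order, \<open>h\<close> may be arbitrary, in
  contrast to \<open>pair_prod_reindex\<close>.\<close>

lemma pair_prod_image:
  assumes "\<And>i j. i \<in> I \<Longrightarrow> j \<in> I \<Longrightarrow> i < j \<longleftrightarrow> r i < r j" "inj_on r I"
  shows "pair_prod (r ` I) h = pair_prod I (\<lambda>i j. h (r i) (r j))"
proof -
  have "{j \<in> r ` I. r i < j} = r ` {j \<in> I. i < j}" if "i \<in> I" for i
    using assms(1) that by auto
  moreover have "inj_on r {j \<in> I. i < j}" for i
    using assms(2) by (rule inj_on_subset) auto
  ultimately show ?thesis
    unfolding pair_prod_def using assms(2) by (simp add: prod.reindex)
qed

lemma image_int_interval: "int ` {1..n} = {1..int n}"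
  using image_int_atLeastAtMost[of 1 n] by simp

lemma pair_prod_int: "pair_prod {1..int n} h = pair_prod {1..n} (\<lambda>i j. h (int i) (int j))"
  unfolding image_int_interval[symmetric] by (rule pair_prod_image) auto

lemma prod_int: "(\<Prod>r\<in>{1..int n}. f r) = (\<Prod>r=1..n. f (int r))"
  unfolding image_int_interval[symmetric] by (subst prod.reindex) auto

lemma pair_prod_Suc: "pair_prod {1..Suc n} h = pair_prod {1..n} h * (\<Prod>i=1..n. h i (Suc n))"
proof -
  have "{1..Suc n} - {Suc n} = {1..n}" "{i \<in> {1..Suc n}. i < Suc n} = {1..n}" "{j \<in> {1..Suc n}. Suc n < j} = {}"
    by auto
  moreover have "pair_prod {1..Suc n} h = pair_prod ({1..Suc n} - {Suc n}) h *
      ((\<Prod>i\<in>{i\<in>{1..Suc n}. i < Suc n}. h i (Suc n)) * (\<Prod>j\<in>{j\<in>{1..Suc n}. Suc n < j}. h (Suc n) j))"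
    by (rule pair_prod_remove) auto
  ultimately show ?thesis by (simp only: prod.empty mult_1_right)
qed

lemma cosine_pair_pos:
  assumes "0 \<le> i" "i < j" "j \<le> int m"
  shows "cosine_pair m i j > 0"
  using cosine_strict_antimono[OF assms] by (simp add: cosine_pair_def)

text \<open>Fold the odd numbers below \<open>2 N\<close> about \<open>N\<close>.\<close>

lemma prod_fold_odd:
  "(\<Prod>i\<in>{i\<in>{1..n}. even i \<noteq> even (Suc n)}. 2 * half_sine m (int (Suc n) + int i) * half_sine m (int (Suc n) - int i)) *
     (if odd (Suc n) then half_sine m (int (Suc n)) else 1) = 2 ^ (Suc n div 2) * odd_half_sine_prod m (Suc n)"
proof (cases "odd (Suc n)")
  case True
  then obtain p where p: "n = 2 * p" by auto
  have "{i\<in>{1..n}. even i \<noteq> even (Suc n)} = (\<lambda>l. 2 * l) ` {1..p}"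
    unfolding p by (auto elim!: evenE)
  then have "(\<Prod>i\<in>{i\<in>{1..n}. even i \<noteq> even (Suc n)}. 2 * half_sine m (int (Suc n) + int i) * half_sine m (int (Suc n) - int i)) =
    (\<Prod>l=1..p. 2 * half_sine m (int (Suc n) + int (2 * l)) * half_sine m (int (Suc n) - int (2 * l)))"
    by (simp add: prod.reindex inj_on_def)
  also have "\<dots> = 2 ^ p * (\<Prod>l=1..p. half_sine m (2 * int (p + l) + 1)) * (\<Prod>l=1..p. half_sine m (2 * (int p - int l) + 1))"
    unfolding p by (simp add: prod.distrib algebra_simps)
  also have "\<dots> = 2 ^ p * (\<Prod>j=p+2..2*p+1. half_sine m (2 * int j - 1)) * odd_half_sine_prod m p"
  proof -
    have "(\<Prod>l=1..p. half_sine m (2 * int (p + l) + 1)) = (\<Prod>j=p+2..2*p+1. half_sine m (2 * int j - 1))"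
      by (rule prod.reindex_bij_witness[of _ "\<lambda>j. j - p - 1" "\<lambda>l. l + p + 1"]) (auto simp: algebra_simps)
    then show ?thesis unfolding odd_half_sine_prod_rev[of m p] by simp
  qed
  finally have *: "(\<Prod>i\<in>{i\<in>{1..n}. even i \<noteq> even (Suc n)}. 2 * half_sine m (int (Suc n) + int i) * half_sine m (int (Suc n) - int i)) =
    2 ^ p * (\<Prod>j=p+2..2*p+1. half_sine m (2 * int j - 1)) * odd_half_sine_prod m p" .
  have "odd_half_sine_prod m (Suc n) = odd_half_sine_prod m p * (\<Prod>j=Suc p..2*p+1. half_sine m (2 * int j - 1))"
  proof -
    have "{1..Suc n} = {1..p} \<union> {Suc p..2*p+1}" unfolding p by auto
    then show ?thesis unfolding odd_half_sine_prod_def by (simp add: prod.union_disjoint)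
  qed
  also have "(\<Prod>j=Suc p..2*p+1. half_sine m (2 * int j - 1)) = half_sine m (int (Suc n)) * (\<Prod>j=p+2..2*p+1. half_sine m (2 * int j - 1))"
    unfolding p by (subst prod.atLeast_Suc_atMost) (auto simp: algebra_simps)
  finally show ?thesis unfolding * using True p by (simp add: mult_ac)
next
  case False
  then have "2 dvd Suc n" by simp
  then obtain p where p: "Suc n = 2 * p" by (elim dvdE)
  have "{i\<in>{1..n}. even i \<noteq> even (Suc n)} = (\<lambda>l. 2 * l - 1) ` {1..p}"
  proof (rule set_eqI)
    fix i show "i \<in> {i\<in>{1..n}. even i \<noteq> even (Suc n)} \<longleftrightarrow> i \<in> (\<lambda>l. 2 * l - 1) ` {1..p}"
    proof
      assume i: "i \<in> {i\<in>{1..n}. even i \<noteq> even (Suc n)}"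
      then have "odd i" "i \<le> n" using False by auto
      then show "i \<in> (\<lambda>l. 2 * l - 1) ` {1..p}"
        using p by (intro image_eqI[of _ _ "Suc i div 2"]) (auto elim!: oddE)
    next
      assume "i \<in> (\<lambda>l. 2 * l - 1) ` {1..p}"
      then obtain l where "i = 2 * l - 1" "1 \<le> l" "l \<le> p" by auto
      then show "i \<in> {i\<in>{1..n}. even i \<noteq> even (Suc n)}" using p False by auto
    qed
  qed
  moreover have "inj_on (\<lambda>l. 2 * l - 1 :: nat) {1..p}" by (auto simp: inj_on_def)
  ultimately have "(\<Prod>i\<in>{i\<in>{1..n}. even i \<noteq> even (Suc n)}. 2 * half_sine m (int (Suc n) + int i) * half_sine m (int (Suc n) - int i)) =
    (\<Prod>l=1..p. 2 * half_sine m (int (Suc n) + int (2 * l - 1)) * half_sine m (int (Suc n) - int (2 * l - 1)))"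
    by (simp only: prod.reindex o_def)
  also have "\<dots> = (\<Prod>l=1..p. 2 * half_sine m (2 * int (p + l) - 1) * half_sine m (2 * (int p - int l) + 1))"
    unfolding p by (intro prod.cong refl arg_cong2[of _ _ _ _ "(*)"] arg_cong[of _ _ "half_sine m"]) auto
  also have "\<dots> = 2 ^ p * (\<Prod>l=1..p. half_sine m (2 * int (p + l) - 1)) * odd_half_sine_prod m p"
    unfolding odd_half_sine_prod_rev by (simp add: prod.distrib)
  also have "(\<Prod>l=1..p. half_sine m (2 * int (p + l) - 1)) = (\<Prod>j=p+1..2*p. half_sine m (2 * int j - 1))"
    by (rule prod.reindex_bij_witness[of _ "\<lambda>j. j - p" "\<lambda>l. l + p"]) (auto simp: algebra_simps)
  also have "2 ^ p * (\<Prod>j=p+1..2*p. half_sine m (2 * int j - 1)) * odd_half_sine_prod m p = 2 ^ p * odd_half_sine_prod m (Suc n)"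
  proof -
    have "{1..Suc n} = {1..p} \<union> {p+1..2*p}" unfolding p by auto
    then show ?thesis unfolding odd_half_sine_prod_def by (simp add: prod.union_disjoint mult_ac)
  qed
  finally show ?thesis using False p by simp
qed

lemma row_weight_eq: "row_weight m r = half_sine m (2 * r) * (if odd r then 1 / (2 * (half_sine m r)\<^sup>2) else 1)"
  by (simp add: row_weight_def sine_1 one_minus_cosine)

text \<open>Row n + 1 contributes D i for rows of equal parity but 1 / D i for rows of opposite
  parity. Multiplying by the square of B, the product of the latter D i, restores all of them, and
  \<open>prod_fold_odd\<close> identifies B with the next odd product, up to a power of two and one
  half sine. So every row consumes one squared odd product.\<close>

lemma sine_prod_bottom:
  assumes "n < m"
  shows "sine_prod m {1..int n} * (2 ^ n * (\<Prod>i=1..n. (odd_half_sine_prod m i)\<^sup>2)) =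
    pair_prod {1..n} (\<lambda>h t. half_sine m (int t - int h)) * pair_prod {1..n} (\<lambda>h t. half_sine m (int t + int h)) * (\<Prod>h=1..n. half_sine m (2 * int h))"
  using assms
proof (induction n)
  case 0
  then show ?case by (simp add: sine_prod_def)
next
  case (Suc n)
  let ?N = "Suc n"
  let ?O = "\<Prod>i=1..n. (odd_half_sine_prod m i)\<^sup>2"
  define D where "D = (\<lambda>i. 2 * half_sine m (int ?N + int i) * half_sine m (int ?N - int i))"
  define B where "B = (\<Prod>i\<in>{i\<in>{1..n}. even i \<noteq> even ?N}. D i)"
  define w where "w = (if odd ?N then 1 / (2 * (half_sine m (int ?N))\<^sup>2) else 1)"
  have D0: "D i \<noteq> 0" if "i \<in> {1..n}" for i
    using that Suc.prems half_sine_pos[of "int ?N + int i" m] half_sine_pos[of "int ?N - int i" m] by (auto simp: D_def)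
  have s0: "half_sine m (int ?N) \<noteq> 0" using half_sine_pos[of "int ?N" m] Suc.prems by simp
  have G: "sine_prod m {1..int ?N} = sine_prod m {1..int n} * (half_sine m (2 * int ?N) * w * (\<Prod>i=1..n. cosine_pair m (int i) (int ?N)))"
    unfolding sine_prod_def pair_prod_int prod_int pair_prod_Suc w_def by (simp add: row_weight_eq)
  have "B\<^sup>2 = (\<Prod>i=1..n. if even i \<noteq> even ?N then (D i)\<^sup>2 else 1)"
    unfolding B_def prod_power_distrib by (intro prod.mono_neutral_cong_left) auto
  moreover have "cosine_pair m (int i) (int ?N) = (if even i \<noteq> even ?N then 1 / D i else D i)" for i
    unfolding cosine_pair_def cosine_diff D_def by simp
  ultimately have cB: "(\<Prod>i=1..n. cosine_pair m (int i) (int ?N)) * B\<^sup>2 = (\<Prod>i=1..n. D i)"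
    unfolding prod.distrib[symmetric] using D0
    by (simp only: flip: prod.distrib) (intro prod.cong refl, auto simp: power2_eq_square)
  \<comment> \<open>For odd \<open>?N\<close> the fold fixes the argument \<open>?N\<close>, which
    therefore has no partner. Its square is compensated by the row weight \<open>w\<close>.\<close>
  define x where "x = (if odd ?N then half_sine m (int ?N) else 1)"
  have x0: "x\<^sup>2 \<noteq> 0" using s0 by (simp add: x_def)
  have "B * x = 2 ^ (?N div 2) * odd_half_sine_prod m ?N"
    unfolding B_def D_def x_def by (rule prod_fold_odd)
  then have "(B * x)\<^sup>2 = (2 ^ (?N div 2) * odd_half_sine_prod m ?N)\<^sup>2" by simp
  then have "B\<^sup>2 * x\<^sup>2 = 2 ^ (2 * (?N div 2)) * (odd_half_sine_prod m ?N)\<^sup>2"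
    by (simp add: power_mult_distrib power_even_eq)
  also have "2 ^ (2 * (?N div 2)) = 2 ^ ?N * w * x\<^sup>2"
  proof (cases "odd ?N")
    case True
    then have "2 * (?N div 2) = n" by auto
    then show ?thesis using True s0 by (simp add: w_def x_def)
  next
    case False
    then have "2 * (?N div 2) = ?N" by (intro dvd_mult_div_cancel) simp
    then show ?thesis using False by (simp only: w_def x_def if_False) simp
  qed
  finally have "(2 ^ ?N * w * (odd_half_sine_prod m ?N)\<^sup>2) * x\<^sup>2 = B\<^sup>2 * x\<^sup>2"
    by (simp only: mult_ac)
  then have BB: "2 ^ ?N * w * (odd_half_sine_prod m ?N)\<^sup>2 = B\<^sup>2"
    using x0 by (simp only: mult_cancel_right) simp
  have "sine_prod m {1..int ?N} * (2 ^ ?N * (\<Prod>i=1..?N. (odd_half_sine_prod m i)\<^sup>2)) =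
      (sine_prod m {1..int n} * ?O) * (half_sine m (2 * int ?N) * ((\<Prod>i=1..n. cosine_pair m (int i) (int ?N)) * (2 ^ ?N * w * (odd_half_sine_prod m ?N)\<^sup>2)))"
    unfolding G by (simp add: mult_ac)
  also have "\<dots> = (sine_prod m {1..int n} * ?O) * (half_sine m (2 * int ?N) * (\<Prod>i=1..n. D i))"
    unfolding BB cB ..
  also have "(\<Prod>i=1..n. D i) = 2 ^ n * ((\<Prod>i=1..n. half_sine m (int ?N + int i)) * (\<Prod>i=1..n. half_sine m (int ?N - int i)))"
    unfolding D_def by (simp add: prod.distrib)
  also have "(sine_prod m {1..int n} * ?O) * (half_sine m (2 * int ?N) * \<dots>) =
     (sine_prod m {1..int n} * (2 ^ n * ?O)) * (half_sine m (2 * int ?N) * ((\<Prod>i=1..n. half_sine m (int ?N + int i)) * (\<Prod>i=1..n. half_sine m (int ?N - int i))))"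
    by (simp only: mult_ac)
  also have "sine_prod m {1..int n} * (2 ^ n * ?O) = pair_prod {1..n} (\<lambda>h t. half_sine m (int t - int h)) * pair_prod {1..n} (\<lambda>h t. half_sine m (int t + int h)) * (\<Prod>h=1..n. half_sine m (2 * int h))"
    using Suc by simp
  finally show ?case unfolding pair_prod_Suc by (simp add: mult_ac)
qed

section \<open>The second dominant eigenvalue\<close>

lemma prod_split_parity:
  fixes n :: nat
  shows "(\<Prod>r=1..n. if odd r then f r else g r) =
    (\<Prod>h=1..(n+1) div 2. f (2 * h - 1)) * (\<Prod>h=1..n div 2. (g (2 * h) :: real))"
proof (induction n)
  case (Suc n)
  show ?case
  proof (cases "even n")
    case True
    then obtain p where "n = 2 * p" by auto
    then show ?thesis using Suc by (simp add: mult_ac)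
  next
    case False
    then have "Suc n div 2 = Suc (n div 2)" "(Suc n + 1) div 2 = (n + 1) div 2" "2 * Suc (n div 2) = Suc n"
      by (auto elim: oddE)
    moreover have "(\<Prod>r=1..Suc n. if odd r then f r else g r) = (\<Prod>r=1..n. if odd r then f r else g r) * g (Suc n)"
      using False by simp
    ultimately show ?thesis using Suc.IH False by simp
  qed
qed simp

text \<open>The mirror negates cosines, preserves equality of parities and reverses the order. All
  factors are positive on increasing pairs, so absolute values may be taken; these are symmetric,
  which makes the reversal harmless.\<close>

lemma pair_prod_cosine_pair_reflect:
  assumes "n < m"
  shows "pair_prod {int m - int n..int m - 1} (cosine_pair m) = pair_prod {1..int n} (cosine_pair m)"
proof -
  let ?h = "\<lambda>i j. \<bar>cosine_pair m i j\<bar>"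
  have m: "m > 0" using assms by simp
  have "pair_prod {int m - int n..int m - 1} (cosine_pair m) = pair_prod {int m - int n..int m - 1} ?h"
    using assms by (intro pair_prod_cong refl) (simp add: cosine_pair_pos less_imp_le)
  also have "\<dots> = pair_prod {1..int n} (\<lambda>i j. ?h (int m - i) (int m - j))"
  proof -
    have "?h a b = ?h b a" for a b using cosine_pair_anti[of m a b] by simp
    then show ?thesis
      unfolding top_image[symmetric]
      using pair_prod_reindex[of "{1..int n}" "\<lambda>r. int m - r" ?h] by (simp add: inj_on_def)
  qed
  also have "\<dots> = pair_prod {1..int n} (cosine_pair m)"
  proof (rule pair_prod_cong[OF refl])
    fix i j assume ij: "i \<in> {1..int n}" "j \<in> {1..int n}" "i < j"
    have "\<bar>cosine m (int m - i) - cosine m (int m - j)\<bar> = \<bar>cosine m i - cosine m j\<bar>"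
      unfolding cosine_reflect[OF m] by simp
    moreover have "even (int m - i) = even (int m - j) \<longleftrightarrow> even i = even j" by auto
    ultimately have "?h (int m - i) (int m - j) = ?h i j"
      unfolding cosine_pair_def by (simp only: abs_divide abs_one if_distrib[of abs])
    then show "?h (int m - i) (int m - j) = cosine_pair m i j"
      using ij assms cosine_pair_pos[of i j m] by simp
  qed
  finally show ?thesis .
qed

text \<open>The factor by which the closed form changes from {1..n} to its mirror image, in the
  shape of the products in the theorem. For odd \<open>m\<close> it has this meaning only for even
  \<open>n\<close>; for even \<open>m\<close> the bound \<open>(n+1) div 2\<close> covers both
  parities of \<open>n\<close>.\<close>

definition mirror_ratio :: "nat \<Rightarrow> nat \<Rightarrow> real" where
  "mirror_ratio n m = (if even m
     then (\<Prod>h=1..(n+1) div 2. (tan ((2 * real h - 1) * pi / (2 * real m)))\<^sup>2)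
     else (\<Prod>h=1..n div 2. (sin ((2 * real h - 1) * pi / (2 * real m)))\<^sup>2 / (cos (real h * pi / real m))\<^sup>2))"

lemma mirror_ratio_eq:
  "mirror_ratio n m = (if even m
     then (\<Prod>h=1..(n+1) div 2. (half_sine m (2 * int h - 1) / half_cosine m (2 * int h - 1))\<^sup>2)
     else (\<Prod>h=1..n div 2. (half_sine m (2 * int h - 1) / half_cosine m (2 * int h))\<^sup>2))"
proof -
  have a: "(2 * real h - 1) * pi / (2 * real m) = pi * real_of_int (2 * int h - 1) / (2 * real m)" for h
    by simp
  have b: "real h * pi / real m = pi * real_of_int (2 * int h) / (2 * real m)" for h
    by simp
  show ?thesis
    unfolding mirror_ratio_def a b tan_def half_sine_def[symmetric] half_cosine_def[symmetric] by (simp add: power_divide)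
qed

text \<open>The cosines are half sines at complementary arguments. With the denominators taken in
  reverse order, every numerator has a strictly smaller argument than its denominator, inside the
  range where the sine increases. Strictness excludes cancellation between the two dominant
  eigenvalues.\<close>

lemma mirror_ratio_less_1:
  assumes "n \<ge> 1" "n + 1 < m" "even m \<or> even n"
  shows "0 \<le> mirror_ratio n m" "mirror_ratio n m < 1"
proof -
  have m: "m > 0" using assms by simp
  show "0 \<le> mirror_ratio n m" unfolding mirror_ratio_eq by (auto intro!: prod_nonneg)
  \<comment> \<open>The offset \<open>b\<close> is 1 for even \<open>m\<close> and 0 for odd
    \<open>m\<close>. The bound on \<open>q\<close> is 2h - 1 < m - 2(q + 1 - h) + b
    rearranged.\<close>
  have key: "(\<Prod>h=1..q. (half_sine m (2 * int h - 1) / half_sine m (int m - 2 * int h + b))\<^sup>2) < 1"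
    if "q \<ge> 1" "b \<in> {0, 1}" "2 * int q < int m - 1 + b" for q b
  proof -
    have pos: "half_sine m (2 * int h - 1) > 0" "half_sine m (int m - 2 * int h + b) > 0" if "h \<in> {1..q}" for h
      using that \<open>b \<in> {0,1}\<close> \<open>2 * int q < int m - 1 + b\<close> by (auto intro!: half_sine_pos)
    have "(\<Prod>h=1..q. half_sine m (2 * int h - 1)) < (\<Prod>h=1..q. half_sine m (int m - 2 * int (q + 1 - h) + b))"
    proof (rule prod_mono_strict[of 1])
      have less: "half_sine m (2 * int h - 1) < half_sine m (int m - 2 * int (q + 1 - h) + b)" if "h \<in> {1..q}" for h
        using that \<open>b \<in> {0,1}\<close> \<open>2 * int q < int m - 1 + b\<close> by (intro half_sine_less) (auto simp: of_nat_diff)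
      show "half_sine m (2 * int 1 - 1) < half_sine m (int m - 2 * int (q + 1 - 1) + b)"
        by (rule less) (use \<open>q \<ge> 1\<close> in simp)
      show "0 \<le> half_sine m (2 * int h - 1) \<and> half_sine m (2 * int h - 1) \<le> half_sine m (int m - 2 * int (q + 1 - h) + b)"
        "0 < half_sine m (int m - 2 * int (q + 1 - h) + b)" if "h \<in> {1..q}" for h
        using less[OF that] pos(1)[OF that] by linarith+
    qed (use \<open>q \<ge> 1\<close> in auto)
    also have "\<dots> = (\<Prod>h=1..q. half_sine m (int m - 2 * int h + b))"
      by (subst (2) prod.atLeastAtMost_rev) simp
    finally have lt: "(\<Prod>h=1..q. half_sine m (2 * int h - 1)) < (\<Prod>h=1..q. half_sine m (int m - 2 * int h + b))" .
    have p: "0 \<le> (\<Prod>h=1..q. half_sine m (2 * int h - 1))" "0 < (\<Prod>h=1..q. half_sine m (int m - 2 * int h + b))"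
      using pos by (auto intro!: prod_nonneg prod_pos less_imp_le)
    have "((\<Prod>h=1..q. half_sine m (2 * int h - 1)) / (\<Prod>h=1..q. half_sine m (int m - 2 * int h + b)))\<^sup>2 < 1\<^sup>2"
      using lt p by (intro power_strict_mono) auto
    then show ?thesis by (simp only: one_power2 prod_power_distrib flip: prod_dividef)
  qed
  show "mirror_ratio n m < 1"
  proof (cases "even m")
    case True
    have "2 * int ((n + 1) div 2) < int m - 1 + 1" using assms(2) by linarith
    moreover have "half_cosine m (2 * int h - 1) = half_sine m (int m - 2 * int h + 1)" for h
      using half_sine_m_minus[OF m, of "2 * int h - 1"] by (simp add: algebra_simps)
    ultimately show ?thesis unfolding mirror_ratio_eq using True assms(1) key[of "(n + 1) div 2" 1] by simp
  next
    case False
    have "n div 2 \<ge> 1" "2 * int (n div 2) < int m - 1 + 0" using assms False by (auto elim!: evenE)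
    moreover have "half_cosine m (2 * int h) = half_sine m (int m - 2 * int h + 0)" for h
      using half_sine_m_minus[OF m, of "2 * int h"] by simp
    ultimately show ?thesis unfolding mirror_ratio_eq using False key[of "n div 2" 0] by simp
  qed
qed

text \<open>The pair products agree and the sine in a row weight is mirror invariant, so only the
  denominators matter. For even \<open>m\<close> an odd row exchanges 1 - cos for 1 + cos, which is
  a squared tangent of the half angle. For odd \<open>m\<close> odd rows lose 1 - cos and even rows
  acquire 1 + cos; for even \<open>n\<close> both occur equally often and the factors 2
  cancel.\<close>

lemma sine_prod_top:
  assumes "n < m" "even m \<or> even n"
  shows "sine_prod m {int m - int n..int m - 1} = mirror_ratio n m * sine_prod m {1..int n}"
proof -
  have m: "m > 0" using assms by simp
  have "(\<Prod>r\<in>{int m - int n..int m - 1}. row_weight m r) = (\<Prod>r\<in>{1..int n}. row_weight m (int m - r))"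
    unfolding top_image[symmetric] by (subst prod.reindex) (auto simp: inj_on_def)
  also have "\<dots> = (\<Prod>r=1..n. row_weight m (int m - int r))" by (rule prod_int)
  also have "\<dots> = mirror_ratio n m * (\<Prod>r=1..n. row_weight m (int r))"
  proof (cases "even m")
    case True
    have "row_weight m (int m - int r) = (if odd r then (half_sine m (int r) / half_cosine m (int r))\<^sup>2 else 1) * row_weight m (int r)" if "r \<in> {1..n}" for r
    proof -
      have "half_sine m (int r) \<noteq> 0" using half_sine_pos[of "int r" m] that assms(1) by simp
      then show ?thesis
        unfolding row_weight_def sine_reflect[OF m] cosine_reflect[OF m] one_minus_cosine minus_minus
        using True one_plus_cosine[of m "int r"] by (auto simp: power_divide field_simps)
    qed
    then have "(\<Prod>r=1..n. row_weight m (int m - int r)) = (\<Prod>r=1..n. if odd r then (half_sine m (int r) / half_cosine m (int r))\<^sup>2 else 1) * (\<Prod>r=1..n. row_weight m (int r))"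
      unfolding prod.distrib[symmetric] by (intro prod.cong) auto
    also have "(\<Prod>r=1..n. if odd r then (half_sine m (int r) / half_cosine m (int r))\<^sup>2 else 1) = mirror_ratio n m"
      unfolding mirror_ratio_eq prod_split_parity using True by (auto intro!: prod.cong simp: of_nat_diff)
    finally show ?thesis .
  next
    case False
    then have n: "even n" using assms(2) by simp
    have "row_weight m (int m - int r) = (if odd r then 2 * (half_sine m (int r))\<^sup>2 else 1 / (2 * (half_cosine m (int r))\<^sup>2)) * row_weight m (int r)" if "r \<in> {1..n}" for r
    proof -
      have "half_sine m (int r) \<noteq> 0" using half_sine_pos[of "int r" m] that assms(1) by simp
      then show ?thesis
        unfolding row_weight_def sine_reflect[OF m] cosine_reflect[OF m] one_minus_cosine minus_minus
        using False one_plus_cosine[of m "int r"] by (auto simp: power_divide field_simps)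
    qed
    then have "(\<Prod>r=1..n. row_weight m (int m - int r)) = (\<Prod>r=1..n. if odd r then 2 * (half_sine m (int r))\<^sup>2 else 1 / (2 * (half_cosine m (int r))\<^sup>2)) * (\<Prod>r=1..n. row_weight m (int r))"
      unfolding prod.distrib[symmetric] by (intro prod.cong) auto
    also have "(\<Prod>r=1..n. if odd r then 2 * (half_sine m (int r))\<^sup>2 else 1 / (2 * (half_cosine m (int r))\<^sup>2)) =
        (\<Prod>h=1..n div 2. 2 * (half_sine m (int (2 * h - 1)))\<^sup>2) * (\<Prod>h=1..n div 2. 1 / (2 * (half_cosine m (int (2 * h)))\<^sup>2))"
      unfolding prod_split_parity using n by simp
    also have "\<dots> = mirror_ratio n m"
      unfolding mirror_ratio_eq prod.distrib[symmetric] using False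
      by (auto intro!: prod.cong simp: of_nat_diff power_divide)
    finally show ?thesis .
  qed
  finally show ?thesis
    unfolding sine_prod_def pair_prod_cosine_pair_reflect[OF assms(1)] prod_int by simp
qed

lemma card_odds_evens:
  "card (odds {1..int n}) = (n + 1) div 2" "card (evens {1..int n}) = n div 2"
proof (induction n)
  case (Suc n)
  have "{1..int (Suc n)} = insert (int (Suc n)) {1..int n}" by auto
  then have "odds {1..int (Suc n)} = (if odd n then odds {1..int n} else insert (int (Suc n)) (odds {1..int n}))"
    "evens {1..int (Suc n)} = (if odd n then insert (int (Suc n)) (evens {1..int n}) else evens {1..int n})"
    by auto
  moreover have "finite (odds {1..int n})" "finite (evens {1..int n})"
    by (rule finite_subset[of _ "{1..int n}"]; auto)+
  moreover have "int (Suc n) \<notin> odds {1..int n}" "int (Suc n) \<notin> evens {1..int n}" by auto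
  ultimately have "card (odds {1..int (Suc n)}) = (if odd n then (n + 1) div 2 else Suc ((n + 1) div 2))"
    "card (evens {1..int (Suc n)}) = (if odd n then Suc (n div 2) else n div 2)"
    using Suc by (simp_all only: card_insert_disjoint split: if_split) auto
  then show "card (odds {1..int (Suc n)}) = (Suc n + 1) div 2" "card (evens {1..int (Suc n)}) = Suc n div 2"
    by (auto elim!: oddE evenE)
qed simp_all

lemma card_odds_evens_top:
  "card (odds {int m - int n..int m - 1}) = (if even m then (n + 1) div 2 else n div 2)"
  "card (evens {int m - int n..int m - 1}) = (if even m then n div 2 else (n + 1) div 2)"
proof -
  let ?f = "\<lambda>r. int m - r"
  have inj: "inj_on ?f A" for A by (auto simp: inj_on_def)
  have *: "odds (?f ` A) = ?f ` (if even m then odds A else evens A)"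
    "evens (?f ` A) = ?f ` (if even m then evens A else odds A)" for A
    by auto
  note *[of "{1..int n}"]
  then show "card (odds {int m - int n..int m - 1}) = (if even m then (n + 1) div 2 else n div 2)"
    "card (evens {int m - int n..int m - 1}) = (if even m then n div 2 else (n + 1) div 2)"
    unfolding top_image by (cases "even m"; simp only: if_True if_False card_image[OF inj] card_odds_evens)+
qed

lemma alternating_sum_bottom:
  assumes "n < m"
  shows "alternating_sum {1..int m - 1} (sine m) {1..int n} = sine_prod m {1..int n}"
proof (rule alternating_sum_sine_balanced)
  show "card (odds {1..int n}) = card (evens {1..int n}) \<or> card (odds {1..int n}) = card (evens {1..int n}) + 1"
    unfolding card_odds_evens by (cases "even n") (auto elim!: oddE evenE)
qed (use assms in auto)

text \<open>For \<open>m\<close> and \<open>n\<close> both odd, the mirrored set has one more even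
  than odd frequency and its sum vanishes. This is why the last case of the theorem has no
  oscillating term.\<close>

lemma alternating_sum_top_set:
  assumes "n < m"
  shows "alternating_sum {1..int m - 1} (sine m) {int m - int n..int m - 1} =
    (if even m \<or> even n then mirror_ratio n m else 0) * sine_prod m {1..int n}"
proof (cases "even m \<or> even n")
  case True
  have "alternating_sum {1..int m - 1} (sine m) {int m - int n..int m - 1} = sine_prod m {int m - int n..int m - 1}"
  proof (rule alternating_sum_sine_balanced)
    show "card (odds {int m - int n..int m - 1}) = card (evens {int m - int n..int m - 1}) \<or>
      card (odds {int m - int n..int m - 1}) = card (evens {int m - int n..int m - 1}) + 1"
      unfolding card_odds_evens_top using True by (cases "even n") (auto elim!: oddE evenE)
  qed (use assms in auto)
  then show ?thesis using True sine_prod_top[OF assms True] by simp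
next
  case False
  have "alternating_sum {1..int m - 1} (sine m) {int m - int n..int m - 1} = 0"
  proof (rule alternating_sum_sine_unbalanced)
    show "card (odds {int m - int n..int m - 1}) < card (evens {int m - int n..int m - 1})"
      unfolding card_odds_evens_top using False by (auto elim!: oddE)
  qed (use assms in auto)
  then show ?thesis using False by simp
qed

text \<open>The product counts even coordinates and so equals (-1)^(n + |x|). The exponent n(n-1)/2
  + n has the parity of \<open>(n + 1) div 2\<close>, as the residues of n modulo 4 show. This
  explains the n/2 and (n+1)/2 in the theorem.\<close>

lemma sign_eq:
  "(-1) ^ (n * (n - 1) div 2) * (\<Prod>i\<in>{1..n}. if even (x i) then -1 else 1) =
    ((-1) powi ((\<Sum>i=1..n. x i) + int ((n + 1) div 2)) :: real)"
proof -
  have "(\<Prod>i\<in>{1..n}. if even (x i) then -1 else 1) = ((-1) ^ n * (-1) powi (\<Sum>i=1..n. x i) :: real)"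
  proof (induction n)
    case (Suc n)
    then show ?case by (simp add: power_int_add power_int_minus_left)
  qed simp
  moreover have "(-1) ^ (n * (n - 1) div 2) * (-1) ^ n = ((-1) ^ ((n + 1) div 2) :: real)"
  proof -
    obtain q r where n: "n = 4 * q + r" "r < 4" by (metis mod_less_divisor mult_div_mod_eq zero_less_numeral)
    have d: "a div 2 = b" if "a = 2 * b" for a b :: nat using that by simp
    from \<open>r < 4\<close> consider "r = 0" | "r = 1" | "r = 2" | "r = 3" by linarith
    then have "even (n * (n - 1) div 2 + n) \<longleftrightarrow> even ((n + 1) div 2)"
    proof cases
      case 1
      then have "n * (n - 1) = 2 * (2 * q * (n - 1))" "(n + 1) div 2 = 2 * q" using n by simp_all
      then have "n * (n - 1) div 2 = 2 * q * (n - 1)" "(n + 1) div 2 = 2 * q" by (blast intro: d)+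
      then show ?thesis using n 1 by simp
    next
      case 2
      then have "n * (n - 1) = 2 * (2 * q * n)" "(n + 1) div 2 = 2 * q + 1" using n by simp_all
      then have "n * (n - 1) div 2 = 2 * q * n" "(n + 1) div 2 = 2 * q + 1" by (blast intro: d)+
      then show ?thesis using n 2 by simp
    next
      case 3
      then have "n * (n - 1) = 2 * ((2 * q + 1) * (n - 1))" "(n + 1) div 2 = 2 * q + 1" using n by simp_all
      then have "n * (n - 1) div 2 = (2 * q + 1) * (n - 1)" "(n + 1) div 2 = 2 * q + 1" by (blast intro: d)+
      then show ?thesis using n 3 by simp
    next
      case 4
      then have "n * (n - 1) = 2 * (n * (2 * q + 1))" "(n + 1) div 2 = 2 * q + 2" using n by simp_all
      then have "n * (n - 1) div 2 = n * (2 * q + 1)" "(n + 1) div 2 = 2 * q + 2" by (blast intro: d)+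
      then show ?thesis using n 4 by simp
    qed
    moreover have "(-1) ^ a * (-1) ^ n = ((-1) ^ b :: real)" if "even (a + n) = even b" for a b
      using that by (cases "even a"; cases "even n"; cases "even b"; simp)
    ultimately show ?thesis by blast
  qed
  ultimately show ?thesis by (simp add: power_int_add mult_ac)
qed

text \<open>Both frequency sets have n elements, so their normalising signs agree. What remains is
  the mirror sign of the starting point and the ratio of the end-point sums.\<close>

lemma spectral_coeff_top:
  assumes "n < m"
  shows "spectral_coeff n m x {int m - int n..int m - 1} =
    (-1) powi ((\<Sum>i=1..n. x i) + int ((n + 1) div 2)) * (if even m \<or> even n then mirror_ratio n m else 0) *
      spectral_coeff n m x {1..int n}"
proof -
  have sgR: "order_sign R (\<lambda>a. a) = (-1) ^ (card R * (card R - 1) div 2)" if "finite R" for R :: "int set"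
  proof -
    have "order_sign R (\<lambda>a. a) = pair_prod R (\<lambda>_ _. -1)" unfolding order_sign_def by (intro pair_prod_cong) auto
    then show ?thesis using that by (simp add: pair_prod_const)
  qed
  have m: "m > 0" using assms by simp
  show ?thesis
    unfolding spectral_coeff_def alternating_sum_top_set[OF assms] alternating_sum_bottom[OF assms] alternating_sum_top_reflect[OF m] sign_eq
    by (simp add: sgR mult_ac)
qed

section \<open>Asymptotics\<close>

lemma pair_prod_nonzero:
  assumes "finite I" "\<And>i j. i \<in> I \<Longrightarrow> j \<in> I \<Longrightarrow> i < j \<Longrightarrow> h i j \<noteq> 0"
  shows "pair_prod I h \<noteq> 0"
  unfolding pair_prod_def using assms by auto

text \<open>A Dirichlet kernel sum, brought to the form in which it is raised to the power k in
  \<open>P_factor\<close>.\<close>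

lemma eigenvalue_eq:
  assumes "m > 0"
  shows "2 * (\<Sum>r\<in>{1..int n}. cosine m r) =
    2 * sin (real n * pi / (2 * real m)) * cos ((real n + 1) * pi / (2 * real m)) / sin (pi / (2 * real m))"
proof -
  define h where "h = pi / (2 * real m)"
  have s: "sin h \<noteq> 0" using half_sine_pos[of 1 m] assms by (simp add: half_sine_def h_def)
  have "(\<Sum>r\<in>{1..int n}. cosine m r) = (\<Sum>x\<in>{1..int n}. cos (2 * h * real_of_int x))"
    by (simp add: cosine_def h_def)
  then have "2 * sin h * (\<Sum>r\<in>{1..int n}. cosine m r) = sin (h * (2 * real n + 1)) - sin h"
    using sum_cos_telescope[of 1 "int n" h] by simp
  also have "\<dots> = 2 * sin (real n * h) * cos ((real n + 1) * h)"
    unfolding sin_diff_sin by (simp add: algebra_simps add_divide_distrib)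
  finally have "2 * (\<Sum>r\<in>{1..int n}. cosine m r) = 2 * sin (real n * h) * cos ((real n + 1) * h) / sin h"
    using s by (simp add: field_simps)
  then show ?thesis by (simp add: h_def)
qed

lemma prod_pairs_less:
  fixes n :: nat
  shows "(\<Prod>(h, t)\<in>{(h, t). 1 \<le> h \<and> h < t \<and> t \<le> n}. f h t) = pair_prod {1..n} f"
proof -
  have "{(h, t). 1 \<le> h \<and> h < t \<and> t \<le> n} = (SIGMA h:{1..n}. {t\<in>{1..n}. h < t})" by auto
  then show ?thesis unfolding pair_prod_def by (simp add: prod.Sigma)
qed

lemma prod_pairs_le:
  fixes n :: nat
  shows "(\<Prod>(h, t)\<in>{(h, t). 1 \<le> h \<and> h \<le> t \<and> t \<le> n}. f h t) = pair_prod {1..n} f * (\<Prod>h=1..n. f h h)"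
proof -
  let ?A = "{(h, t). 1 \<le> h \<and> h < t \<and> t \<le> n}"
  have "{(h, t). 1 \<le> h \<and> h \<le> t \<and> t \<le> n} = ?A \<union> (\<lambda>h. (h, h)) ` {1..n}" by auto
  moreover have "finite ?A" by (rule finite_subset[of _ "{1..n} \<times> {1..n}"]) auto
  moreover have "?A \<inter> (\<lambda>h. (h, h)) ` {1..n} = {}" by auto
  moreover have "inj_on (\<lambda>h. (h, h)) {1..n}" by (auto simp: inj_on_def)
  ultimately show ?thesis
    by (simp only: prod.union_disjoint finite_imageI finite_atLeastAtMost prod_pairs_less prod.reindex o_def prod.case)
qed

text \<open>The exponent 2n^2 - n is split as n^2 + n(n-1). The first power will cancel against
  \<open>Q\<close>; the second arises half from \<open>weyl_numerator\<close> and half from writing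
  differences of cosines as products of sines.\<close>

lemma P_factor_eq:
  assumes "m > 0"
  shows "P_factor n m \<eta> k = 2 ^ n\<^sup>2 * 2 ^ (n * (n - 1)) / real m ^ n * (2 * (\<Sum>r\<in>{1..int n}. cosine m r)) ^ k *
    (pair_prod {1..n} (\<lambda>h t. half_sine m (\<eta> h - \<eta> t)) * pair_prod {1..n} (\<lambda>h t. half_sine m (int t - int h))) *
    (pair_prod {1..n} (\<lambda>h t. half_sine m (\<eta> t + \<eta> h)) * (\<Prod>h=1..n. half_sine m (2 * \<eta> h)) *
     (pair_prod {1..n} (\<lambda>h t. half_sine m (int t + int h)) * (\<Prod>h=1..n. half_sine m (2 * int h))))"
proof -
  have "2 * int n ^ 2 - int n = int (n\<^sup>2 + n * (n - 1))"
    by (cases n) (auto simp: power2_eq_square algebra_simps)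
  then have "2 powi (2 * int n ^ 2 - int n) = (2 ^ n\<^sup>2 * 2 ^ (n * (n - 1)) :: real)"
    by (simp only: power_int_of_nat power_add)
  moreover have "sin (pi * real_of_int z / (2 * real m)) = half_sine m z"
    "sin (pi * (real t - real h) / (2 * real m)) = half_sine m (int t - int h)"
    "sin (pi * (real t + real h) / (2 * real m)) = half_sine m (int t + int h)"
    "half_sine m (z + z) = half_sine m (2 * z)" for t h z
    by (simp_all add: half_sine_def)
  ultimately show ?thesis
    unfolding P_factor_def eigenvalue_eq[OF assms, symmetric] prod_pairs_less prod_pairs_le pair_prod_mult prod.distrib
    by (simp only: mult_ac)
qed

lemma sine_1_left: "sine m 1 x = half_sine m (2 * x)"
  by (simp add: sine_def half_sine_def)

text \<open>The squared odd products enter through \<open>sine_prod_bottom\<close> and leave through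
  \<open>Q_factor_eq\<close>, so that only the products in \<open>P_factor\<close> remain. The
  coefficient is nonzero because every half sine involved has its argument strictly between 0 and
  2m.\<close>

lemma spectral_coeff_bottom:
  assumes x: "(\<lambda>i. real_of_int (x i)) \<in> alcove_C n m" and "n < m"
  shows "spectral_coeff n m x {1..int n} * (2 * (\<Sum>r\<in>{1..int n}. cosine m r)) ^ k = P_factor n m x k * Q_factor n m"
    "spectral_coeff n m x {1..int n} \<noteq> 0"
proof -
  let ?I = "{1..n}" and ?O = "\<Prod>i=1..n. (odd_half_sine_prod m i)\<^sup>2"
  let ?C = "n * (n - 1) div 2"
  have m: "m > 0" using assms by simp
  have range: "0 < x i" "x i < int m" if "i \<in> ?I" for i
    using alcove_range[OF x that] by linarith+
  have dec: "x j < x i" if "i \<in> ?I" "j \<in> ?I" "i < j" for i j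
    using alcove_mono[OF x, of i j] that by simp
  have inj: "inj_on (\<lambda>i. cosine m (x i)) ?I"
  proof (rule linorder_inj_onI)
    fix i j assume "i < j" "i \<in> ?I" "j \<in> ?I"
    then have "cosine m (x i) < cosine m (x j)" using dec range by (intro cosine_strict_antimono) (auto simp: less_imp_le)
    then show "cosine m (x i) \<noteq> cosine m (x j)" by simp
  qed auto
  define PM where "PM = pair_prod ?I (\<lambda>h t. half_sine m (x h - x t))"
  define PP where "PP = pair_prod ?I (\<lambda>h t. half_sine m (x t + x h))"
  define PD where "PD = (\<Prod>h=1..n. half_sine m (2 * x h))"
  define RM where "RM = pair_prod ?I (\<lambda>h t. half_sine m (int t - int h))"
  define RP where "RP = pair_prod ?I (\<lambda>h t. half_sine m (int t + int h))"
  define RD where "RD = (\<Prod>h=1..n. half_sine m (2 * int h))"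
  define G where "G = sine_prod m {1..int n}"
  have "even (n * (n - 1))" by (cases n) auto
  then have two: "2 * ?C = n * (n - 1)" by (rule dvd_mult_div_cancel)
  \<comment> \<open>The sign collected from each pair here cancels against the order sign of the
    increasing list of frequencies.\<close>
  have "cosine m (x i) - cosine m (x j) = (-1) * (2 * (half_sine m (x i - x j) * half_sine m (x j + x i)))" for i j
    unfolding cosine_diff using half_sine_minus[of m "x i - x j"] by simp
  then have "pair_prod ?I (\<lambda>i j. cosine m (x i) - cosine m (x j)) = (-1) ^ ?C * (2 ^ ?C * (PM * PP))"
    unfolding PM_def PP_def by (simp only: pair_prod_mult) (simp add: pair_prod_const)
  then have W: "alternating_sum {1..int n} (\<lambda>i \<rho>. sine m \<rho> (x i)) ?I = 2 ^ ?C * PD * ((-1) ^ ?C * (2 ^ ?C * (PM * PP)))"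
    using weyl_numerator[OF _ inj] unfolding PD_def sine_1_left by simp
  have "order_sign {1..int n} (\<lambda>a. a) = pair_prod {1..int n} (\<lambda>_ _. -1)"
    unfolding order_sign_def by (intro pair_prod_cong) auto
  then have order_sign: "order_sign {1..int n} (\<lambda>a. a) = (-1) ^ ?C" by (simp add: pair_prod_const)
  have "spectral_coeff n m x {1..int n} =
     (2 / real m) ^ n * ((-1) ^ ?C * (-1) ^ ?C) * (2 ^ ?C * 2 ^ ?C) * G * (PD * PM * PP)"
    unfolding spectral_coeff_def alternating_sum_bottom[OF assms(2)] W order_sign G_def by (simp only: mult_ac)
  also have "(-1) ^ ?C * (-1) ^ ?C = (1::real)" by (simp flip: power_add)
  also have "2 ^ ?C * 2 ^ ?C = (2 ^ (n * (n - 1)) :: real)" by (simp only: two flip: power_add mult_2)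
  finally have S: "spectral_coeff n m x {1..int n} = 2 ^ n / real m ^ n * 2 ^ (n * (n - 1)) * G * (PD * PM * PP)"
    by (simp add: power_divide)
  have GB: "G * (2 ^ n * ?O) = RM * RP * RD"
    unfolding G_def RM_def RP_def RD_def by (rule sine_prod_bottom[OF assms(2)])
  have Q: "Q_factor n m * (2 ^ n\<^sup>2 * ?O) = 1" by (rule Q_factor_eq[OF assms(2)])
  define \<mu> where "\<mu> = 2 * (\<Sum>r\<in>{1..int n}. cosine m r)"
  have "P_factor n m x k * Q_factor n m =
      2 ^ n\<^sup>2 * 2 ^ (n * (n - 1)) / real m ^ n * \<mu> ^ k * (PM * PP * PD) * (RM * RP * RD) * Q_factor n m"
    unfolding P_factor_eq[OF m] PM_def PP_def PD_def RM_def RP_def RD_def \<mu>_def by (simp only: mult_ac)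
  also have "\<dots> = 2 ^ (n * (n - 1)) / real m ^ n * \<mu> ^ k * (PM * PP * PD) * (G * 2 ^ n) * (Q_factor n m * (2 ^ n\<^sup>2 * ?O))"
    unfolding GB[symmetric] by simp
  also have "\<dots> = spectral_coeff n m x {1..int n} * \<mu> ^ k"
    unfolding Q S by (simp add: mult_ac)
  finally show "spectral_coeff n m x {1..int n} * (2 * (\<Sum>r\<in>{1..int n}. cosine m r)) ^ k = P_factor n m x k * Q_factor n m"
    unfolding \<mu>_def by simp
  have "PM \<noteq> 0" unfolding PM_def
  proof (rule pair_prod_nonzero)
    fix i j assume "i \<in> ?I" "j \<in> ?I" "i < j"
    then show "half_sine m (x i - x j) \<noteq> 0" using dec[of i j] range[of i] range[of j] half_sine_pos[of "x i - x j" m] by simp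
  qed simp
  moreover have "PP \<noteq> 0" unfolding PP_def
  proof (rule pair_prod_nonzero)
    fix i j assume "i \<in> ?I" "j \<in> ?I" "i < j"
    then show "half_sine m (x j + x i) \<noteq> 0" using range[of i] range[of j] half_sine_pos[of "x j + x i" m] by simp
  qed simp
  moreover have "half_sine m (2 * x h) > 0" if "h \<in> ?I" for h
    using range[OF that] by (intro half_sine_pos) auto
  then have "PD \<noteq> 0" unfolding PD_def by (metis less_irrefl prod_pos)
  moreover have "RM \<noteq> 0" unfolding RM_def
  proof (rule pair_prod_nonzero)
    fix i j assume "i \<in> ?I" "j \<in> ?I" "i < j"
    then show "half_sine m (int j - int i) \<noteq> 0" using half_sine_pos[of "int j - int i" m] assms(2) by simp
  qed simp
  moreover have "RP \<noteq> 0" unfolding RP_def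
  proof (rule pair_prod_nonzero)
    fix i j assume "i \<in> ?I" "j \<in> ?I" "i < j"
    then show "half_sine m (int j + int i) \<noteq> 0" using half_sine_pos[of "int j + int i" m] assms(2) by simp
  qed simp
  moreover have "half_sine m (2 * int h) > 0" if "h \<in> ?I" for h
    using that assms(2) by (intro half_sine_pos) auto
  then have "RD \<noteq> 0" unfolding RD_def by (metis less_irrefl prod_pos)
  ultimately show "spectral_coeff n m x {1..int n} \<noteq> 0"
    unfolding S using GB m by auto
qed

text \<open>The normalised sequence need not converge, so the comparison function keeps the
  oscillation. Divided by the power of \<mu>, its modulus is at least |A| (1 - t), and so a
  vanishing absolute error is a vanishing relative error.\<close>

lemma asymp_equiv_oscillating:
  fixes f :: "nat \<Rightarrow> real"
  assumes lim: "(\<lambda>k. f k / \<mu> ^ k - (A + (-1) ^ k * (s * (t * A)))) \<longlonglongrightarrow> 0"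
    and "\<mu> > 0" "A \<noteq> 0" "\<bar>s\<bar> = 1" "0 \<le> t" "t < 1"
  shows "f \<sim>[at_top] (\<lambda>k. A * \<mu> ^ k * (1 + (-1) ^ k * s * t))"
proof (rule asymp_equivI')
  define d where "d = (\<lambda>k. f k / \<mu> ^ k - (A + (-1) ^ k * (s * (t * A))))"
  define b where "b = (\<lambda>k::nat. 1 + (-1) ^ k * s * t)"
  have b: "1 - t \<le> b k" for k
  proof -
    have "\<bar>(-1) ^ k * s * t\<bar> = t" using assms by (simp add: abs_mult power_abs)
    then show ?thesis unfolding b_def by linarith
  qed
  have b0: "b k > 0" for k using b[of k] assms by linarith
  have eq: "f k / (A * \<mu> ^ k * b k) - 1 = d k / (A * b k)" for k
  proof -
    have "d k = f k / \<mu> ^ k - A * b k" by (simp add: d_def b_def algebra_simps)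
    then have fk: "f k = (d k + A * b k) * \<mu> ^ k" using assms(2) by (simp add: field_simps)
    show ?thesis unfolding fk using b0[of k] assms(2,3) by (simp add: field_simps)
  qed
  have "(\<lambda>k. f k / (A * \<mu> ^ k * b k) - 1) \<longlonglongrightarrow> 0"
  proof (rule tendsto_0_le)
    show "d \<longlonglongrightarrow> 0" unfolding d_def by (rule lim)
    show "\<forall>\<^sub>F k in sequentially. norm (f k / (A * \<mu> ^ k * b k) - 1) \<le> norm (d k) * (1 / (\<bar>A\<bar> * (1 - t)))"
    proof (rule always_eventually, rule allI)
      fix k
      have "norm (f k / (A * \<mu> ^ k * b k) - 1) = \<bar>d k\<bar> / (\<bar>A\<bar> * b k)"
        unfolding eq using b0[of k] by (simp add: abs_mult)
      also have "\<dots> \<le> \<bar>d k\<bar> / (\<bar>A\<bar> * (1 - t))"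
        using b[of k] b0[of k] assms by (intro divide_left_mono mult_left_mono mult_pos_pos) auto
      finally show "norm (f k / (A * \<mu> ^ k * b k) - 1) \<le> norm (d k) * (1 / (\<bar>A\<bar> * (1 - t)))" by simp
    qed
  qed
  then show "(\<lambda>k. f k / (A * \<mu> ^ k * (1 + (-1) ^ k * s * t))) \<longlonglongrightarrow> 1"
    unfolding b_def by (simp add: LIM_zero_iff)
qed

text \<open>One formula for all four cases: \<open>(n + 1) div 2\<close> is also n/2 for even n,
  \<open>mirror_ratio\<close> selects the product by the parity of m, and the second term is
  switched off when both numbers are odd.\<close>

lemma walks_asymptotics:
  fixes \<eta> :: "nat \<Rightarrow> int"
  assumes "n \<ge> 1" "m > 0" and \<eta>: "(\<lambda>i. real_of_int (\<eta> i)) \<in> alcove_C n m"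
  shows "(\<lambda>k. real (card (walks n (alcove_C n m) (\<lambda>i. real_of_int (\<eta> i)) k))) \<sim>[at_top]
    (\<lambda>k. P_factor n m \<eta> k * (Q_factor n m +
      (-1) powi ((\<Sum>i=1..n. \<eta> i) + int k + int ((n + 1) div 2)) * 2 powi (- (int n ^ 2)) *
      inverse (Delta_factor n m) * (if even m \<or> even n then mirror_ratio n m else 0)))"
proof -
  let ?N = "\<lambda>k. real (card (walks n (alcove_C n m) (\<lambda>i. real_of_int (\<eta> i)) k))"
  have N: "?N k = walk_sum n m k \<eta>" for k by (rule card_walks_eq_walk_sum[OF assms])
  \<comment> \<open>A lattice point of the alcove has n distinct coordinates in {1..m-1}.\<close>
  have nm: "n < m"
  proof -
    have "\<eta> i \<in> {1..int m - 1}" if "i \<in> {1..n}" for i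
      using alcove_range[OF \<eta> that] by auto
    moreover have "inj_on \<eta> {1..n}"
    proof (rule linorder_inj_onI)
      fix i j assume "i < j" "i \<in> {1..n}" "j \<in> {1..n}"
      then show "\<eta> i \<noteq> \<eta> j" using alcove_mono[OF \<eta>, of i j] by simp
    qed auto
    ultimately have "card {1..n} \<le> card {1..int m - 1}" by (intro card_inj_on_le[of \<eta>]) auto
    then show ?thesis using assms(1,2) by simp
  qed
  let ?t = "if even m \<or> even n then mirror_ratio n m else 0"
  show ?thesis
  proof (cases "n + 1 = m")
    case True
    \<comment> \<open>Here (n + 1)\<pi> / (2m) is \<pi>/2, so the base of the k-th power in
      \<open>P_factor\<close> is 0. From k = 1 on both sides vanish, hence they are eventually
      equal.\<close>
    have "?N k = 0 \<and> P_factor n m \<eta> k = 0" if "k \<ge> 1" for k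
    proof
      show "?N k = 0" unfolding N using walk_sum_single_point[OF assms(2) True that] .
      have n1: "real n + 1 = real m" using True by linarith
      have c: "(real n + 1) * pi / (2 * real m) = pi / 2" unfolding n1 using assms(2) by simp
      show "P_factor n m \<eta> k = 0"
        unfolding P_factor_def c cos_pi_half using that by (simp add: power_0_left)
    qed
    then show ?thesis
      by (intro asymp_equiv_refl_ev eventually_mono[OF eventually_ge_at_top[of 1]]) simp
  next
    case False
    then have nm1: "n + 1 < m" using nm by simp
    define \<mu> where "\<mu> = 2 * (\<Sum>r\<in>{1..int n}. cosine m r)"
    define A where "A = spectral_coeff n m \<eta> {1..int n}"
    define s where "s = ((-1) powi ((\<Sum>i=1..n. \<eta> i) + int ((n + 1) div 2)) :: real)"
    have "?N \<sim>[at_top] (\<lambda>k. A * \<mu> ^ k * (1 + (-1) ^ k * s * ?t))"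
    proof (rule asymp_equiv_oscillating)
      show "\<mu> > 0" unfolding \<mu>_def by (rule walk_sum_asymptotics(1)[OF assms(1) nm1])
      show "(\<lambda>k. ?N k / \<mu> ^ k - (A + (-1) ^ k * (s * (?t * A)))) \<longlonglongrightarrow> 0"
        using walk_sum_asymptotics(2)[OF assms(1) nm1, of \<eta>, unfolded spectral_coeff_top[OF nm]]
        unfolding N \<mu>_def A_def s_def by (simp only: mult.assoc)
      show "A \<noteq> 0" unfolding A_def by (rule spectral_coeff_bottom(2)[OF \<eta> nm])
      show "\<bar>s\<bar> = 1" unfolding s_def by (simp add: power_int_minus_left)
      show "0 \<le> ?t" "?t < 1" using mirror_ratio_less_1[OF assms(1) nm1] by auto
    qed
    also have "(\<lambda>k. A * \<mu> ^ k * (1 + (-1) ^ k * s * ?t)) = (\<lambda>k. P_factor n m \<eta> k * (Q_factor n m +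
      (-1) powi ((\<Sum>i=1..n. \<eta> i) + int k + int ((n + 1) div 2)) * 2 powi (- (int n ^ 2)) *
      inverse (Delta_factor n m) * ?t))"
    proof
      fix k
      have AP: "A * \<mu> ^ k = P_factor n m \<eta> k * Q_factor n m"
        unfolding A_def \<mu>_def by (rule spectral_coeff_bottom(1)[OF \<eta> nm])
      \<comment> \<open>This makes the whole bracket a multiple of \<open>Q\<close>, to be compared
        with A times the oscillating factor.\<close>
      have Q: "2 powi (- (int n ^ 2)) * inverse (Delta_factor n m) = Q_factor n m"
      proof -
        have "2 powi (- (int n ^ 2)) = inverse (2 ^ n\<^sup>2 :: real)"
          by (simp only: power_int_minus power_int_of_nat of_nat_power[symmetric])
        then have "2 powi (- (int n ^ 2)) * inverse (Delta_factor n m) = inverse (2 ^ n\<^sup>2 * Delta_factor n m)"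
          by (simp add: inverse_mult_distrib)
        also have "\<dots> = Q_factor n m"
          using Q_factor_eq[OF nm] Delta_factor_eq[of n m] nm
          by (metis inverse_unique less_imp_le mult.commute)
        finally show ?thesis .
      qed
      have "(-1) powi ((\<Sum>i=1..n. \<eta> i) + int k + int ((n + 1) div 2)) = ((-1) ^ k * s :: real)"
        unfolding s_def by (simp add: power_int_add mult_ac)
      then have "(-1) powi ((\<Sum>i=1..n. \<eta> i) + int k + int ((n + 1) div 2)) * 2 powi (- (int n ^ 2)) *
          inverse (Delta_factor n m) * ?t = (-1) ^ k * s * Q_factor n m * ?t"
        by (simp only: Q mult.assoc[of _ "2 powi _" "inverse _"])
      then show "A * \<mu> ^ k * (1 + (-1) ^ k * s * ?t) = P_factor n m \<eta> k * (Q_factor n m +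
        (-1) powi ((\<Sum>i=1..n. \<eta> i) + int k + int ((n + 1) div 2)) * 2 powi (- (int n ^ 2)) *
        inverse (Delta_factor n m) * ?t)"
        unfolding AP by (simp only: algebra_simps)
    qed
    finally show ?thesis .
  qed
qed

theorem theorem22:
  fixes n m :: nat and \<eta> :: "nat \<Rightarrow> int"
  assumes "n \<ge> 1" and "m > 0"
    and "(\<lambda>i. real_of_int (\<eta> i)) \<in> alcove_C n m"
  defines "N \<equiv> \<lambda>k. real (card (walks n (alcove_C n m) (\<lambda>i. real_of_int (\<eta> i)) k))"
  shows
    "(even m \<and> even n \<longrightarrow>
       N \<sim>[at_top] (\<lambda>k. P_factor n m \<eta> k *
         (Q_factor n m +
          (-1) powi ((\<Sum>i = 1..n. \<eta> i) + int k + int (n div 2)) *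
          2 powi (- (int n ^ 2)) * inverse (Delta_factor n m) *
          (\<Prod>h = 1..n div 2. tan ((2 * real h - 1) * pi / (2 * real m)) ^ 2)))) \<and>
     (even m \<and> odd n \<longrightarrow>
       N \<sim>[at_top] (\<lambda>k. P_factor n m \<eta> k *
         (Q_factor n m +
          (-1) powi ((\<Sum>i = 1..n. \<eta> i) + int k + int ((n + 1) div 2)) *
          2 powi (- (int n ^ 2)) * inverse (Delta_factor n m) *
          (\<Prod>h = 1..(n + 1) div 2. tan ((2 * real h - 1) * pi / (2 * real m)) ^ 2)))) \<and>
     (odd m \<and> even n \<longrightarrow>
       N \<sim>[at_top] (\<lambda>k. P_factor n m \<eta> k *
         (Q_factor n m +
          (-1) powi ((\<Sum>i = 1..n. \<eta> i) + int k + int (n div 2)) *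
          2 powi (- (int n ^ 2)) * inverse (Delta_factor n m) *
          (\<Prod>h = 1..n div 2. sin ((2 * real h - 1) * pi / (2 * real m)) ^ 2 /
                              cos (real h * pi / real m) ^ 2)))) \<and>
     (odd m \<and> odd n \<longrightarrow>
       N \<sim>[at_top] (\<lambda>k. P_factor n m \<eta> k * Q_factor n m))"
proof -
  have half: "(n + 1) div 2 = n div 2" if "even n" using that by (auto elim: evenE)
  note main = walks_asymptotics[OF assms(1-3), folded N_def]
  show ?thesis
  proof (intro conjI impI; elim conjE)
    assume "even m" "even n"
    then show "N \<sim>[at_top] (\<lambda>k. P_factor n m \<eta> k *
         (Q_factor n m +
          (-1) powi ((\<Sum>i = 1..n. \<eta> i) + int k + int (n div 2)) *
          2 powi (- (int n ^ 2)) * inverse (Delta_factor n m) *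
          (\<Prod>h = 1..n div 2. tan ((2 * real h - 1) * pi / (2 * real m)) ^ 2)))"
      using main by (simp only: mirror_ratio_def half if_True simp_thms)
  next
    assume "even m" "odd n"
    then show "N \<sim>[at_top] (\<lambda>k. P_factor n m \<eta> k *
         (Q_factor n m +
          (-1) powi ((\<Sum>i = 1..n. \<eta> i) + int k + int ((n + 1) div 2)) *
          2 powi (- (int n ^ 2)) * inverse (Delta_factor n m) *
          (\<Prod>h = 1..(n + 1) div 2. tan ((2 * real h - 1) * pi / (2 * real m)) ^ 2)))"
      using main by (simp only: mirror_ratio_def if_True simp_thms)
  next
    assume "odd m" "even n"
    then show "N \<sim>[at_top] (\<lambda>k. P_factor n m \<eta> k *
         (Q_factor n m +
          (-1) powi ((\<Sum>i = 1..n. \<eta> i) + int k + int (n div 2)) *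
          2 powi (- (int n ^ 2)) * inverse (Delta_factor n m) *
          (\<Prod>h = 1..n div 2. sin ((2 * real h - 1) * pi / (2 * real m)) ^ 2 /
                              cos (real h * pi / real m) ^ 2)))"
      using main by (simp only: mirror_ratio_def half if_True if_False simp_thms)
  next
    assume "odd m" "odd n"
    then show "N \<sim>[at_top] (\<lambda>k. P_factor n m \<eta> k * Q_factor n m)"
      using main by (simp only: if_False simp_thms mult_zero_right add_0_right)
  qed
qed

end
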